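(* Let $n\ge 2$ and let $g$ be the contravariant metric on the orbit space $\mathbb{C}^n/B_n$ induced by $g^{ij}(p)=\frac{1-\delta^{ij}}{p_ip_j}$, written in the basic invariants $u_1,\dots,u_n$ (normalized by dividing by the constant $4(n-1)$), and let $\eta^{ij}(u)=\frac{\partial g^{ij}}{\partial u_{n-1}}(u)$. Then the flat pencil of contravariant metrics $g-\lambda\eta$ gives rise to a Dubrovin–Frobenius manifold structure on $\mathbb{C}^n/B_n$ (on the open subset where $u_n\neq 0$), whose invariant flat metric is $\eta$ and whose intersection form is $g$.
   Context: $B_n$ is the hyperoctahedral Coxeter group acting on $\mathbb{C}^n$ (coordinates $p_1,\dots,p_n$) by permutations and sign changes of the coordinates, i.e. generated by the reflections in the hyperplanes $p_j=0$ and $p_i\pm p_j=0$. The basic invariants are $u_k=\sum_{1\le i_1<\dots<i_k\le n}p_{i_1}^2\cdots p_{i_k}^2$ ($k=1,\dots,n$), with $u_0=1$ and $u_k=0$ for $k<0$ or $k>n$; so $u_n=(p_1\cdots p_n)^2$. The cometric in these coordinates is $g^{ij}(u)=\sum_{k,l}g^{kl}(p)\frac{\partial u_i}{\partial p_k}\frac{\partial u_j}{\partial p_l}$ (it is polynomial in $u$). A pair of contravariant metrics $(g,\eta)$ is a flat pencil if $g-\lambda\eta$ is flat for every $\lambda$ and its contravariant Christoffel symbols are $\Gamma^{ij}_{g,k}-\lambda\Gamma^{ij}_{\eta,k}$. A Dubrovin–Frobenius manifold is a manifold with a flat metric $\eta$, a commutative associative product $\circ$ on tangent spaces with $\eta(X\circ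 Y,Z)=\eta(X,Y\circ Z)$, $\nabla^\eta$-flat unit $e$, symmetric $\nabla^\eta c$ for the structure constants $c$, and an Euler vector field $E$ with $[e,E]=e$, $\mathcal{L}_E\circ=\circ$, $\mathcal{L}_E\eta=(2-d)\eta$; its intersection form is the cometric $(E\circ)\eta^{-1}$. *)

theory Defs
  imports "HOL-Analysis.Analysis"
begin

text \<open>Points of C^n are modelled as functions nat => complex, the relevant
  coordinates being those with index in {1..n}.  Tensor fields are given by
  their components (indices in {1..n}) in the coordinate system at hand.\<close>

type_synonym pt = "nat \<Rightarrow> complex"
type_synonym cometric = "pt \<Rightarrow> nat \<Rightarrow> nat \<Rightarrow> complex"

definition pd :: "nat \<Rightarrow> (pt \<Rightarrow> complex) \<Rightarrow> pt \<Rightarrow> complex" where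
  "pd k f x = deriv (\<lambda>t. f (x(k := t))) (x k)"

text \<open>Holomorphy on U (separately holomorphic at every point of the open set U,
  which by Hartogs' theorem is holomorphy).\<close>
definition holo_on :: "nat \<Rightarrow> pt set \<Rightarrow> (pt \<Rightarrow> complex) \<Rightarrow> bool" where
  "holo_on n U f \<longleftrightarrow>
     (\<forall>x\<in>U. \<forall>k\<in>{1..n}. (\<lambda>t. f (x(k := t))) field_differentiable (at (x k)))"

definition bu :: "nat \<Rightarrow> nat \<Rightarrow> pt \<Rightarrow> complex" where
  "bu n k p = (\<Sum>S\<in>{S. S \<subseteq> {1..n} \<and> card S = k}. \<Prod>i\<in>S. (p i)^2)"

definition umap :: "nat \<Rightarrow> pt \<Rightarrow> pt" where
  "umap n p = (\<lambda>k. if k \<in> {1..n} then bu n k p else 0)"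

definition gBp :: "pt \<Rightarrow> nat \<Rightarrow> nat \<Rightarrow> complex" where
  "gBp p k l = (if k = l then 0 else 1 / (p k * p l))"

definition gBu :: "nat \<Rightarrow> pt \<Rightarrow> nat \<Rightarrow> nat \<Rightarrow> complex" where
  "gBu n p i j = (\<Sum>k\<in>{1..n}. \<Sum>l\<in>{1..n}.
       gBp p k l * pd k (bu n i) p * pd l (bu n j) p)"

definition orbit_domain :: "nat \<Rightarrow> pt set" where
  "orbit_domain n = {u. (\<forall>k. k \<notin> {1..n} \<longrightarrow> u k = 0) \<and> u n \<noteq> 0}"

definition nondeg :: "nat \<Rightarrow> cometric \<Rightarrow> pt \<Rightarrow> bool" where
  "nondeg n h x \<longleftrightarrow> (\<exists>M. \<forall>a\<in>{1..n}. \<forall>c\<in>{1..n}.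
      (\<Sum>b\<in>{1..n}. h x a b * M b c) = (if a = c then 1 else 0))"

definition lower :: "nat \<Rightarrow> cometric \<Rightarrow> cometric" where
  "lower n h x = (THE M. (\<forall>a b. (a \<notin> {1..n} \<or> b \<notin> {1..n}) \<longrightarrow> M a b = 0) \<and>
      (\<forall>a\<in>{1..n}. \<forall>c\<in>{1..n}. (\<Sum>b\<in>{1..n}. h x a b * M b c) = (if a = c then 1 else 0)))"

definition christ :: "nat \<Rightarrow> cometric \<Rightarrow> pt \<Rightarrow> nat \<Rightarrow> nat \<Rightarrow> nat \<Rightarrow> complex" where
  "christ n h x k i j = (1/2) * (\<Sum>l\<in>{1..n}. h x k l *
      (pd i (\<lambda>y. lower n h y j l) x + pd j (\<lambda>y. lower n h y i l) x
       - pd l (\<lambda>y. lower n h y i j) x))"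

definition riemann :: "nat \<Rightarrow> cometric \<Rightarrow> pt \<Rightarrow> nat \<Rightarrow> nat \<Rightarrow> nat \<Rightarrow> nat \<Rightarrow> complex" where
  "riemann n h x l i j k =
     pd j (\<lambda>y. christ n h y l i k) x - pd k (\<lambda>y. christ n h y l i j) x
     + (\<Sum>m\<in>{1..n}. christ n h x l j m * christ n h x m i k
                    - christ n h x l k m * christ n h x m i j)"

definition contra_christ :: "nat \<Rightarrow> cometric \<Rightarrow> pt \<Rightarrow> nat \<Rightarrow> nat \<Rightarrow> nat \<Rightarrow> complex" where
  "contra_christ n h x i j k = - (\<Sum>a\<in>{1..n}. h x i a * christ n h x j a k)"

definition is_cometric :: "nat \<Rightarrow> pt set \<Rightarrow> cometric \<Rightarrow> bool" where
  "is_cometric n U h \<longleftrightarrow> (\<forall>i\<in>{1..n}. \<forall>j\<in>{1..n}.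
      holo_on n U (\<lambda>x. h x i j) \<and> (\<forall>x\<in>U. h x i j = h x j i))"

definition flat_on :: "nat \<Rightarrow> pt set \<Rightarrow> cometric \<Rightarrow> bool" where
  "flat_on n U h \<longleftrightarrow> is_cometric n U h \<and>
     (\<forall>x\<in>U. nondeg n h x \<longrightarrow>
        (\<forall>l\<in>{1..n}. \<forall>i\<in>{1..n}. \<forall>j\<in>{1..n}. \<forall>k\<in>{1..n}. riemann n h x l i j k = 0))"

definition flat_pencil :: "nat \<Rightarrow> pt set \<Rightarrow> cometric \<Rightarrow> cometric \<Rightarrow> bool" where
  "flat_pencil n U g \<eta> \<longleftrightarrow> is_cometric n U g \<and> is_cometric n U \<eta> \<and>
     (\<forall>s::complex.
        flat_on n U (\<lambda>x i j. g x i j - s * \<eta> x i j) \<and>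
        (\<forall>x\<in>U. nondeg n g x \<and> nondeg n \<eta> x \<and> nondeg n (\<lambda>x i j. g x i j - s * \<eta> x i j) x \<longrightarrow>
           (\<forall>i\<in>{1..n}. \<forall>j\<in>{1..n}. \<forall>k\<in>{1..n}.
              contra_christ n (\<lambda>x i j. g x i j - s * \<eta> x i j) x i j k
              = contra_christ n g x i j k - s * contra_christ n \<eta> x i j k)))"

text \<open>c x i j k: structure constants, d_i o d_j = sum_k c_{ij}^k d_k;
  e, E: components of unit and Euler vector fields; d: charge.\<close>

definition clow :: "nat \<Rightarrow> cometric \<Rightarrow> (pt \<Rightarrow> nat \<Rightarrow> nat \<Rightarrow> nat \<Rightarrow> complex)
    \<Rightarrow> pt \<Rightarrow> nat \<Rightarrow> nat \<Rightarrow> nat \<Rightarrow> complex" where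
  "clow n \<eta> c x i j k = (\<Sum>a\<in>{1..n}. c x i j a * lower n \<eta> x a k)"

definition nabla_c :: "nat \<Rightarrow> cometric \<Rightarrow> (pt \<Rightarrow> nat \<Rightarrow> nat \<Rightarrow> nat \<Rightarrow> complex)
    \<Rightarrow> pt \<Rightarrow> nat \<Rightarrow> nat \<Rightarrow> nat \<Rightarrow> nat \<Rightarrow> complex" where
  "nabla_c n \<eta> c x l i j k = pd l (\<lambda>y. clow n \<eta> c y i j k) x
     - (\<Sum>a\<in>{1..n}. christ n \<eta> x a l i * clow n \<eta> c x a j k
                    + christ n \<eta> x a l j * clow n \<eta> c x i a k
                    + christ n \<eta> x a l k * clow n \<eta> c x i j a)"

definition frobenius_structure :: "nat \<Rightarrow> pt set \<Rightarrow> cometric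
    \<Rightarrow> (pt \<Rightarrow> nat \<Rightarrow> nat \<Rightarrow> nat \<Rightarrow> complex) \<Rightarrow> (pt \<Rightarrow> nat \<Rightarrow> complex) \<Rightarrow> (pt \<Rightarrow> nat \<Rightarrow> complex)
    \<Rightarrow> complex \<Rightarrow> bool" where
  "frobenius_structure n U \<eta> c e E d \<longleftrightarrow>
     \<comment> \<open>flat nondegenerate metric\<close>
     is_cometric n U \<eta> \<and> (\<forall>x\<in>U. nondeg n \<eta> x) \<and> flat_on n U \<eta> \<and>
     \<comment> \<open>holomorphic data\<close>
     (\<forall>i\<in>{1..n}. \<forall>j\<in>{1..n}. \<forall>k\<in>{1..n}. holo_on n U (\<lambda>x. c x i j k)) \<and>
     (\<forall>k\<in>{1..n}. holo_on n U (\<lambda>x. e x k) \<and> holo_on n U (\<lambda>x. E x k)) \<and>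
     (\<forall>x\<in>U. \<forall>i\<in>{1..n}. \<forall>j\<in>{1..n}. \<forall>k\<in>{1..n}.
        \<comment> \<open>commutativity\<close>
        c x i j k = c x j i k \<and>
        \<comment> \<open>invariance: eta(d_i o d_j, d_k) = eta(d_i, d_j o d_k)\<close>
        (\<Sum>a\<in>{1..n}. c x i j a * lower n \<eta> x a k) = (\<Sum>a\<in>{1..n}. lower n \<eta> x i a * c x j k a)) \<and>
     \<comment> \<open>associativity\<close>
     (\<forall>x\<in>U. \<forall>i\<in>{1..n}. \<forall>j\<in>{1..n}. \<forall>k\<in>{1..n}. \<forall>l\<in>{1..n}.
        (\<Sum>m\<in>{1..n}. c x i j m * c x m k l) = (\<Sum>m\<in>{1..n}. c x j k m * c x i m l)) \<and>
     \<comment> \<open>unit and its flatness\<close>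
     (\<forall>x\<in>U. \<forall>j\<in>{1..n}. \<forall>k\<in>{1..n}.
        (\<Sum>i\<in>{1..n}. e x i * c x i j k) = (if j = k then 1 else 0) \<and>
        pd j (\<lambda>y. e y k) x + (\<Sum>i\<in>{1..n}. christ n \<eta> x k j i * e x i) = 0) \<and>
     \<comment> \<open>symmetry of nabla c\<close>
     (\<forall>x\<in>U. \<forall>l\<in>{1..n}. \<forall>i\<in>{1..n}. \<forall>j\<in>{1..n}. \<forall>k\<in>{1..n}.
        nabla_c n \<eta> c x l i j k = nabla_c n \<eta> c x i l j k) \<and>
     \<comment> \<open>Euler field: [e,E] = e\<close>
     (\<forall>x\<in>U. \<forall>k\<in>{1..n}.
        (\<Sum>i\<in>{1..n}. e x i * pd i (\<lambda>y. E y k) x - E x i * pd i (\<lambda>y. e y k) x) = e x k) \<and>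
     \<comment> \<open>Lie_E (o) = o\<close>
     (\<forall>x\<in>U. \<forall>i\<in>{1..n}. \<forall>j\<in>{1..n}. \<forall>k\<in>{1..n}.
        (\<Sum>a\<in>{1..n}. E x a * pd a (\<lambda>y. c y i j k) x - c x i j a * pd a (\<lambda>y. E y k) x
                      + c x a j k * pd i (\<lambda>y. E y a) x + c x i a k * pd j (\<lambda>y. E y a) x)
        = c x i j k) \<and>
     \<comment> \<open>Lie_E eta = (2 - d) eta  (covariant metric)\<close>
     (\<forall>x\<in>U. \<forall>i\<in>{1..n}. \<forall>j\<in>{1..n}.
        (\<Sum>a\<in>{1..n}. E x a * pd a (\<lambda>y. lower n \<eta> y i j) x
                      + lower n \<eta> x a j * pd i (\<lambda>y. E y a) x
                      + lower n \<eta> x i a * pd j (\<lambda>y. E y a) x)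
        = (2 - d) * lower n \<eta> x i j)"

definition intersection_form_is :: "nat \<Rightarrow> pt set \<Rightarrow> cometric
    \<Rightarrow> (pt \<Rightarrow> nat \<Rightarrow> nat \<Rightarrow> nat \<Rightarrow> complex) \<Rightarrow> (pt \<Rightarrow> nat \<Rightarrow> complex) \<Rightarrow> cometric \<Rightarrow> bool" where
  "intersection_form_is n U \<eta> c E g \<longleftrightarrow>
     (\<forall>x\<in>U. \<forall>i\<in>{1..n}. \<forall>j\<in>{1..n}.
        g x i j = (\<Sum>k\<in>{1..n}. \<Sum>a\<in>{1..n}. E x k * \<eta> x i a * c x a k j))"

end

(*
  Put P(z) = prod (z + p_k^2) = sum u_k z^(n-k).  In generating form,
  (n-1) g(z,w) = P'(z)P'(w) - (P(z)P'(w) - P'(z)P(w))/(z-w), and the contravariant Christoffel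
  symbols of g are given by an analogous expression, linear in P and in its variation.  Compatibility,
  vanishing torsion and flatness become rational identities in the values of P at three points; they
  hold for every P of degree at most n.  Shifting u_(n-1) replaces P by P - s z, which gives
  g - s eta, so the same identities cover the whole pencil.

  With Q = z P' - P one has (n-1) eta(z,w) = (Q(z) - Q(w))/(z-w) and (n-1) g = Bezoutian of Q and P'.
  Hence the Frobenius algebra is C[z]/Q, with d/du_i = z^(n-1-i) and Euler field P'(z).  Its
  invariants are read off the power series D = sum (n-1-k)/(n-1) u_k x^k and R = 1/D: eta is the
  Hankel matrix of D, its inverse the Hankel matrix of R, and the lowered product tensor c_(ijk)
  depends on i+j+k only.
*)

theory Submission
  imports Defs "Jordan_Normal_Form.Determinant" "HOL-Computational_Algebra.Computational_Algebra"
begin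


section \<open>Differentiability of inverse matrices\<close>

text \<open>Christoffel symbols and curvature are defined through the inverse matrix of the
  cometric, and the inverse of g is never computed. The proof therefore works with contravariant
  symbols Gamma^{ij}_k, for which compatibility, torsion and curvature are polynomial in g, Gamma
  and their derivatives; the inverse only has to exist and be differentiable. In the constant
  4(n-1), the 4 comes from the factors 2 p_k in du_i/dp_k, whose p_k cancel 1/(p_k p_l); the n-1
  makes D(0) = 1. The condition u_n \<noteq> 0 says Q(0) = -u_n is nonzero, so that z is invertible
  in C[z]/Q and d/du_n = z^(-1) makes sense. The lowered product is a residue: for N = i+j+k it is
  (n-1) times the sum over the zeros of Q of Res z^(3n-1-N)/Q. It can be read off at infinity as a
  coefficient of R, except for i = j = k = n, where the pole at 0 contributes (n-1)/u_n.\<close>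

lemma det_mat_field_differentiable:
  fixes H :: "complex \<Rightarrow> nat \<Rightarrow> nat \<Rightarrow> complex"
  assumes "\<And>i j. i < m \<Longrightarrow> j < m \<Longrightarrow> (\<lambda>t. H t i j) field_differentiable (at t0)"
  shows "(\<lambda>t. Determinant.det (mat m m (\<lambda>(i,j). H t i j))) field_differentiable (at t0)"
proof -
  have prod_diff: "(\<lambda>t. \<Prod>i\<in>S. f t i) field_differentiable (at t0)"
    if "\<And>i. i \<in> S \<Longrightarrow> (\<lambda>t. f t i) field_differentiable (at t0)" "finite S"
    for f :: "complex \<Rightarrow> nat \<Rightarrow> complex" and S
    using that(2,1)
    by (induction S rule: finite_induct) (auto intro!: field_differentiable_mult)
  have eq: "Determinant.det (mat m m (\<lambda>(i,j). H t i j))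
      = (\<Sum>p\<in>{p. p permutes {0..<m}}. signof p * (\<Prod>i\<in>{0..<m}. H t i (p i)))" for t
  proof -
    have "mat m m (\<lambda>(i,j). H t i j) $$ (i, p i) = H t i (p i)"
      if "p permutes {0..<m}" "i \<in> {0..<m}" for p i
      using that permutes_in_image[OF that(1), of i] by simp
    thus ?thesis
      by (subst Determinant.det_def'[of _ m]) (auto intro!: sum.cong prod.cong)
  qed
  show ?thesis
    unfolding eq
    using assms permutes_in_image
    by (intro field_differentiable_sum field_differentiable_mult prod_diff) fastforce+
qed

lemma sum_unit_vector:
  fixes f g :: "'a \<Rightarrow> 'b::semiring_1"
  assumes "finite I" "a \<in> I" "\<And>b. b \<in> I \<Longrightarrow> f b = (if a = b then 1 else 0)"
  shows "(\<Sum>b\<in>I. f b * g b) = g a" and "(\<Sum>b\<in>I. g b * f b) = g a"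
proof -
  have "(\<Sum>b\<in>I. f b * g b) = (\<Sum>b\<in>I. if a = b then g b else 0)"
    using assms(3) by (intro sum.cong) auto
  thus "(\<Sum>b\<in>I. f b * g b) = g a" using assms(1,2) by simp
  have "(\<Sum>b\<in>I. g b * f b) = (\<Sum>b\<in>I. if a = b then g b else 0)"
    using assms(3) by (intro sum.cong) auto
  thus "(\<Sum>b\<in>I. g b * f b) = g a" using assms(1,2) by simp
qed

text \<open>Cramer's rule: determinant and adjugate are polynomial in the entries of H, and a
  nonzero determinant stays nonzero near t0. This gives a differentiable local formula for
  \<open>lower\<close>, which is only a definite description.\<close>

lemma inverse_matrix_differentiable:
  fixes H :: "complex \<Rightarrow> nat \<Rightarrow> nat \<Rightarrow> complex"
  assumes diff: "\<And>i j. i \<in> {1..n} \<Longrightarrow> j \<in> {1..n} \<Longrightarrow> (\<lambda>t. H t i j) field_differentiable (at t0)"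
    and inv: "\<And>a c. a \<in> {1..n} \<Longrightarrow> c \<in> {1..n} \<Longrightarrow>
      (\<Sum>b\<in>{1..n}. H t0 a b * M b c) = (if a = c then 1 else 0)"
  obtains K where
    "\<forall>\<^sub>F t in nhds t0. \<forall>a\<in>{1..n}. \<forall>c\<in>{1..n}. (\<Sum>b\<in>{1..n}. H t a b * K t b c) = (if a = c then 1 else 0)"
    "\<And>a b. a \<in> {1..n} \<Longrightarrow> b \<in> {1..n} \<Longrightarrow> (\<lambda>t. K t a b) field_differentiable (at t0)"
proof -
  \<comment> \<open>Library matrices are indexed from 0, coordinates from 1.\<close>
  have sum_shift: "(\<Sum>b\<in>{1..n}. f b) = (\<Sum>b = 0..<n. f (Suc b))" for f :: "nat \<Rightarrow> complex"
    using sum.shift_bounds_Suc_ivl[of f 0 n] by (simp add: atLeastLessThanSuc_atLeastAtMost)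
  define A where "A t = mat n n (\<lambda>(i,j). H t (Suc i) (Suc j))" for t
  have A: "A t \<in> carrier_mat n n" for t by (simp add: A_def)
  have dA: "(\<lambda>t. Determinant.det (A t)) field_differentiable (at t0)"
    unfolding A_def by (rule det_mat_field_differentiable) (use diff in auto)
  have "A t0 * mat n n (\<lambda>(i,j). M (Suc i) (Suc j)) = 1\<^sub>m n"
  proof (rule eq_matI)
    fix i j assume "i < dim_row (1\<^sub>m n :: complex mat)" "j < dim_col (1\<^sub>m n :: complex mat)"
    thus "(A t0 * mat n n (\<lambda>(i,j). M (Suc i) (Suc j))) $$ (i, j) = 1\<^sub>m n $$ (i, j)"
      using inv[of "Suc i" "Suc j"] unfolding sum_shift by (auto simp: A_def scalar_prod_def)
  qed (auto simp: A_def)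
  hence "Determinant.det (A t0) * Determinant.det (mat n n (\<lambda>(i,j). M (Suc i) (Suc j))) = 1"
    using det_mult[OF A, of "mat n n (\<lambda>(i,j). M (Suc i) (Suc j))" t0] by simp
  hence d0: "Determinant.det (A t0) \<noteq> 0" by auto
  have "isCont (\<lambda>t. Determinant.det (A t)) t0"
    using dA field_differentiable_imp_continuous_at by blast
  hence ev: "\<forall>\<^sub>F t in nhds t0. Determinant.det (A t) \<noteq> 0"
    using d0 by (simp add: tendsto_nhds_iff isCont_def tendsto_imp_eventually_ne eventually_nhds_conv_at)
  define K where "K t a b = adj_mat (A t) $$ (a - 1, b - 1) / Determinant.det (A t)" for t a b
  show thesis
  proof (rule that[of K])
    show "\<forall>\<^sub>F t in nhds t0. \<forall>a\<in>{1..n}. \<forall>c\<in>{1..n}. (\<Sum>b\<in>{1..n}. H t a b * K t b c) = (if a = c then 1 else 0)"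
      using ev
    proof eventually_elim
      case (elim t)
      show ?case
      proof (intro ballI)
        fix a c assume ac: "a \<in> {1..n}" "c \<in> {1..n}"
        have ad: "adj_mat (A t) \<in> carrier_mat n n" by (rule adj_mat(1)[OF A])
        have "(A t * adj_mat (A t)) $$ (a - 1, c - 1) = (Determinant.det (A t) \<cdot>\<^sub>m 1\<^sub>m n) $$ (a - 1, c - 1)"
          by (simp add: adj_mat(2)[OF A])
        moreover have "(A t * adj_mat (A t)) $$ (a - 1, c - 1)
            = (\<Sum>b\<in>{1..n}. H t a b * adj_mat (A t) $$ (b - 1, c - 1))"
          unfolding sum_shift using ac ad by (auto simp: A_def scalar_prod_def intro!: sum.cong)
        moreover have "(Determinant.det (A t) \<cdot>\<^sub>m 1\<^sub>m n) $$ (a - 1, c - 1) = (if a = c then Determinant.det (A t) else 0)"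
          using ac by auto
        ultimately have "(\<Sum>b\<in>{1..n}. H t a b * adj_mat (A t) $$ (b - 1, c - 1)) = (if a = c then Determinant.det (A t) else 0)"
          by simp
        thus "(\<Sum>b\<in>{1..n}. H t a b * K t b c) = (if a = c then 1 else 0)"
          using elim by (simp add: K_def flip: sum_divide_distrib)
      qed
    qed
    fix a b assume ab: "a \<in> {1..n}" "b \<in> {1..n}"
    \<comment> \<open>The adjugate transposes, so row b - 1 and column a - 1 are deleted; the
      cofactor is again a determinant in entries of H.\<close>
    have eq: "adj_mat (A t) $$ (a - 1, b - 1) = (-1)^(b - 1 + (a - 1)) * Determinant.det
       (mat (n - 1) (n - 1) (\<lambda>(i,j). H t (Suc (if i < b - 1 then i else Suc i)) (Suc (if j < a - 1 then j else Suc j))))" for t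
      using ab unfolding adj_mat_def cofactor_def mat_delete_def A_def
      by (auto intro!: arg_cong[of _ _ Determinant.det] eq_matI)
    have "(\<lambda>t. adj_mat (A t) $$ (a - 1, b - 1)) field_differentiable (at t0)"
      unfolding eq using diff
      by (intro field_differentiable_mult det_mat_field_differentiable) auto
    thus "(\<lambda>t. K t a b) field_differentiable (at t0)"
      unfolding K_def using dA d0 by (intro field_differentiable_divide) auto
  qed
qed

text \<open>Both sides arise from bracketing transpose(M) H M' in two ways. With M' = M this makes
  the inverse of a symmetric matrix symmetric; with two right inverses it makes them equal up to
  transposition.\<close>

lemma symmetric_inverse:
  fixes H M :: "nat \<Rightarrow> nat \<Rightarrow> complex"
  assumes sym: "\<And>a b. a \<in> {1..n} \<Longrightarrow> b \<in> {1..n} \<Longrightarrow> H a b = H b a"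
    and inv: "\<And>a c. a \<in> {1..n} \<Longrightarrow> c \<in> {1..n} \<Longrightarrow>
      (\<Sum>b\<in>{1..n}. H a b * M b c) = (if a = c then 1 else 0)"
    and inv': "\<And>a c. a \<in> {1..n} \<Longrightarrow> c \<in> {1..n} \<Longrightarrow>
      (\<Sum>b\<in>{1..n}. H a b * M' b c) = (if a = c then 1 else 0)"
    and "a \<in> {1..n}" "c \<in> {1..n}"
  shows "M' a c = M c a"
proof -
  have "(\<Sum>d\<in>{1..n}. M d a * (\<Sum>b\<in>{1..n}. H d b * M' b c)) = M c a"
    using assms by (intro sum_unit_vector(2)) auto
  moreover have "(\<Sum>d\<in>{1..n}. M d a * (\<Sum>b\<in>{1..n}. H d b * M' b c))
      = (\<Sum>b\<in>{1..n}. (\<Sum>d\<in>{1..n}. H b d * M d a) * M' b c)"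
    unfolding sum_distrib_left sum_distrib_right
    by (subst sum.swap) (auto intro!: sum.cong simp: sym)
  moreover have "\<dots> = M' a c"
    using assms by (intro sum_unit_vector(1)) auto
  ultimately show ?thesis by simp
qed

text \<open>Zero entries outside the index range make the right inverse unique as a function, which
  the description in \<open>lower\<close> requires.\<close>

lemma lower_eqI:
  assumes sym: "\<And>a b. a \<in> {1..n} \<Longrightarrow> b \<in> {1..n} \<Longrightarrow> h x a b = h x b a"
    and inv: "\<And>a c. a \<in> {1..n} \<Longrightarrow> c \<in> {1..n} \<Longrightarrow>
      (\<Sum>b\<in>{1..n}. h x a b * M b c) = (if a = c then 1 else 0)"
    and "a \<in> {1..n}" "c \<in> {1..n}"
  shows "lower n h x a c = M a c"
proof -
  define M0 where "M0 = (\<lambda>a b. if a \<in> {1..n} \<and> b \<in> {1..n} then M a b else 0)"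
  have M0: "(\<Sum>b\<in>{1..n}. h x a b * M0 b c) = (if a = c then 1 else 0)"
    if "a \<in> {1..n}" "c \<in> {1..n}" for a c
    unfolding inv[OF that, symmetric] using that by (intro sum.cong) (auto simp: M0_def)
  have "lower n h x = M0"
    unfolding lower_def
  proof (rule the_equality, intro conjI allI ballI impI)
    fix M' assume M': "(\<forall>a b. (a \<notin> {1..n} \<or> b \<notin> {1..n}) \<longrightarrow> M' a b = 0) \<and>
      (\<forall>a\<in>{1..n}. \<forall>c\<in>{1..n}. (\<Sum>b\<in>{1..n}. h x a b * M' b c) = (if a = c then 1 else 0))"
    show "M' = M0"
    proof (intro ext)
      fix a b
      show "M' a b = M0 a b"
      proof (cases "a \<in> {1..n} \<and> b \<in> {1..n}")
        case True
        \<comment> \<open>\<open>symmetric_inverse\<close> is applied twice: it transposes from M'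
          to M0, then within M0.\<close>
        have "M' a b = M0 b a"
          by (rule symmetric_inverse[where H="h x" and n=n]) (use True M' sym M0 in blast)+
        also have "\<dots> = M0 a b"
          by (rule symmetric_inverse[where H="h x" and n=n]) (use True sym M0 in blast)+
        finally show ?thesis .
      qed (use M' in \<open>auto simp: M0_def\<close>)
    qed
  qed (use M0 in \<open>auto simp: M0_def\<close>)
  thus ?thesis using assms by (simp add: M0_def)
qed

section \<open>Contravariant connections\<close>

text \<open>Dubrovin's form of a flat Levi-Civita connection: \<Gamma> x i j k is minus h^{ia} times
  the Christoffel symbol with upper index j and lower indices a, k. No axiom involves the inverse of
  h, so all of them can hold where h degenerates. \<open>nhds_in_U\<close> is openness along
  coordinate lines.\<close>

locale contravariant_flat =
  fixes n :: nat and U :: "pt set" and h :: cometric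
    and \<Gamma> :: "pt \<Rightarrow> nat \<Rightarrow> nat \<Rightarrow> nat \<Rightarrow> complex"
    and d\<Gamma> :: "nat \<Rightarrow> pt \<Rightarrow> nat \<Rightarrow> nat \<Rightarrow> nat \<Rightarrow> complex"
  assumes nhds_in_U: "x \<in> U \<Longrightarrow> k \<in> {1..n} \<Longrightarrow> \<forall>\<^sub>F t in nhds (x k). x(k := t) \<in> U"
    and metric_deriv: "x \<in> U \<Longrightarrow> i \<in> {1..n} \<Longrightarrow> j \<in> {1..n} \<Longrightarrow> k \<in> {1..n} \<Longrightarrow>
      ((\<lambda>t. h (x(k := t)) i j) has_field_derivative \<Gamma> x i j k + \<Gamma> x j i k) (at (x k))"
    and metric_sym: "x \<in> U \<Longrightarrow> i \<in> {1..n} \<Longrightarrow> j \<in> {1..n} \<Longrightarrow> h x i j = h x j i"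
    and torsion_free: "x \<in> U \<Longrightarrow> i \<in> {1..n} \<Longrightarrow> j \<in> {1..n} \<Longrightarrow> k \<in> {1..n} \<Longrightarrow>
      (\<Sum>s\<in>{1..n}. h x i s * \<Gamma> x j k s) = (\<Sum>s\<in>{1..n}. h x j s * \<Gamma> x i k s)"
    and Gamma_deriv: "x \<in> U \<Longrightarrow> i \<in> {1..n} \<Longrightarrow> j \<in> {1..n} \<Longrightarrow> k \<in> {1..n} \<Longrightarrow> m \<in> {1..n} \<Longrightarrow>
      ((\<lambda>t. \<Gamma> (x(m := t)) i j k) has_field_derivative d\<Gamma> m x i j k) (at (x m))"
    and curvature: "x \<in> U \<Longrightarrow> p \<in> {1..n} \<Longrightarrow> r \<in> {1..n} \<Longrightarrow> l \<in> {1..n} \<Longrightarrow> k \<in> {1..n} \<Longrightarrow>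
      (\<Sum>j\<in>{1..n}. h x p j * (d\<Gamma> j x r l k - d\<Gamma> k x r l j)) =
      (\<Sum>a\<in>{1..n}. \<Gamma> x p r a * \<Gamma> x a l k - \<Gamma> x p l a * \<Gamma> x a r k)"
begin

lemma inverse_lower:
  assumes "x \<in> U" "nondeg n h x" "a \<in> {1..n}" "c \<in> {1..n}"
  shows "(\<Sum>b\<in>{1..n}. h x a b * lower n h x b c) = (if a = c then 1 else 0)"
proof -
  obtain M where M: "\<forall>a\<in>{1..n}. \<forall>c\<in>{1..n}. (\<Sum>b\<in>{1..n}. h x a b * M b c) = (if a = c then 1 else 0)"
    using assms(2) by (auto simp: nondeg_def)
  have "lower n h x b c = M b c" if "b \<in> {1..n}" for b
    by (rule lower_eqI) (use M that assms metric_sym in auto)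
  hence "(\<Sum>b\<in>{1..n}. h x a b * lower n h x b c) = (\<Sum>b\<in>{1..n}. h x a b * M b c)"
    by (intro sum.cong) auto
  thus ?thesis using M assms by simp
qed

lemma lower_sym:
  assumes "x \<in> U" "nondeg n h x" "a \<in> {1..n}" "b \<in> {1..n}"
  shows "lower n h x a b = lower n h x b a"
  by (rule symmetric_inverse[where H="h x" and n=n])
     (use assms metric_sym inverse_lower in auto)

lemma lower_inverse:
  assumes "x \<in> U" "nondeg n h x" "a \<in> {1..n}" "c \<in> {1..n}"
  shows "(\<Sum>b\<in>{1..n}. lower n h x a b * h x b c) = (if a = c then 1 else 0)"
proof -
  have "(\<Sum>b\<in>{1..n}. lower n h x a b * h x b c) = (\<Sum>b\<in>{1..n}. h x c b * lower n h x b a)"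
    using assms by (intro sum.cong) (auto simp: lower_sym[OF assms(1,2)] metric_sym[OF assms(1)])
  thus ?thesis using inverse_lower[OF assms(1,2,4,3)] by auto
qed

text \<open>Derivatives of \<open>lower\<close> at x are meaningful once nearby points are
  nondegenerate too; both facts come from the same local inverse.\<close>

lemma eventually_nondeg:
  assumes "x \<in> U" "nondeg n h x" "k \<in> {1..n}"
  shows "\<forall>\<^sub>F t in nhds (x k). x(k := t) \<in> U \<and> nondeg n h (x(k := t))"
    and "i \<in> {1..n} \<Longrightarrow> j \<in> {1..n} \<Longrightarrow>
      (\<lambda>t. lower n h (x(k := t)) i j) field_differentiable (at (x k))"
proof -
  obtain M where M: "\<forall>a\<in>{1..n}. \<forall>c\<in>{1..n}. (\<Sum>b\<in>{1..n}. h x a b * M b c) = (if a = c then 1 else 0)"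
    using assms(2) by (auto simp: nondeg_def)
  obtain K where K:
    "\<forall>\<^sub>F t in nhds (x k). \<forall>a\<in>{1..n}. \<forall>c\<in>{1..n}. (\<Sum>b\<in>{1..n}. h (x(k := t)) a b * K t b c) = (if a = c then 1 else 0)"
    "\<And>a b. a \<in> {1..n} \<Longrightarrow> b \<in> {1..n} \<Longrightarrow> (\<lambda>t. K t a b) field_differentiable (at (x k))"
  proof (rule inverse_matrix_differentiable[of n "\<lambda>t. h (x(k := t))" "x k" M])
    show "(\<lambda>t. h (x(k := t)) i j) field_differentiable at (x k)"
      if "i \<in> {1..n}" "j \<in> {1..n}" for i j
      using metric_deriv[OF assms(1) that assms(3)] field_differentiable_def by blast
  qed (use M in auto)
  note ev = eventually_conj[OF nhds_in_U[OF assms(1,3)] K(1)]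
  show "\<forall>\<^sub>F t in nhds (x k). x(k := t) \<in> U \<and> nondeg n h (x(k := t))"
    using ev unfolding nondeg_def by (rule eventually_mono) blast
  assume ij: "i \<in> {1..n}" "j \<in> {1..n}"
  have "\<forall>\<^sub>F t in nhds (x k). K t i j = lower n h (x(k := t)) i j"
    using ev
  proof (rule eventually_mono, goal_cases)
    case (1 t)
    show ?case by (rule lower_eqI[symmetric]) (use 1 ij metric_sym in blast)+
  qed
  thus "(\<lambda>t. lower n h (x(k := t)) i j) field_differentiable (at (x k))"
    using K(2)[OF ij] has_field_derivative_cong_ev[of "x k" "x k" UNIV "\<lambda>t. K t i j" "\<lambda>t. lower n h (x(k := t)) i j"]
    unfolding field_differentiable_def by (auto simp: eventually_nhds_x_imp_x)
qed

text \<open>Christoffel symbols of the second kind with upper index b, recovered by lowering the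
  first index of \<Gamma>; \<open>christ_eq\<close> identifies them with the Levi-Civita
  ones.\<close>

definition \<gamma> :: "pt \<Rightarrow> nat \<Rightarrow> nat \<Rightarrow> nat \<Rightarrow> complex" where
  "\<gamma> x b j i = - (\<Sum>a\<in>{1..n}. lower n h x j a * \<Gamma> x a b i)"

lemma Gamma_eq:
  assumes "x \<in> U" "nondeg n h x" "a \<in> {1..n}"
  shows "\<Gamma> x a b k = - (\<Sum>j\<in>{1..n}. h x a j * \<gamma> x b j k)"
proof -
  have "(\<Sum>j\<in>{1..n}. h x a j * (\<Sum>c\<in>{1..n}. lower n h x j c * \<Gamma> x c b k))
      = (\<Sum>c\<in>{1..n}. (\<Sum>j\<in>{1..n}. h x a j * lower n h x j c) * \<Gamma> x c b k)"
    unfolding sum_distrib_left sum_distrib_right mult.assoc by (rule sum.swap)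
  also have "\<dots> = \<Gamma> x a b k"
    using assms by (intro sum_unit_vector(1) inverse_lower) auto
  finally show ?thesis by (simp add: \<gamma>_def sum_negf)
qed

text \<open>Lowering the two metric indices in \<open>torsion_free\<close> turns its exchange of
  upper indices into an exchange of lower ones.\<close>

lemma gamma_sym:
  assumes "x \<in> U" "nondeg n h x" "b \<in> {1..n}" "j \<in> {1..n}" "i \<in> {1..n}"
  shows "\<gamma> x b j i = \<gamma> x b i j"
proof -
  have expand: "\<gamma> x b j i = - (\<Sum>a\<in>{1..n}. \<Sum>r\<in>{1..n}. lower n h x j a * lower n h x i r *
      (\<Sum>s\<in>{1..n}. h x r s * \<Gamma> x a b s))" if "i \<in> {1..n}" for i j
  proof -
    have "(\<Sum>r\<in>{1..n}. lower n h x i r * (\<Sum>s\<in>{1..n}. h x r s * \<Gamma> x a b s)) = \<Gamma> x a b i" for a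
    proof -
      have "(\<Sum>r\<in>{1..n}. lower n h x i r * (\<Sum>s\<in>{1..n}. h x r s * \<Gamma> x a b s))
          = (\<Sum>s\<in>{1..n}. (\<Sum>r\<in>{1..n}. lower n h x i r * h x r s) * \<Gamma> x a b s)"
        unfolding sum_distrib_left sum_distrib_right mult.assoc by (rule sum.swap)
      also have "\<dots> = \<Gamma> x a b i" using assms that by (intro sum_unit_vector(1) lower_inverse) auto
      finally show ?thesis .
    qed
    thus ?thesis by (simp add: \<gamma>_def mult.assoc flip: sum_distrib_left)
  qed
  have "(\<Sum>a\<in>{1..n}. \<Sum>r\<in>{1..n}. lower n h x j a * lower n h x i r * (\<Sum>s\<in>{1..n}. h x r s * \<Gamma> x a b s))
     = (\<Sum>r\<in>{1..n}. \<Sum>a\<in>{1..n}. lower n h x i r * lower n h x j a * (\<Sum>s\<in>{1..n}. h x a s * \<Gamma> x r b s))"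
    by (subst sum.swap) (use assms torsion_free in \<open>auto intro!: sum.cong\<close>)
  thus ?thesis using expand[of i j] expand[of j i] assms by simp
qed

text \<open>Covariant form of metric compatibility. The derivative exists by
  \<open>eventually_nondeg\<close>, so differentiating the product of h and its inverse determines
  it.\<close>

lemma lower_has_derivative:
  assumes "x \<in> U" "nondeg n h x" "i \<in> {1..n}" "j \<in> {1..n}" "m \<in> {1..n}"
  shows "((\<lambda>t. lower n h (x(i := t)) j m) has_field_derivative
     (\<Sum>b\<in>{1..n}. \<gamma> x b j i * lower n h x b m) + (\<Sum>b\<in>{1..n}. lower n h x j b * \<gamma> x b m i)) (at (x i))"
proof -
  define L where "L = (\<lambda>a b. deriv (\<lambda>t. lower n h (x(i := t)) a b) (x i))"
  have L: "((\<lambda>t. lower n h (x(i := t)) a b) has_field_derivative L a b) (at (x i))"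
    if "a \<in> {1..n}" "b \<in> {1..n}" for a b
    using eventually_nondeg(2)[OF assms(1-3) that] unfolding L_def
    by (simp add: field_differentiable_derivI)
  have key: "(\<Sum>b\<in>{1..n}. h x a b * L b m) = - (\<Sum>b\<in>{1..n}. (\<Gamma> x a b i + \<Gamma> x b a i) * lower n h x b m)"
    if a: "a \<in> {1..n}" for a
  proof -
    have "((\<lambda>t. \<Sum>b\<in>{1..n}. h (x(i := t)) a b * lower n h (x(i := t)) b m) has_field_derivative
        (\<Sum>b\<in>{1..n}. (\<Gamma> x a b i + \<Gamma> x b a i) * lower n h x b m + L b m * h x a b)) (at (x i))"
    proof (rule DERIV_sum)
      fix b assume b: "b \<in> {1..n}"
      show "((\<lambda>t. h (x(i := t)) a b * lower n h (x(i := t)) b m) has_field_derivative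
          (\<Gamma> x a b i + \<Gamma> x b a i) * lower n h x b m + L b m * h x a b) (at (x i))"
        using DERIV_mult[OF metric_deriv[OF assms(1) a b assms(3)] L[OF b assms(5)]] by simp
    qed
    moreover have "\<forall>\<^sub>F t in nhds (x i). (\<Sum>b\<in>{1..n}. h (x(i := t)) a b * lower n h (x(i := t)) b m) = (if a = m then 1 else 0)"
      using eventually_nondeg(1)[OF assms(1-3)]
      by (rule eventually_mono) (use inverse_lower a assms in auto)
    hence "((\<lambda>t. \<Sum>b\<in>{1..n}. h (x(i := t)) a b * lower n h (x(i := t)) b m) has_field_derivative 0) (at (x i))"
      by (subst DERIV_cong_ev[OF refl _ refl]) auto
    ultimately have "(\<Sum>b\<in>{1..n}. (\<Gamma> x a b i + \<Gamma> x b a i) * lower n h x b m + L b m * h x a b) = 0"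
      by (rule DERIV_unique)
    thus ?thesis by (simp add: sum.distrib mult.commute eq_neg_iff_add_eq_0 add.commute)
  qed
  have "L j m = (\<Sum>a\<in>{1..n}. lower n h x j a * (\<Sum>b\<in>{1..n}. h x a b * L b m))"
  proof -
    have "(\<Sum>a\<in>{1..n}. lower n h x j a * (\<Sum>b\<in>{1..n}. h x a b * L b m))
        = (\<Sum>b\<in>{1..n}. (\<Sum>a\<in>{1..n}. lower n h x j a * h x a b) * L b m)"
      unfolding sum_distrib_left sum_distrib_right mult.assoc by (rule sum.swap)
    also have "\<dots> = L j m" using assms by (intro sum_unit_vector(1) lower_inverse) auto
    finally show ?thesis by simp
  qed
  also have "\<dots> = (\<Sum>a\<in>{1..n}. \<Sum>b\<in>{1..n}. - (lower n h x j a * \<Gamma> x a b i * lower n h x b m))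
      + (\<Sum>a\<in>{1..n}. \<Sum>b\<in>{1..n}. - (lower n h x j a * (lower n h x b m * \<Gamma> x b a i)))"
    unfolding sum.distrib[symmetric]
  proof (intro sum.cong refl)
    fix a assume "a \<in> {1..n}"
    show "lower n h x j a * (\<Sum>b\<in>{1..n}. h x a b * L b m) =
      (\<Sum>b\<in>{1..n}. - (lower n h x j a * \<Gamma> x a b i * lower n h x b m)
         + - (lower n h x j a * (lower n h x b m * \<Gamma> x b a i)))"
      unfolding key[OF \<open>a \<in> {1..n}\<close>] sum_negf[symmetric] sum_distrib_left
      by (intro sum.cong refl) (simp add: algebra_simps)
  qed
  also have "(\<Sum>a\<in>{1..n}. \<Sum>b\<in>{1..n}. - (lower n h x j a * \<Gamma> x a b i * lower n h x b m))
     = (\<Sum>b\<in>{1..n}. \<gamma> x b j i * lower n h x b m)"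
    by (subst sum.swap) (simp add: \<gamma>_def sum_negf sum_distrib_right)
  also have "(\<Sum>a\<in>{1..n}. \<Sum>b\<in>{1..n}. - (lower n h x j a * (lower n h x b m * \<Gamma> x b a i)))
     = (\<Sum>b\<in>{1..n}. lower n h x j b * \<gamma> x b m i)"
    using assms by (auto simp: \<gamma>_def sum_negf sum_distrib_left lower_sym[OF assms(1,2)] intro!: sum.cong)
  finally show ?thesis using L[OF assms(4,5)] by simp
qed

text \<open>Uniqueness of the Levi-Civita connection: S j i m is the symbol with its upper index
  lowered to m, symmetric in j and i, and the three derivatives in the Koszul formula collapse to 2
  S i j l.\<close>

lemma christ_eq:
  assumes "x \<in> U" "nondeg n h x" "k \<in> {1..n}" "i \<in> {1..n}" "j \<in> {1..n}"
  shows "christ n h x k i j = \<gamma> x k i j"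
proof -
  define S where "S j i m = (\<Sum>b\<in>{1..n}. \<gamma> x b j i * lower n h x b m)" for j i m
  have pd: "pd i (\<lambda>y. lower n h y j m) x = S j i m + S m i j"
    if "i \<in> {1..n}" "j \<in> {1..n}" "m \<in> {1..n}" for i j m
  proof -
    have "(\<Sum>b\<in>{1..n}. lower n h x j b * \<gamma> x b m i) = S m i j"
      unfolding S_def
    proof (rule sum.cong[OF refl])
      fix b assume b: "b \<in> {1..n}"
      show "lower n h x j b * \<gamma> x b m i = \<gamma> x b m i * lower n h x b j"
        by (simp only: lower_sym[OF assms(1,2) that(2) b] mult.commute)
    qed
    thus ?thesis
      unfolding pd_def DERIV_imp_deriv[OF lower_has_derivative[OF assms(1,2) that]] S_def by simp
  qed
  have S: "S j i m = S i j m" if "i \<in> {1..n}" "j \<in> {1..n}" for i j m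
    unfolding S_def using gamma_sym[OF assms(1,2) _ that(2,1)] by (intro sum.cong) auto
  have "christ n h x k i j = (1/2) * (\<Sum>l\<in>{1..n}. h x k l * (2 * S i j l))"
    unfolding christ_def
  proof (intro arg_cong[of _ _ "(*) (1/2)"] sum.cong refl)
    fix l assume l: "l \<in> {1..n}"
    show "h x k l * (pd i (\<lambda>y. lower n h y j l) x + pd j (\<lambda>y. lower n h y i l) x - pd l (\<lambda>y. lower n h y i j) x)
        = h x k l * (2 * S i j l)"
      unfolding pd[OF assms(4,5) l] pd[OF assms(5,4) l] pd[OF l assms(4,5)]
        S[OF assms(4,5), of l] S[OF assms(4) l, of j] S[OF assms(5) l, of i] by simp
  qed
  also have "\<dots> = (\<Sum>l\<in>{1..n}. \<Sum>b\<in>{1..n}. h x k l * lower n h x l b * \<gamma> x b i j)"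
    by (auto simp: S_def sum_distrib_left lower_sym[OF assms(1,2)] intro!: sum.cong)
  also have "\<dots> = (\<Sum>b\<in>{1..n}. (\<Sum>l\<in>{1..n}. h x k l * lower n h x l b) * \<gamma> x b i j)"
    unfolding sum_distrib_right by (rule sum.swap)
  also have "\<dots> = \<gamma> x k i j"
    using assms by (intro sum_unit_vector(1) inverse_lower) auto
  finally show ?thesis .
qed

lemma contra_christ_eq:
  assumes "x \<in> U" "nondeg n h x" "i \<in> {1..n}" "j \<in> {1..n}" "k \<in> {1..n}"
  shows "contra_christ n h x i j k = \<Gamma> x i j k"
  unfolding contra_christ_def Gamma_eq[OF assms(1-3)]
  using assms by (intro arg_cong[of _ _ uminus] sum.cong) (auto simp: christ_eq)

lemma gamma_has_derivative:
  assumes "x \<in> U" "nondeg n h x" "l \<in> {1..n}" "i \<in> {1..n}" "k \<in> {1..n}" "j \<in> {1..n}"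
  shows "((\<lambda>t. \<gamma> (x(j := t)) l i k) has_field_derivative
    (\<Sum>b\<in>{1..n}. \<gamma> x b i j * \<gamma> x l b k)
     - (\<Sum>b\<in>{1..n}. lower n h x i b * ((\<Sum>a\<in>{1..n}. \<gamma> x b a j * \<Gamma> x a l k) + d\<Gamma> j x b l k))) (at (x j))"
proof -
  have "((\<lambda>t. \<gamma> (x(j := t)) l i k) has_field_derivative
     - (\<Sum>a\<in>{1..n}. ((\<Sum>b\<in>{1..n}. \<gamma> x b i j * lower n h x b a) + (\<Sum>b\<in>{1..n}. lower n h x i b * \<gamma> x b a j)) * \<Gamma> x a l k
        + d\<Gamma> j x a l k * lower n h x i a)) (at (x j))" (is "(_ has_field_derivative ?d) _")
    unfolding \<gamma>_def[of "x(j := _)" l i k]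
  proof (intro DERIV_minus DERIV_sum)
    fix a assume a: "a \<in> {1..n}"
    show "((\<lambda>t. lower n h (x(j := t)) i a * \<Gamma> (x(j := t)) a l k) has_field_derivative
      ((\<Sum>b\<in>{1..n}. \<gamma> x b i j * lower n h x b a) + (\<Sum>b\<in>{1..n}. lower n h x i b * \<gamma> x b a j)) * \<Gamma> x a l k
        + d\<Gamma> j x a l k * lower n h x i a) (at (x j))"
      using DERIV_mult[OF lower_has_derivative[OF assms(1,2,6,4) a] Gamma_deriv[OF assms(1) a assms(3,5,6)]] by simp
  qed
  moreover have "?d = (\<Sum>b\<in>{1..n}. \<gamma> x b i j * \<gamma> x l b k)
     - (\<Sum>b\<in>{1..n}. lower n h x i b * ((\<Sum>a\<in>{1..n}. \<gamma> x b a j * \<Gamma> x a l k) + d\<Gamma> j x b l k))"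
  proof -
    have 1: "(\<Sum>a\<in>{1..n}. \<Sum>b\<in>{1..n}. \<gamma> x b i j * lower n h x b a * \<Gamma> x a l k) = - (\<Sum>b\<in>{1..n}. \<gamma> x b i j * \<gamma> x l b k)"
      by (subst sum.swap) (simp add: \<gamma>_def[of x l] sum_distrib_left mult.assoc sum_negf)
    have 2: "(\<Sum>a\<in>{1..n}. \<Sum>b\<in>{1..n}. lower n h x i b * \<gamma> x b a j * \<Gamma> x a l k)
      = (\<Sum>b\<in>{1..n}. lower n h x i b * (\<Sum>a\<in>{1..n}. \<gamma> x b a j * \<Gamma> x a l k))"
      by (subst sum.swap) (simp add: sum_distrib_left mult.assoc)
    show ?thesis
      using 1 2 by (simp add: distrib_right distrib_left sum.distrib sum_distrib_right mult.commute[of "d\<Gamma> _ _ _ _ _"])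
  qed
  ultimately show ?thesis by simp
qed

lemma riemann_eq_0:
  assumes "x \<in> U" "nondeg n h x" "l \<in> {1..n}" "i \<in> {1..n}" "j \<in> {1..n}" "k \<in> {1..n}"
  shows "riemann n h x l i j k = 0"
proof -
  have pd: "pd j (\<lambda>y. christ n h y l i k) x = (\<Sum>b\<in>{1..n}. \<gamma> x b i j * \<gamma> x l b k)
     - (\<Sum>b\<in>{1..n}. lower n h x i b * ((\<Sum>a\<in>{1..n}. \<gamma> x b a j * \<Gamma> x a l k) + d\<Gamma> j x b l k))"
    if "j \<in> {1..n}" "k \<in> {1..n}" for j k
  proof -
    have "\<forall>\<^sub>F t in nhds (x j). christ n h (x(j := t)) l i k = \<gamma> (x(j := t)) l i k"
      using eventually_nondeg(1)[OF assms(1,2) that(1)]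
      by (rule eventually_mono) (use christ_eq assms that in auto)
    hence "deriv (\<lambda>t. christ n h (x(j := t)) l i k) (x j) = deriv (\<lambda>t. \<gamma> (x(j := t)) l i k) (x j)"
      by (intro deriv_cong_ev) auto
    also have "\<dots> = (\<Sum>b\<in>{1..n}. \<gamma> x b i j * \<gamma> x l b k)
     - (\<Sum>b\<in>{1..n}. lower n h x i b * ((\<Sum>a\<in>{1..n}. \<gamma> x b a j * \<Gamma> x a l k) + d\<Gamma> j x b l k))"
      by (rule DERIV_imp_deriv, rule gamma_has_derivative) (use assms that in auto)
    finally show ?thesis by (simp add: pd_def)
  qed
  \<comment> \<open>Up to sign, \<open>B\<close> is the part of the curvature with index i raised to
    b; raising j as well turns its vanishing into the axiom \<open>curvature\<close>.\<close>
  define B where "B b j = (\<Sum>a\<in>{1..n}. \<gamma> x b a j * \<Gamma> x a l k) + d\<Gamma> j x b l k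
      - ((\<Sum>a\<in>{1..n}. \<gamma> x b a k * \<Gamma> x a l j) + d\<Gamma> k x b l j)" for b j
  have hB: "(\<Sum>j\<in>{1..n}. h x p j * B b j) = 0" if p: "p \<in> {1..n}" and b: "b \<in> {1..n}" for p b
  proof -
    have 1: "(\<Sum>j\<in>{1..n}. h x p j * (\<Sum>a\<in>{1..n}. \<gamma> x b a j * \<Gamma> x a l k)) = - (\<Sum>a\<in>{1..n}. \<Gamma> x p b a * \<Gamma> x a l k)"
    proof -
      have "(\<Sum>j\<in>{1..n}. h x p j * (\<Sum>a\<in>{1..n}. \<gamma> x b a j * \<Gamma> x a l k))
         = (\<Sum>a\<in>{1..n}. (\<Sum>j\<in>{1..n}. h x p j * \<gamma> x b j a) * \<Gamma> x a l k)"
        unfolding sum_distrib_left sum_distrib_right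
        by (subst sum.swap) (use gamma_sym[OF assms(1,2) b] in \<open>auto intro!: sum.cong simp: mult.assoc\<close>)
      thus ?thesis using Gamma_eq[OF assms(1,2) p, of b] by (simp add: sum_negf)
    qed
    have 2: "(\<Sum>j\<in>{1..n}. h x p j * (\<Sum>a\<in>{1..n}. \<gamma> x b a k * \<Gamma> x a l j)) = - (\<Sum>a\<in>{1..n}. \<Gamma> x p l a * \<Gamma> x a b k)"
    proof -
      have "(\<Sum>j\<in>{1..n}. h x p j * (\<Sum>a\<in>{1..n}. \<gamma> x b a k * \<Gamma> x a l j))
         = (\<Sum>a\<in>{1..n}. \<gamma> x b a k * (\<Sum>j\<in>{1..n}. h x p j * \<Gamma> x a l j))"
        unfolding sum_distrib_left by (subst sum.swap) (auto intro!: sum.cong)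
      \<comment> \<open>\<open>torsion_free\<close> moves the contraction onto the index shared with
        \<gamma>, so that h and \<gamma> recombine to a \<Gamma>.\<close>
      also have "\<dots> = (\<Sum>a\<in>{1..n}. \<gamma> x b a k * (\<Sum>j\<in>{1..n}. h x a j * \<Gamma> x p l j))"
        using torsion_free[OF assms(1) p _ assms(3)] by (auto intro!: sum.cong)
      also have "\<dots> = (\<Sum>j\<in>{1..n}. \<Gamma> x p l j * (\<Sum>a\<in>{1..n}. h x j a * \<gamma> x b a k))"
        unfolding sum_distrib_left by (subst sum.swap) (auto intro!: sum.cong simp: metric_sym[OF assms(1)])
      also have "\<dots> = - (\<Sum>j\<in>{1..n}. \<Gamma> x p l j * \<Gamma> x j b k)"
        unfolding sum_negf[symmetric] by (intro sum.cong refl) (simp add: Gamma_eq[OF assms(1,2), of _ b k])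
      finally show ?thesis .
    qed
    show ?thesis
      using curvature[OF assms(1) p b assms(3,6)]
      unfolding B_def distrib_left right_diff_distrib sum.distrib sum_subtractf 1 2 by (simp add: algebra_simps)
  qed
  have B0: "B b j = 0" if "b \<in> {1..n}" "j \<in> {1..n}" for b j
  proof -
    have "(\<Sum>p\<in>{1..n}. lower n h x j p * (\<Sum>i\<in>{1..n}. h x p i * B b i))
       = (\<Sum>i\<in>{1..n}. (\<Sum>p\<in>{1..n}. lower n h x j p * h x p i) * B b i)"
      unfolding sum_distrib_left sum_distrib_right mult.assoc by (rule sum.swap)
    also have "\<dots> = B b j"
      using assms that by (intro sum_unit_vector(1) lower_inverse) auto
    finally show ?thesis using hB that by simp
  qed
  have "riemann n h x l i j k = - (\<Sum>b\<in>{1..n}. lower n h x i b * B b j)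
     + ((\<Sum>b\<in>{1..n}. \<gamma> x b i j * \<gamma> x l b k) - (\<Sum>b\<in>{1..n}. \<gamma> x b i k * \<gamma> x l b j)
     + (\<Sum>m\<in>{1..n}. \<gamma> x l j m * \<gamma> x m i k - \<gamma> x l k m * \<gamma> x m i j))"
  proof -
    have "(\<Sum>m\<in>{1..n}. christ n h x l j m * christ n h x m i k - christ n h x l k m * christ n h x m i j)
       = (\<Sum>m\<in>{1..n}. \<gamma> x l j m * \<gamma> x m i k - \<gamma> x l k m * \<gamma> x m i j)"
      using assms by (intro sum.cong refl) (simp add: christ_eq)
    thus ?thesis
      unfolding riemann_def pd[OF assms(5,6)] pd[OF assms(6,5)] B_def right_diff_distrib sum_subtractf by simp
  qed
  \<comment> \<open>The products of Christoffel symbols in \<open>riemann\<close> cancel the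
    quadratic terms that came from differentiating \<open>lower\<close>.\<close>
  also have "(\<Sum>m\<in>{1..n}. \<gamma> x l j m * \<gamma> x m i k - \<gamma> x l k m * \<gamma> x m i j)
     = (\<Sum>b\<in>{1..n}. \<gamma> x b i k * \<gamma> x l b j) - (\<Sum>b\<in>{1..n}. \<gamma> x b i j * \<gamma> x l b k)"
    unfolding sum_subtractf[symmetric]
    using gamma_sym[OF assms(1,2)] assms by (intro sum.cong) (auto simp: mult.commute)
  finally show ?thesis using B0 assms by simp
qed

lemma is_cometric: "is_cometric n U h"
  using metric_deriv metric_sym unfolding is_cometric_def holo_on_def field_differentiable_def by blast

lemma flat_on: "flat_on n U h"
  using is_cometric riemann_eq_0 unfolding flat_on_def by blast

end


section \<open>Bezoutians\<close>

hide_const (open) Module.smult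

text \<open>\<open>bezout_row s X Y\<close> is the coefficient of \<open>z ^ s\<close>, as a polynomial in \<open>w\<close>, of the Bezoutian
  \<open>(X(z) Y(w) - Y(z) X(w)) / (z - w)\<close>; the \<open>_gen\<close> versions below sum the rows against \<open>z ^ s\<close>.\<close>

definition bezout_row :: "nat \<Rightarrow> complex poly \<Rightarrow> complex poly \<Rightarrow> complex poly" where
  "bezout_row s X Y = poly_shift (Suc s) X * Y - poly_shift (Suc s) Y * X"

definition metric_row :: "nat \<Rightarrow> complex poly \<Rightarrow> complex poly" where
  "metric_row s P = smult (poly.coeff (pderiv P) s) (pderiv P) - bezout_row s P (pderiv P)"

text \<open>Polarization of the quadratic map \<open>metric_row s\<close>: its derivative at P in
  the direction Y.\<close>

definition metric_row_deriv :: "nat \<Rightarrow> complex poly \<Rightarrow> complex poly \<Rightarrow> complex poly" where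
  "metric_row_deriv s P Y = smult (poly.coeff (pderiv Y) s) (pderiv P) + smult (poly.coeff (pderiv P) s) (pderiv Y)
     - bezout_row s Y (pderiv P) - bezout_row s P (pderiv Y)"

text \<open>Contravariant Christoffel symbols at \<open>X\<close> in the direction \<open>Y\<close>: the rows of
  \<open>X'(z) Y'(w) - (X(z) Y'(w) - X'(z) Y(w)) / (z - w) - (X(z) Y(w) - X(w) Y(z)) / (z - w)\<^sup>2\<close>.\<close>

definition christoffel_row :: "nat \<Rightarrow> complex poly \<Rightarrow> complex poly \<Rightarrow> complex poly" where
  "christoffel_row s X Y = smult (poly.coeff (pderiv X) s) (pderiv Y) - pderiv (bezout_row s X Y) + bezout_row s (pderiv X) Y"

lemma poly_shift_add: "poly_shift s (X + Y) = poly_shift s X + poly_shift s (Y :: complex poly)"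
  by (simp add: poly_eq_iff coeff_poly_shift)

lemma poly_shift_smult: "poly_shift s (smult c X) = smult c (poly_shift s (X :: complex poly))"
  by (simp add: poly_eq_iff coeff_poly_shift)

lemma poly_shift_Suc: "poly_shift s X = pCons (poly.coeff X s) (poly_shift (Suc s) (X :: complex poly))"
proof (rule poly_eqI)
  fix i show "poly.coeff (poly_shift s X) i = poly.coeff (pCons (poly.coeff X s) (poly_shift (Suc s) X)) i"
    by (cases i) (simp_all add: coeff_poly_shift)
qed

lemma poly_shift_pderiv:
  "poly_shift (Suc s) (pderiv X) = pderiv (poly_shift (Suc s) X) + smult (of_nat (Suc s)) (poly_shift (Suc (Suc s)) (X :: complex poly))"
  by (simp add: poly_eq_iff coeff_poly_shift coeff_pderiv algebra_simps)

lemma bezout_row_anti: "bezout_row s Y X = - bezout_row s X Y"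
  by (simp add: bezout_row_def)

lemma bezout_row_add_left: "bezout_row s (X + X') Y = bezout_row s X Y + bezout_row s X' Y"
  by (simp add: bezout_row_def poly_shift_add algebra_simps)

lemma bezout_row_add_right: "bezout_row s X (Y + Y') = bezout_row s X Y + bezout_row s X Y'"
  by (simp add: bezout_row_def poly_shift_add algebra_simps)

lemma bezout_row_smult_left: "bezout_row s (smult c X) Y = smult c (bezout_row s X Y)"
  by (simp add: bezout_row_def poly_shift_smult smult_diff_right)

lemma bezout_row_smult_right: "bezout_row s X (smult c Y) = smult c (bezout_row s X Y)"
  by (simp add: bezout_row_def poly_shift_smult smult_diff_right)

text \<open>As a full convolution minus two initial segments the coefficient is visibly symmetric in
  s and t. The same form later produces the weights by which the intersection form is
  matched.\<close>

lemma coeff_bezout_row: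
  "poly.coeff (bezout_row s X Y) t = (\<Sum>j\<le>s + t + 1. poly.coeff X j * poly.coeff Y (s + t + 1 - j))
     - (\<Sum>j\<le>s. poly.coeff X j * poly.coeff Y (s + t + 1 - j))
     - (\<Sum>j\<le>t. poly.coeff X j * poly.coeff Y (s + t + 1 - j))"
proof -
  let ?f = "\<lambda>j. poly.coeff X j * poly.coeff Y (s + t + 1 - j)"
  have "(\<Sum>j\<le>s + t + 1. ?f j) = (\<Sum>j\<le>s. ?f j) + (\<Sum>j\<in>{Suc s..s + t + 1}. ?f j)"
  proof -
    have "{..s + t + 1} = {..s} \<union> {Suc s..s + t + 1}" by auto
    moreover have "{..s} \<inter> {Suc s..s + t + 1} = {}" by auto
    ultimately show ?thesis by (simp only: sum.union_disjoint[OF finite_atMost finite_atLeastAtMost])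
  qed
  moreover have "(\<Sum>j\<in>{Suc s..s + t + 1}. ?f j) = poly.coeff (poly_shift (Suc s) X * Y) t"
    unfolding coeff_mult coeff_poly_shift
    by (rule sum.reindex_bij_witness[of _ "\<lambda>i. i + Suc s" "\<lambda>j. j - Suc s"]) (auto simp: add.commute)
  moreover have "(\<Sum>j\<le>t. ?f j) = poly.coeff (poly_shift (Suc s) Y * X) t"
    unfolding coeff_mult coeff_poly_shift
    by (rule sum.reindex_bij_witness[of _ "\<lambda>j. t - j" "\<lambda>j. t - j"])
       (auto simp: mult.commute add.commute Suc_diff_le)
  ultimately show ?thesis by (simp add: bezout_row_def)
qed

lemma coeff_bezout_row_sym: "poly.coeff (bezout_row s X Y) t = poly.coeff (bezout_row t X Y) s"
  unfolding coeff_bezout_row by (simp add: add.commute)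

lemma coeff_bezout_row_eq_0:
  assumes "degree X \<le> N" "degree Y \<le> N" "N \<le> t"
  shows "poly.coeff (bezout_row s X Y) t = 0"
proof -
  have "poly_shift (Suc t) X = 0" "poly_shift (Suc t) Y = 0"
    using assms by (auto simp: poly_eq_iff coeff_poly_shift intro!: coeff_eq_0)
  thus ?thesis by (subst coeff_bezout_row_sym) (simp add: bezout_row_def)
qed

lemma degree_pderiv_le: "degree X \<le> N \<Longrightarrow> degree (pderiv (X :: complex poly)) \<le> N"
  by (simp add: degree_pderiv)

lemma coeff_pderiv_eq_0: "degree X \<le> N \<Longrightarrow> N \<le> t \<Longrightarrow> poly.coeff (pderiv (X :: complex poly)) t = 0"
  by (simp add: coeff_pderiv coeff_eq_0)

lemma coeff_metric_row_eq_0: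
  assumes "degree P \<le> N" "N \<le> t"
  shows "poly.coeff (metric_row s P) t = 0"
  using coeff_bezout_row_eq_0[OF assms(1) degree_pderiv_le[OF assms(1)] assms(2)] coeff_pderiv_eq_0[OF assms]
  by (simp add: metric_row_def)

lemma coeff_christoffel_row_eq_0:
  assumes "degree X \<le> N" "degree Y \<le> N" "N \<le> t"
  shows "poly.coeff (christoffel_row s X Y) t = 0"
proof -
  have "poly.coeff (bezout_row s X Y) (Suc t) = 0" by (rule coeff_bezout_row_eq_0) (use assms in auto)
  hence "poly.coeff (pderiv (bezout_row s X Y)) t = 0" by (simp add: coeff_pderiv)
  moreover have "poly.coeff (bezout_row s (pderiv X) Y) t = 0"
    by (rule coeff_bezout_row_eq_0[OF degree_pderiv_le[OF assms(1)] assms(2,3)])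
  ultimately show ?thesis using coeff_pderiv_eq_0[OF assms(2,3)] by (simp add: christoffel_row_def)
qed

lemma degree_metric_row: "degree P \<le> N \<Longrightarrow> degree (metric_row s P) \<le> N"
  by (intro degree_le) (auto intro: coeff_metric_row_eq_0)

lemma coeff_metric_row_sym: "poly.coeff (metric_row s P) t = poly.coeff (metric_row t P) s"
  by (simp add: metric_row_def coeff_bezout_row_sym[of s] mult.commute)

text \<open>The operator d/dz + d/dw annihilates 1 / (z - w) and is a derivation on the numerator of
  the Bezoutian. The second summand on the left is the d/dz part: differentiating z^(s+1) gives the
  factor Suc s.\<close>

lemma pderiv_bezout_row:
  "pderiv (bezout_row s X Y) + smult (of_nat (Suc s)) (bezout_row (Suc s) X Y) = bezout_row s (pderiv X) Y + bezout_row s X (pderiv Y)"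
  unfolding bezout_row_def poly_shift_pderiv
  by (simp add: pderiv_diff pderiv_mult algebra_simps smult_diff_right del: of_nat_Suc)

text \<open>Exchanging s and t turns the w-derivative of the Bezoutian into its z-derivative, and
  \<open>pderiv_bezout_row\<close> evaluates the sum of the two.\<close>

lemma christoffel_row_compatible:
  "poly.coeff (christoffel_row s X Y) t + poly.coeff (christoffel_row t X Y) s = poly.coeff (metric_row_deriv s X Y) t"
proof -
  have "poly.coeff (pderiv (bezout_row t X Y)) s = of_nat (Suc s) * poly.coeff (bezout_row (Suc s) X Y) t"
    by (simp only: coeff_pderiv coeff_bezout_row_sym[of t])
  moreover have "poly.coeff (pderiv (bezout_row s X Y)) t + of_nat (Suc s) * poly.coeff (bezout_row (Suc s) X Y) t
      = poly.coeff (bezout_row s (pderiv X) Y) t + poly.coeff (bezout_row s X (pderiv Y)) t"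
    using arg_cong[OF pderiv_bezout_row[of s X Y], of "\<lambda>p. poly.coeff p t"] by simp
  ultimately show ?thesis
    by (simp add: christoffel_row_def metric_row_deriv_def bezout_row_anti[of s "Y" "pderiv X"] coeff_bezout_row_sym[of t "pderiv X"] algebra_simps)
qed

lemma christoffel_row_add_left: "christoffel_row s (X + X') Y = christoffel_row s X Y + christoffel_row s X' Y"
  by (simp add: christoffel_row_def bezout_row_add_left pderiv_add smult_add_left)

lemma christoffel_row_add_right: "christoffel_row s X (Y + Y') = christoffel_row s X Y + christoffel_row s X Y'"
  by (simp add: christoffel_row_def bezout_row_add_right pderiv_add smult_add_right)

lemma christoffel_row_smult_left: "christoffel_row s (smult c X) Y = smult c (christoffel_row s X Y)"
  by (simp add: christoffel_row_def bezout_row_smult_left pderiv_smult smult_add_right smult_diff_right)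

lemma christoffel_row_smult_right: "christoffel_row s X (smult c Y) = smult c (christoffel_row s X Y)"
  by (simp add: christoffel_row_def bezout_row_smult_right pderiv_smult smult_add_right smult_diff_right mult.commute)

lemma christoffel_row_0_left [simp]: "christoffel_row s 0 Y = 0"
  by (simp add: christoffel_row_def bezout_row_def)

lemma christoffel_row_0_right [simp]: "christoffel_row s X 0 = 0"
  by (simp add: christoffel_row_def bezout_row_def)

lemma christoffel_row_sum_left: "christoffel_row s (\<Sum>i\<in>I. smult (c i) (X i)) Y = (\<Sum>i\<in>I. smult (c i) (christoffel_row s (X i) Y))"
  by (induction I rule: infinite_finite_induct) (simp_all add: christoffel_row_add_left christoffel_row_smult_left)

lemma christoffel_row_sum_right: "christoffel_row s X (\<Sum>i\<in>I. smult (c i) (Y i)) = (\<Sum>i\<in>I. smult (c i) (christoffel_row s X (Y i)))"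
  by (induction I rule: infinite_finite_induct) (simp_all add: christoffel_row_add_right christoffel_row_smult_right)

section \<open>Generating functions of the rows and their values at points\<close>

lemma poly_eq_sum_lessThan:
  fixes X :: "complex poly"
  assumes "\<And>t. N \<le> t \<Longrightarrow> poly.coeff X t = 0"
  shows "poly X z = (\<Sum>t<N. z ^ t * poly.coeff X t)"
proof -
  have "poly X z = (\<Sum>t\<le>max N (degree X). poly.coeff X t * z ^ t)"
    unfolding poly_altdef by (rule sum.mono_neutral_left) (auto simp: coeff_eq_0)
  also have "\<dots> = (\<Sum>t<N. poly.coeff X t * z ^ t)"
    by (rule sum.mono_neutral_right) (use assms in auto)
  finally show ?thesis by (simp add: mult.commute)
qed

lemma poly_sum_smult: "poly (\<Sum>s<N. smult (z ^ s) (R s)) w = (\<Sum>s<N. z ^ s * poly (R s) w)"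
  by (simp add: poly_sum)

text \<open>Synthetic division: the z^s coefficient of (X(z) - X(w)) / (z - w) is the (s+1)-fold
  shift of X at w. The induction keeps the remainder at a general cut-off M; at Suc N it
  vanishes.\<close>

lemma sum_poly_shift:
  fixes X :: "complex poly"
  assumes "degree X \<le> N"
  shows "(z - w) * (\<Sum>s<N. z ^ s * poly (poly_shift (Suc s) X) w) = poly X z - poly X w"
proof -
  have "(z - w) * (\<Sum>s<M. z ^ s * poly (poly_shift (Suc s) X) w)
     = z ^ M * poly (poly_shift M X) w - poly X w + (\<Sum>s<M. z ^ s * poly.coeff X s)" for M
  proof (induction M)
    case (Suc M)
    have "poly (poly_shift M X) w = poly.coeff X M + w * poly (poly_shift (Suc M) X) w"
      by (subst poly_shift_Suc) simp
    with Suc show ?case by (simp add: algebra_simps)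
  qed simp
  from this[of "Suc N"] have "(z - w) * (\<Sum>s<Suc N. z ^ s * poly (poly_shift (Suc s) X) w)
     = z ^ Suc N * poly (poly_shift (Suc N) X) w - poly X w + (\<Sum>s<Suc N. z ^ s * poly.coeff X s)" .
  moreover have "poly_shift (Suc N) X = 0"
    using assms by (auto simp: poly_eq_iff coeff_poly_shift intro!: coeff_eq_0)
  moreover have "poly X z = (\<Sum>s<Suc N. z ^ s * poly.coeff X s)"
    by (rule poly_eq_sum_lessThan) (use assms in \<open>auto intro!: coeff_eq_0\<close>)
  ultimately show ?thesis by simp
qed

text \<open>In these generating functions z is a number and w stays the polynomial variable, so
  \<open>pderiv\<close> differentiates in w.\<close>

definition bezout_gen :: "nat \<Rightarrow> complex \<Rightarrow> complex poly \<Rightarrow> complex poly \<Rightarrow> complex poly" where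
  "bezout_gen N z X Y = (\<Sum>s<N. smult (z ^ s) (bezout_row s X Y))"

definition metric_gen :: "nat \<Rightarrow> complex \<Rightarrow> complex poly \<Rightarrow> complex poly" where
  "metric_gen N z P = (\<Sum>s<N. smult (z ^ s) (metric_row s P))"

definition christoffel_gen :: "nat \<Rightarrow> complex \<Rightarrow> complex poly \<Rightarrow> complex poly \<Rightarrow> complex poly" where
  "christoffel_gen N z X Y = (\<Sum>s<N. smult (z ^ s) (christoffel_row s X Y))"

lemma bezout_gen_mult:
  assumes "degree X \<le> N" "degree Y \<le> N"
  shows "[:z, -1:] * bezout_gen N z X Y = smult (poly X z) Y - smult (poly Y z) X"
proof -
  have "poly ([:z, -1:] * bezout_gen N z X Y) w = poly (smult (poly X z) Y - smult (poly Y z) X) w" for w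
  proof -
    have "poly ([:z, -1:] * bezout_gen N z X Y) w
       = (z - w) * (\<Sum>s<N. z ^ s * poly (poly_shift (Suc s) X) w) * poly Y w
       - (z - w) * (\<Sum>s<N. z ^ s * poly (poly_shift (Suc s) Y) w) * poly X w"
    proof -
      have "poly (bezout_gen N z X Y) w = (\<Sum>s<N. z ^ s * poly (poly_shift (Suc s) X) w) * poly Y w
         - (\<Sum>s<N. z ^ s * poly (poly_shift (Suc s) Y) w) * poly X w"
        by (simp add: bezout_gen_def poly_sum_smult bezout_row_def right_diff_distrib sum_subtractf sum_distrib_right mult.assoc)
      thus ?thesis by (simp add: right_diff_distrib mult.assoc) (simp add: algebra_simps)
    qed
    thus ?thesis unfolding sum_poly_shift[OF assms(1)] sum_poly_shift[OF assms(2)]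
      by (simp add: algebra_simps)
  qed
  thus ?thesis by (simp add: poly_eq_poly_eq_iff[symmetric] fun_eq_iff)
qed

text \<open>The second equation is the w-derivative of the first. The factor z - w is kept, so both
  hold on the diagonal too.\<close>

lemma poly_bezout_gen:
  assumes "degree X \<le> N" "degree Y \<le> N"
  shows "(z - w) * poly (bezout_gen N z X Y) w = poly X z * poly Y w - poly Y z * poly X w"
    and "(z - w) * poly (pderiv (bezout_gen N z X Y)) w = poly (bezout_gen N z X Y) w
      + poly X z * poly (pderiv Y) w - poly Y z * poly (pderiv X) w"
proof -
  show "(z - w) * poly (bezout_gen N z X Y) w = poly X z * poly Y w - poly Y z * poly X w"
    using arg_cong[OF bezout_gen_mult[OF assms, of z], of "\<lambda>p. poly p w"] by (simp add: algebra_simps)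
  have "pderiv ([:z, -1:] * bezout_gen N z X Y) = smult (poly X z) (pderiv Y) - smult (poly Y z) (pderiv X)"
    by (simp only: bezout_gen_mult[OF assms, of z] pderiv_diff pderiv_smult)
  from arg_cong[OF this, of "\<lambda>p. poly p w"]
  show "(z - w) * poly (pderiv (bezout_gen N z X Y)) w = poly (bezout_gen N z X Y) w
      + poly X z * poly (pderiv Y) w - poly Y z * poly (pderiv X) w"
    unfolding pderiv_mult by (simp add: pderiv_pCons algebra_simps)
qed

lemma sum_power_pderiv_coeff:
  assumes "degree X \<le> N"
  shows "(\<Sum>s<N. z ^ s * poly.coeff (pderiv X) s) = poly (pderiv X) (z :: complex)"
  by (rule poly_eq_sum_lessThan[symmetric]) (use coeff_pderiv_eq_0[OF assms] in auto)

lemma metric_gen_eq: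
  assumes "degree P \<le> N"
  shows "metric_gen N z P = smult (poly (pderiv P) z) (pderiv P) - bezout_gen N z P (pderiv P)"
  unfolding metric_gen_def bezout_gen_def metric_row_def sum_power_pderiv_coeff[OF assms, symmetric]
  by (simp add: smult_diff_right sum_subtractf smult_sum)

lemma christoffel_gen_eq:
  assumes "degree X \<le> N"
  shows "christoffel_gen N z X Y = smult (poly (pderiv X) z) (pderiv Y) - pderiv (bezout_gen N z X Y) + bezout_gen N z (pderiv X) Y"
proof -
  have "pderiv (bezout_gen N z X Y) = (\<Sum>s<N. smult (z ^ s) (pderiv (bezout_row s X Y)))"
    unfolding bezout_gen_def by (induction N) (simp_all add: pderiv_add pderiv_smult)
  thus ?thesis
    unfolding christoffel_gen_def bezout_gen_def christoffel_row_def sum_power_pderiv_coeff[OF assms, symmetric]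
    by (simp add: smult_diff_right smult_add_right sum_subtractf sum.distrib smult_sum)
qed

text \<open>The letter b stands for 1 / (z - w). As a separate symbol it keeps all values
  polynomial, so that torsion and curvature become ring computations modulo one relation between
  such reciprocals.\<close>

lemma poly_metric_gen:
  assumes "degree P \<le> N" "b * (z - w) = 1"
  shows "poly (metric_gen N z P) w = poly (pderiv P) z * poly (pderiv P) w
      - b * (poly P z * poly (pderiv P) w - poly (pderiv P) z * poly P w)"
    and "poly (pderiv (metric_gen N z P)) w = poly (pderiv P) z * poly (pderiv (pderiv P)) w
      - b * (poly P z * poly (pderiv (pderiv P)) w - poly (pderiv P) z * poly (pderiv P) w)
      - b^2 * (poly P z * poly (pderiv P) w - poly (pderiv P) z * poly P w)"
proof -
  note B = poly_bezout_gen[OF assms(1) degree_pderiv_le[OF assms(1)], of z w]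
  have B1: "poly (bezout_gen N z P (pderiv P)) w = b * (poly P z * poly (pderiv P) w - poly (pderiv P) z * poly P w)"
    using assms(2) by (simp flip: B(1) mult.assoc)
  have B2: "poly (pderiv (bezout_gen N z P (pderiv P))) w = b * (poly (bezout_gen N z P (pderiv P)) w
      + poly P z * poly (pderiv (pderiv P)) w - poly (pderiv P) z * poly (pderiv P) w)"
    using assms(2) by (simp flip: B(2) mult.assoc)
  show "poly (metric_gen N z P) w = poly (pderiv P) z * poly (pderiv P) w
      - b * (poly P z * poly (pderiv P) w - poly (pderiv P) z * poly P w)"
    by (simp add: metric_gen_eq[OF assms(1)] B1)
  show "poly (pderiv (metric_gen N z P)) w = poly (pderiv P) z * poly (pderiv (pderiv P)) w
      - b * (poly P z * poly (pderiv (pderiv P)) w - poly (pderiv P) z * poly (pderiv P) w)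
      - b^2 * (poly P z * poly (pderiv P) w - poly (pderiv P) z * poly P w)"
    by (simp add: metric_gen_eq[OF assms(1)] pderiv_diff pderiv_smult B2 B1 algebra_simps power2_eq_square)
qed

text \<open>Multiplied out, the formula also holds at z = w; it can therefore be read as an identity
  of polynomials in z and differentiated in z.\<close>

lemma poly_christoffel_gen_mult:
  assumes "degree X \<le> N" "degree Y \<le> N"
  shows "(z - w)^2 * poly (christoffel_gen N z X Y) w = (z - w)^2 * (poly (pderiv X) z * poly (pderiv Y) w)
    - (z - w) * (poly X z * poly (pderiv Y) w - poly (pderiv X) z * poly Y w)
    - (poly X z * poly Y w - poly X w * poly Y z)"
proof -
  note B = poly_bezout_gen[OF assms, of z w]
  note B' = poly_bezout_gen(1)[OF degree_pderiv_le[OF assms(1)] assms(2), of z w]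
  have "(z - w)^2 * poly (christoffel_gen N z X Y) w = (z - w)^2 * (poly (pderiv X) z * poly (pderiv Y) w)
     - (z - w) * ((z - w) * poly (pderiv (bezout_gen N z X Y)) w) + (z - w) * ((z - w) * poly (bezout_gen N z (pderiv X) Y) w)"
    by (simp add: christoffel_gen_eq[OF assms(1)] power2_eq_square algebra_simps)
  also have "\<dots> = (z - w)^2 * (poly (pderiv X) z * poly (pderiv Y) w)
     - (z - w) * poly (bezout_gen N z X Y) w - (z - w) * (poly X z * poly (pderiv Y) w - poly Y z * poly (pderiv X) w)
     + (z - w) * (poly (pderiv X) z * poly Y w - poly Y z * poly (pderiv X) w)"
    unfolding B(2) B' by (simp add: algebra_simps)
  finally show ?thesis unfolding B(1) by (simp add: algebra_simps)
qed

lemma poly_christoffel_gen: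
  assumes "degree X \<le> N" "degree Y \<le> N" "b * (z - w) = 1"
  shows "poly (christoffel_gen N z X Y) w = poly (pderiv X) z * poly (pderiv Y) w
    - b * (poly X z * poly (pderiv Y) w - poly (pderiv X) z * poly Y w)
    - b^2 * (poly X z * poly Y w - poly X w * poly Y z)"
proof -
  have b: "b^2 * (z - w)^2 = 1" "b^2 * (z - w) = b"
    by (simp only: power_mult_distrib[symmetric] assms(3) power_one)
       (simp only: power2_eq_square mult.assoc assms(3) mult_1_right)
  have "poly (christoffel_gen N z X Y) w = b^2 * ((z - w)^2 * poly (christoffel_gen N z X Y) w)"
    by (simp add: b flip: mult.assoc)
  also have "\<dots> = (b^2 * (z - w)^2) * (poly (pderiv X) z * poly (pderiv Y) w)
    - (b^2 * (z - w)) * (poly X z * poly (pderiv Y) w - poly (pderiv X) z * poly Y w)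
    - b^2 * (poly X z * poly Y w - poly X w * poly Y z)"
    unfolding poly_christoffel_gen_mult[OF assms(1,2)] by (simp add: algebra_simps)
  finally show ?thesis by (simp add: b)
qed

text \<open>A column of the coefficient matrix of Gamma, as a polynomial in the first variable. The
  products Gamma^{pr}_a Gamma^{al}_k contract the first upper index of the second factor, so its
  column has to be inserted as the variation Y of the first.\<close>

definition christoffel_col :: "nat \<Rightarrow> nat \<Rightarrow> complex poly \<Rightarrow> complex poly \<Rightarrow> complex poly" where
  "christoffel_col N l X Y = (\<Sum>b<N. monom (poly.coeff (christoffel_row b X Y) l) b)"

definition christoffel_christoffel_col_gen :: "nat \<Rightarrow> complex \<Rightarrow> complex poly \<Rightarrow> complex poly \<Rightarrow> complex poly" where
  "christoffel_christoffel_col_gen N w X Y = (\<Sum>l<N. smult (w ^ l) (christoffel_col N l X Y))"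

lemma coeff_christoffel_col: "poly.coeff (christoffel_col N l X Y) b = (if b < N then poly.coeff (christoffel_row b X Y) l else 0)"
  by (simp add: christoffel_col_def coeff_sum)

lemma degree_christoffel_col: "degree (christoffel_col N l X Y) \<le> N"
  by (intro degree_le) (auto simp: coeff_christoffel_col)

lemma degree_christoffel_christoffel_col_gen: "degree (christoffel_christoffel_col_gen N w X Y) \<le> N"
  unfolding christoffel_christoffel_col_gen_def by (intro degree_sum_le) (auto intro: degree_christoffel_col)

lemma poly_christoffel_christoffel_col_gen:
  assumes "degree X \<le> N" "degree Y \<le> N"
  shows "poly (christoffel_christoffel_col_gen N w X Y) v = poly (christoffel_gen N v X Y) w"
proof -
  have "poly (christoffel_christoffel_col_gen N w X Y) v = (\<Sum>l<N. w ^ l * (\<Sum>b<N. v ^ b * poly.coeff (christoffel_row b X Y) l))"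
    by (simp add: christoffel_christoffel_col_gen_def poly_sum christoffel_col_def poly_monom mult.commute)
  also have "\<dots> = (\<Sum>b<N. v ^ b * (\<Sum>l<N. w ^ l * poly.coeff (christoffel_row b X Y) l))"
    unfolding sum_distrib_left by (subst sum.swap) (simp add: mult.left_commute)
  also have "\<dots> = (\<Sum>b<N. v ^ b * poly (christoffel_row b X Y) w)"
    using coeff_christoffel_row_eq_0[OF assms] by (simp add: poly_eq_sum_lessThan[symmetric])
  finally show ?thesis by (simp add: christoffel_gen_def poly_sum_smult)
qed

lemma poly_pderiv_christoffel_christoffel_col_gen:
  assumes "degree X \<le> N" "degree Y \<le> N" "b * (v - w) = 1"
  shows "poly (pderiv (christoffel_christoffel_col_gen N w X Y)) v = poly (pderiv (pderiv X)) v * poly (pderiv Y) w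
     - b * (poly (pderiv X) v * poly (pderiv Y) w - poly (pderiv (pderiv X)) v * poly Y w)
     + b^2 * (poly X v * poly (pderiv Y) w - poly (pderiv X) v * poly Y w)
     - b^2 * (poly (pderiv X) v * poly Y w - poly X w * poly (pderiv Y) v)
     + 2 * b^3 * (poly X v * poly Y w - poly X w * poly Y v)"
proof -
  define L where "L = [:-w, 1::complex:]"
  define V where "V = christoffel_christoffel_col_gen N w X Y"
  have L': "pderiv L = 1" by (simp add: L_def pderiv_pCons one_pCons)
  have pL: "poly L v = v - w" for v by (simp add: L_def)
  \<comment> \<open>Denominators are cleared before differentiating; multiplying by b^2 afterwards
    solves for the derivative.\<close>
  have "L * L * V = smult (poly (pderiv Y) w) (L * L * pderiv X)
     - L * (smult (poly (pderiv Y) w) X - smult (poly Y w) (pderiv X))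
     - (smult (poly Y w) X - smult (poly X w) Y)" (is "?l = ?r")
  proof -
    have "poly ?l u = poly ?r u" for u
      using poly_christoffel_gen_mult[OF assms(1,2), of u w]
      by (simp add: pL V_def poly_christoffel_christoffel_col_gen[OF assms(1,2)] power2_eq_square algebra_simps)
    thus ?thesis by (simp add: poly_eq_poly_eq_iff[symmetric] fun_eq_iff)
  qed
  from arg_cong[OF this, of "\<lambda>p. poly (pderiv p) v"]
  have eq: "(v - w)^2 * poly (pderiv V) v = - 2 * (v - w) * poly V v
     + poly (pderiv Y) w * (2 * (v - w) * poly (pderiv X) v + (v - w)^2 * poly (pderiv (pderiv X)) v)
     - (poly (pderiv Y) w * poly X v - poly Y w * poly (pderiv X) v)
     - (v - w) * (poly (pderiv Y) w * poly (pderiv X) v - poly Y w * poly (pderiv (pderiv X)) v)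
     - (poly Y w * poly (pderiv X) v - poly X w * poly (pderiv Y) v)"
    unfolding pderiv_mult pderiv_diff pderiv_smult L' by (simp add: pL power2_eq_square algebra_simps)
  have b: "b^2 * (v - w)^2 = 1" "b^2 * (v - w) = b"
    by (simp only: power_mult_distrib[symmetric] assms(3) power_one)
       (simp only: power2_eq_square mult.assoc assms(3) mult_1_right)
  have V: "poly V v = poly (pderiv X) v * poly (pderiv Y) w
    - b * (poly X v * poly (pderiv Y) w - poly (pderiv X) v * poly Y w)
    - b^2 * (poly X v * poly Y w - poly X w * poly Y v)"
    unfolding V_def poly_christoffel_christoffel_col_gen[OF assms(1,2)] by (rule poly_christoffel_gen[OF assms])
  have "poly (pderiv V) v = b^2 * ((v - w)^2 * poly (pderiv V) v)"
    by (simp add: b flip: mult.assoc)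
  also have "\<dots> = - 2 * (b^2 * (v - w)) * poly V v
     + poly (pderiv Y) w * (2 * (b^2 * (v - w)) * poly (pderiv X) v + (b^2 * (v - w)^2) * poly (pderiv (pderiv X)) v)
     - b^2 * (poly (pderiv Y) w * poly X v - poly Y w * poly (pderiv X) v)
     - (b^2 * (v - w)) * (poly (pderiv Y) w * poly (pderiv X) v - poly Y w * poly (pderiv (pderiv X)) v)
     - b^2 * (poly Y w * poly (pderiv X) v - poly X w * poly (pderiv Y) v)"
    unfolding eq by (simp add: algebra_simps)
  finally show ?thesis
    unfolding V_def[symmetric] b V by (simp add: algebra_simps power2_eq_square power3_eq_cube)
qed

text \<open>In the next two identities \<open>a\<close>, \<open>b\<close>, \<open>c\<close> stand for \<open>1 / (x - z)\<close>, \<open>1 / (z - w)\<close>, \<open>1 / (x - w)\<close>, and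
  \<open>P0x\<close>, \<open>P1x\<close>, \<open>P2x\<close>, ... for the values of a polynomial and of its derivatives at these points.
  The displayed cofactors come from dividing the difference of the two sides by \<open>a b - c (a + b)\<close>.\<close>

lemma torsion_identity_aux:
  fixes a b c :: complex
  assumes abc: "a * b = c * (a + b)"
    and Xz: "X0w = P1x * P1w - c * (P0x * P1w - P1x * P0w)"
    and "X1w = P1x * P2w - c * (P0x * P2w - P1x * P1w) - c^2 * (P0x * P1w - P1x * P0w)"
    and "X0z = P1x * P1z - a * (P0x * P1z - P1x * P0z)"
    and "Z0w = P1z * P1w - b * (P0z * P1w - P1z * P0w)"
    and "Z1w = P1z * P2w - b * (P0z * P2w - P1z * P1w) - b^2 * (P0z * P1w - P1z * P0w)"
  shows "P1z * X1w - b * (P0z * X1w - P1z * X0w) - b^2 * (P0z * X0w - P0w * X0z)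
       = P1x * Z1w - c * (P0x * Z1w - P1x * Z0w) - c^2 * (P0x * Z0w - P0w * X0z)"
  (is "?l = ?r")
proof -
  have "?l - ?r = (P0w*P0x*P1z*(- b - c) + P0w*P0z*P1x*(b + c)) * (a * b - c * (a + b))"
    unfolding assms(2-) by (simp add: algebra_simps power2_eq_square power3_eq_cube)
  thus ?thesis using abc by simp
qed

lemma curvature_identity_aux:
  fixes a b c :: complex
  assumes abc: "a * b = c * (a + b)"
    and "Xz = P1x * P1z - a * (P0x * P1z - P1x * P0z)"
    and "Xw = P1x * P1w - c * (P0x * P1w - P1x * P0w)"
    and "dXz = P1x * P2z - a * (P0x * P2z - P1x * P1z) - a^2 * (P0x * P1z - P1x * P0z)"
    and "dXw = P1x * P2w - c * (P0x * P2w - P1x * P1w) - c^2 * (P0x * P1w - P1x * P0w)"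
    and "Wz = P1z * Y1w - b * (P0z * Y1w - P1z * Y0w) - b^2 * (P0z * Y0w - P0w * Y0z)"
    and "Wx = P1x * Y1w - c * (P0x * Y1w - P1x * Y0w) - c^2 * (P0x * Y0w - P0w * Y0x)"
    and "dWz = P2z * Y1w - b * (P1z * Y1w - P2z * Y0w) + b^2 * (P0z * Y1w - P1z * Y0w)
      - b^2 * (P1z * Y0w - P0w * Y1z) + 2 * b^3 * (P0z * Y0w - P0w * Y0z)"
    and "Zw = P1w * Y1z + b * (P0w * Y1z - P1w * Y0z) - b^2 * (P0w * Y0z - P0z * Y0w)"
    and "Zx = P1x * Y1z - a * (P0x * Y1z - P1x * Y0z) - a^2 * (P0x * Y0z - P0z * Y0x)"
    and "dZw = P2w * Y1z + b * (P1w * Y1z - P2w * Y0z) + b^2 * (P0w * Y1z - P1w * Y0z)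
      - b^2 * (P1w * Y0z - P0z * Y1w) - 2 * b^3 * (P0w * Y0z - P0z * Y0w)"
  shows "dXz * Y1w - b * (Xz * Y1w - dXz * Y0w) - b^2 * (Xz * Y0w - Xw * Y0z)
     - (Y1z * dXw - b * (Y0z * dXw - Y1z * Xw) - b^2 * (Y0z * Xw - Y0w * Xz))
   = P1x * dWz - a * (P0x * dWz - P1x * Wz) - a^2 * (P0x * Wz - P0z * Wx)
     - (P1x * dZw - c * (P0x * dZw - P1x * Zw) - c^2 * (P0x * Zw - P0w * Zx))"
  (is "?l = ?r")
proof -
  have "?l - ?r = (P0x*P0z*Y0w*(2*b*b - a*b + b*c - a*c) + P0w*P0x*Y0z*(- 2*b*b + a*b - b*c + a*c) + P0z*P1x*Y0w*(a - b) + P0x*P0z*Y1w*(b - a) + P0w*P0x*Y1z*(b + c) + P0w*P1x*Y0z*(- b - c)) * (a * b - c * (a + b))"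
    unfolding assms(2-) by (simp add: algebra_simps power2_eq_square power3_eq_cube)
  thus ?thesis using abc by simp
qed

lemma power_sum_coeff_eq_0:
  fixes c :: "nat \<Rightarrow> complex"
  assumes "finite F" "\<And>z. z \<notin> F \<Longrightarrow> (\<Sum>s<N. z ^ s * c s) = 0" "s < N"
  shows "c s = 0"
proof -
  define p where "p = (\<Sum>s<N. monom (c s) s)"
  have "p = 0"
  proof (rule ccontr)
    assume "p \<noteq> 0"
    moreover have "- F \<subseteq> {z. poly p z = 0}"
      using assms(2) by (auto simp: p_def poly_sum poly_monom mult.commute)
    ultimately have "finite (- F)" using poly_roots_finite finite_subset by blast
    thus False using assms(1) infinite_UNIV_char_0[where 'a=complex] finite_compl by blast
  qed
  moreover have "poly.coeff p s = c s" using assms(3) by (simp add: p_def coeff_sum)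
  ultimately show ?thesis by simp
qed

text \<open>Removes the exceptions on the diagonals: z is freed first with x and w fixed, then x
  with w fixed, and for w no exception remains.\<close>

lemma power_sum3_coeff_eq_0:
  fixes B :: "nat \<Rightarrow> nat \<Rightarrow> complex poly"
  assumes "\<And>x z w. x \<noteq> z \<Longrightarrow> z \<noteq> w \<Longrightarrow> x \<noteq> w \<Longrightarrow> (\<Sum>s<N. \<Sum>t<N. z ^ s * x ^ t * poly (B s t) w) = 0"
    and "s < N" "t < N"
  shows "B s t = 0"
proof -
  have *: "(\<Sum>t<N. x ^ t * poly (B s t) w) = 0" if "x \<noteq> w" for x w
  proof (rule power_sum_coeff_eq_0[where F="{x, w}" and N=N and c="\<lambda>s. \<Sum>t<N. x ^ t * poly (B s t) w"])
    show "(\<Sum>s<N. z ^ s * (\<Sum>t<N. x ^ t * poly (B s t) w)) = 0" if "z \<notin> {x, w}" for z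
      using assms(1)[of x z w] that \<open>x \<noteq> w\<close> by (auto simp: sum_distrib_left mult.assoc)
  qed (use assms in auto)
  have "poly (B s t) w = 0" for w
    by (rule power_sum_coeff_eq_0[where F="{w}" and N=N and c="\<lambda>t. poly (B s t) w"]) (use * assms in auto)
  thus ?thesis using poly_all_0_iff_0 by blast
qed

text \<open>Partial fractions from (x - z) + (z - w) = x - w. It is the hypothesis on a, b, c in the
  two polynomial identities.\<close>

lemma inverse_difference_relation:
  fixes x z w :: complex
  assumes "x \<noteq> z" "z \<noteq> w" "x \<noteq> w"
  shows "inverse (x - z) * inverse (z - w) = inverse (x - w) * (inverse (x - z) + inverse (z - w))"
  using assms by (simp add: field_simps)

text \<open>Torsion-freeness: Gamma is linear in the variation, so contracting its lower index with
  a row of the metric substitutes that row for Y.\<close>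

lemma christoffel_row_metric_row_commute:
  assumes "degree P \<le> N" "s < N" "t < N"
  shows "christoffel_row s P (metric_row t P) = christoffel_row t P (metric_row s P)"
proof -
  have CG: "(\<Sum>s<N. \<Sum>t<N. z ^ s * x ^ t * poly (christoffel_row s P (metric_row t P)) w) = poly (christoffel_gen N z P (metric_gen N x P)) w" for x z w
    by (simp add: christoffel_gen_def metric_gen_def christoffel_row_sum_right poly_sum sum_distrib_left mult.assoc)
  have eq: "poly (christoffel_gen N z P (metric_gen N x P)) w = poly (christoffel_gen N x P (metric_gen N z P)) w"
    if "x \<noteq> z" "z \<noteq> w" "x \<noteq> w" for x z w
  proof -
    define a b c where abc: "a = inverse (x - z)" "b = inverse (z - w)" "c = inverse (x - w)"
    have i: "a * (x - z) = 1" "- a * (z - x) = 1" "b * (z - w) = 1" "c * (x - w) = 1"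
      using that by (simp_all add: abc field_simps)
    have dG: "degree (metric_gen N z P) \<le> N" for z
      unfolding metric_gen_def by (intro degree_sum_le) (auto intro: degree_metric_row[OF assms(1)])
    \<comment> \<open>One side contains the metric at (x, z), the other at (z, x); the identity
      needs them to be a single value.\<close>
    have zx: "poly (metric_gen N z P) x = poly (metric_gen N x P) z"
      unfolding poly_metric_gen(1)[OF assms(1) i(1)] poly_metric_gen(1)[OF assms(1) i(2)] by (simp add: algebra_simps)
    show ?thesis
      unfolding poly_christoffel_gen[OF assms(1) dG i(3)] poly_christoffel_gen[OF assms(1) dG i(4)] zx
      by (rule torsion_identity_aux[where a=a])
         (use inverse_difference_relation[OF that] poly_metric_gen[OF assms(1) i(1)] poly_metric_gen[OF assms(1) i(3)]
            poly_metric_gen[OF assms(1) i(4)] in \<open>simp_all add: abc\<close>)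
  qed
  have "christoffel_row s P (metric_row t P) - christoffel_row t P (metric_row s P) = 0"
  proof (rule power_sum3_coeff_eq_0[where B="\<lambda>s t. christoffel_row s P (metric_row t P) - christoffel_row t P (metric_row s P)", OF _ assms(2,3)])
    fix x z w :: complex assume "x \<noteq> z" "z \<noteq> w" "x \<noteq> w"
    from eq[OF this] show "(\<Sum>s<N. \<Sum>t<N. z ^ s * x ^ t * poly (christoffel_row s P (metric_row t P) - christoffel_row t P (metric_row s P)) w) = 0"
      unfolding CG[symmetric] poly_diff right_diff_distrib sum_subtractf
      using sum.swap[of "\<lambda>s t. z ^ s * x ^ t * poly (christoffel_row t P (metric_row s P)) w" "{..<N}" "{..<N}"]
      by (simp add: mult.commute)
  qed
  thus ?thesis by simp
qed

text \<open>On the left are derivatives of Gamma: by linearity in X, differentiating along a metric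
  row puts that row in place of X. On the right are products of two symbols, contracted by inserting
  a column. The exponents s, t, l belong to the indices r, p, l of \<open>curvature\<close>.\<close>

lemma christoffel_row_curvature:
  assumes "degree P \<le> N" "degree Y \<le> N" "s < N" "t < N" "l < N"
  shows "poly.coeff (christoffel_row s (metric_row t P) Y) l - poly.coeff (christoffel_row s Y (metric_row t P)) l
     = poly.coeff (christoffel_row t P (christoffel_col N l P Y)) s - poly.coeff (christoffel_row t P (christoffel_col N s P Y)) l"
proof -
  have dG: "degree (metric_gen N z P) \<le> N" for z
    unfolding metric_gen_def by (intro degree_sum_le) (auto intro: degree_metric_row[OF assms(1)])
  define L where "L s t = christoffel_row s (metric_row t P) Y - christoffel_row s Y (metric_row t P)" for s t
  \<comment> \<open>R collects the right-hand sides for all l into a polynomial in w, so that values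
    at triples of distinct points can be compared.\<close>
  define R where "R s t = (\<Sum>l<N. monom (poly.coeff (christoffel_row t P (christoffel_col N l P Y)) s - poly.coeff (christoffel_row t P (christoffel_col N s P Y)) l) l)" for s t
  have Leq: "(\<Sum>s<N. \<Sum>t<N. z ^ s * x ^ t * poly (L s t) w)
     = poly (christoffel_gen N z (metric_gen N x P) Y) w - poly (christoffel_gen N z Y (metric_gen N x P)) w" for x z w
    by (simp add: L_def christoffel_gen_def metric_gen_def christoffel_row_sum_right christoffel_row_sum_left poly_sum sum_distrib_left mult.assoc
        sum_subtractf right_diff_distrib)
  have R1: "(\<Sum>s<N. \<Sum>t<N. z ^ s * x ^ t * (\<Sum>l<N. w ^ l * poly.coeff (christoffel_row t P (christoffel_col N l P Y)) s))
     = poly (christoffel_gen N x P (christoffel_christoffel_col_gen N w P Y)) z" for x z w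
  proof -
    have "poly (christoffel_gen N x P (christoffel_christoffel_col_gen N w P Y)) z = (\<Sum>t<N. x ^ t * (\<Sum>l<N. w ^ l * poly (christoffel_row t P (christoffel_col N l P Y)) z))"
      by (simp add: christoffel_gen_def christoffel_christoffel_col_gen_def christoffel_row_sum_right poly_sum)
    also have "\<dots> = (\<Sum>t<N. x ^ t * (\<Sum>l<N. w ^ l * (\<Sum>s<N. z ^ s * poly.coeff (christoffel_row t P (christoffel_col N l P Y)) s)))"
      using coeff_christoffel_row_eq_0[OF assms(1) degree_christoffel_col] by (simp add: poly_eq_sum_lessThan[symmetric])
    also have "\<dots> = (\<Sum>t<N. x ^ t * (\<Sum>s<N. z ^ s * (\<Sum>l<N. w ^ l * poly.coeff (christoffel_row t P (christoffel_col N l P Y)) s)))"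
      unfolding sum_distrib_left by (subst (2) sum.swap) (simp add: mult.left_commute)
    also have "\<dots> = (\<Sum>s<N. \<Sum>t<N. z ^ s * x ^ t * (\<Sum>l<N. w ^ l * poly.coeff (christoffel_row t P (christoffel_col N l P Y)) s))"
      unfolding sum_distrib_left by (subst sum.swap) (simp add: mult.left_commute mult.assoc)
    finally show ?thesis by simp
  qed
  have R2: "(\<Sum>s<N. \<Sum>t<N. z ^ s * x ^ t * (\<Sum>l<N. w ^ l * poly.coeff (christoffel_row t P (christoffel_col N s P Y)) l))
     = poly (christoffel_gen N x P (christoffel_christoffel_col_gen N z P Y)) w" for x z w
  proof -
    have "poly (christoffel_gen N x P (christoffel_christoffel_col_gen N z P Y)) w = (\<Sum>t<N. x ^ t * (\<Sum>s<N. z ^ s * poly (christoffel_row t P (christoffel_col N s P Y)) w))"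
      by (simp add: christoffel_gen_def christoffel_christoffel_col_gen_def christoffel_row_sum_right poly_sum)
    also have "\<dots> = (\<Sum>t<N. x ^ t * (\<Sum>s<N. z ^ s * (\<Sum>l<N. w ^ l * poly.coeff (christoffel_row t P (christoffel_col N s P Y)) l)))"
      using coeff_christoffel_row_eq_0[OF assms(1) degree_christoffel_col] by (simp add: poly_eq_sum_lessThan[symmetric])
    also have "\<dots> = (\<Sum>s<N. \<Sum>t<N. z ^ s * x ^ t * (\<Sum>l<N. w ^ l * poly.coeff (christoffel_row t P (christoffel_col N s P Y)) l))"
      unfolding sum_distrib_left by (subst sum.swap) (simp add: mult.left_commute mult.assoc)
    finally show ?thesis by simp
  qed
  have "L s t - R s t = 0"
  proof (rule power_sum3_coeff_eq_0[where B="\<lambda>s t. L s t - R s t", OF _ assms(3,4)])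
    fix x z w :: complex assume d: "x \<noteq> z" "z \<noteq> w" "x \<noteq> w"
    define a b c where abc: "a = inverse (x - z)" "b = inverse (z - w)" "c = inverse (x - w)"
    have i: "a * (x - z) = 1" "b * (z - w) = 1" "c * (x - w) = 1" "- b * (w - z) = 1"
      using d by (simp_all add: abc field_simps)
    have "poly (R s t) w = (\<Sum>l<N. w ^ l * poly.coeff (christoffel_row t P (christoffel_col N l P Y)) s)
       - (\<Sum>l<N. w ^ l * poly.coeff (christoffel_row t P (christoffel_col N s P Y)) l)" for s t
      by (simp add: R_def poly_sum poly_monom mult.commute left_diff_distrib right_diff_distrib sum_subtractf)
    hence "(\<Sum>s<N. \<Sum>t<N. z ^ s * x ^ t * poly (R s t) w)
        = poly (christoffel_gen N x P (christoffel_christoffel_col_gen N w P Y)) z - poly (christoffel_gen N x P (christoffel_christoffel_col_gen N z P Y)) w"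
      by (simp only: right_diff_distrib sum_subtractf R1 R2)
    moreover have "poly (christoffel_gen N z (metric_gen N x P) Y) w - poly (christoffel_gen N z Y (metric_gen N x P)) w
       = poly (christoffel_gen N x P (christoffel_christoffel_col_gen N w P Y)) z - poly (christoffel_gen N x P (christoffel_christoffel_col_gen N z P Y)) w"
      unfolding poly_christoffel_gen[OF dG assms(2) i(2)] poly_christoffel_gen[OF assms(2) dG i(2)]
        poly_christoffel_gen[OF assms(1) degree_christoffel_christoffel_col_gen i(1)] poly_christoffel_gen[OF assms(1) degree_christoffel_christoffel_col_gen i(3)]
      by (rule curvature_identity_aux[where ?Y0x="poly Y x"])
         (use inverse_difference_relation[OF d] poly_metric_gen[OF assms(1) i(1)] poly_metric_gen[OF assms(1) i(3)]
            poly_christoffel_gen[OF assms(1,2) i(1)] poly_christoffel_gen[OF assms(1,2) i(2)] poly_christoffel_gen[OF assms(1,2) i(3)]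
            poly_christoffel_gen[OF assms(1,2) i(4)] poly_pderiv_christoffel_christoffel_col_gen[OF assms(1,2) i(2)] poly_pderiv_christoffel_christoffel_col_gen[OF assms(1,2) i(4)]
          in \<open>simp_all add: abc poly_christoffel_christoffel_col_gen[OF assms(1,2)] power3_eq_cube power2_eq_square\<close>)
    ultimately show "(\<Sum>s<N. \<Sum>t<N. z ^ s * x ^ t * poly (L s t - R s t) w) = 0"
      unfolding poly_diff right_diff_distrib sum_subtractf Leq by simp
  qed
  hence "poly.coeff (L s t) l = poly.coeff (R s t) l" by simp
  thus ?thesis using assms(5) by (simp add: L_def R_def coeff_sum)
qed


section \<open>The flat pencil\<close>

definition orbit_poly :: "nat \<Rightarrow> pt \<Rightarrow> complex poly" where
  "orbit_poly n u = monom 1 n + (\<Sum>k\<in>{1..n}. monom (u k) (n - k))"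

lemma coeff_orbit_poly:
  "poly.coeff (orbit_poly n u) m = (if m = n then 1 else if m < n then u (n - m) else 0)"
proof -
  have "(\<Sum>k\<in>{1..n}. poly.coeff (monom (u k) (n - k)) m) = (\<Sum>k\<in>{1..n}. if n - m = k \<and> m < n then u k else 0)"
    by (intro sum.cong) auto
  thus ?thesis by (auto simp: orbit_poly_def coeff_sum)
qed

lemma degree_orbit_poly: "degree (orbit_poly n u) \<le> n"
  by (intro degree_le) (auto simp: coeff_orbit_poly)

lemma orbit_poly_fun_upd:
  assumes "k \<in> {1..n}"
  shows "orbit_poly n (u(k := t)) = orbit_poly n u + smult (t - u k) (monom 1 (n - k))"
  using assms by (auto simp: poly_eq_iff coeff_orbit_poly)

text \<open>Index i sits at exponent n - i because u_i is the coefficient of z^(n-i); accordingly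
  the variation along u_k is z^(n-k). The argument is an arbitrary polynomial so that every member
  of the pencil is covered.\<close>

definition orbit_metric :: "nat \<Rightarrow> complex poly \<Rightarrow> nat \<Rightarrow> nat \<Rightarrow> complex" where
  "orbit_metric n P i j = poly.coeff (metric_row (n - i) P) (n - j) / of_nat (n - 1)"

definition orbit_christoffel :: "nat \<Rightarrow> complex poly \<Rightarrow> nat \<Rightarrow> nat \<Rightarrow> nat \<Rightarrow> complex" where
  "orbit_christoffel n P i j k = poly.coeff (christoffel_row (n - i) P (monom 1 (n - k))) (n - j) / of_nat (n - 1)"

lemma metric_row_add_smult:
  "metric_row s (P + smult c Y) = metric_row s P + smult c (metric_row_deriv s P Y) + smult (c^2) (metric_row s Y)"
  by (simp add: metric_row_def metric_row_deriv_def pderiv_add pderiv_smult bezout_row_add_left bezout_row_add_right bezout_row_smult_left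
      bezout_row_smult_right power2_eq_square smult_add_left smult_add_right smult_diff_right algebra_simps)

text \<open>The metric is quadratic in P, so the expansion along u_k stops at second order. Z is a
  constant shift of P, later - s z.\<close>

lemma orbit_metric_has_derivative:
  assumes "k \<in> {1..n}" "i \<in> {1..n}" "j \<in> {1..n}"
  shows "((\<lambda>t. orbit_metric n (orbit_poly n (x(k := t)) + Z) i j) has_field_derivative
    orbit_christoffel n (orbit_poly n x + Z) i j k + orbit_christoffel n (orbit_poly n x + Z) j i k) (at (x k))"
proof -
  let ?P = "orbit_poly n x + Z" and ?Y = "monom 1 (n - k) :: complex poly"
  have "orbit_metric n (orbit_poly n (x(k := t)) + Z) i j = (poly.coeff (metric_row (n - i) ?P) (n - j)
      + (t - x k) * poly.coeff (metric_row_deriv (n - i) ?P ?Y) (n - j)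
      + (t - x k)^2 * poly.coeff (metric_row (n - i) ?Y) (n - j)) / of_nat (n - 1)" for t
  proof -
    have "orbit_poly n (x(k := t)) + Z = ?P + smult (t - x k) ?Y"
      using orbit_poly_fun_upd[OF assms(1)] by (simp add: algebra_simps)
    thus ?thesis by (simp only: orbit_metric_def metric_row_add_smult coeff_add coeff_smult)
  qed
  moreover have "((\<lambda>t. (poly.coeff (metric_row (n - i) ?P) (n - j)
      + (t - x k) * poly.coeff (metric_row_deriv (n - i) ?P ?Y) (n - j)
      + (t - x k)^2 * poly.coeff (metric_row (n - i) ?Y) (n - j)) / of_nat (n - 1)) has_field_derivative
     poly.coeff (metric_row_deriv (n - i) ?P ?Y) (n - j) / of_nat (n - 1)) (at (x k))"
    by (rule DERIV_cdivide) (auto intro!: derivative_eq_intros)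
  moreover have "orbit_christoffel n ?P i j k + orbit_christoffel n ?P j i k = poly.coeff (metric_row_deriv (n - i) ?P ?Y) (n - j) / of_nat (n - 1)"
    unfolding orbit_christoffel_def christoffel_row_compatible[symmetric] by (simp add: add_divide_distrib)
  ultimately show ?thesis by simp
qed

lemma poly_eq_sum_monom:
  fixes Y :: "complex poly"
  assumes "\<And>t. n \<le> t \<Longrightarrow> poly.coeff Y t = 0"
  shows "Y = (\<Sum>a\<in>{1..n}. smult (poly.coeff Y (n - a)) (monom 1 (n - a)))"
proof (rule poly_eqI)
  fix m
  have "(\<Sum>a\<in>{1..n}. poly.coeff Y (n - a) * poly.coeff (monom 1 (n - a)) m)
     = (\<Sum>a\<in>{1..n}. if n - m = a \<and> m < n then poly.coeff Y m else 0)"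
    by (intro sum.cong) auto
  also have "\<dots> = poly.coeff Y m" using assms[of m] by (cases "m < n") auto
  finally show "poly.coeff Y m = poly.coeff (\<Sum>a\<in>{1..n}. smult (poly.coeff Y (n - a)) (monom 1 (n - a))) m"
    by (simp add: coeff_sum)
qed

text \<open>Index contractions become substitutions: summing against the coefficients of Y
  reassembles Y inside a linear slot.\<close>

lemma sum_coeff_christoffel_row:
  assumes "\<And>t. n \<le> t \<Longrightarrow> poly.coeff Y t = 0"
  shows "(\<Sum>a\<in>{1..n}. poly.coeff Y (n - a) * poly.coeff (christoffel_row s X (monom 1 (n - a))) l) = poly.coeff (christoffel_row s X Y) l"
    and "(\<Sum>a\<in>{1..n}. poly.coeff Y (n - a) * poly.coeff (christoffel_row s (monom 1 (n - a)) X) l) = poly.coeff (christoffel_row s Y X) l"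
proof -
  have "poly.coeff (christoffel_row s X Y) l = poly.coeff (christoffel_row s X (\<Sum>a\<in>{1..n}. smult (poly.coeff Y (n - a)) (monom 1 (n - a)))) l"
    using poly_eq_sum_monom[OF assms] by simp
  thus "(\<Sum>a\<in>{1..n}. poly.coeff Y (n - a) * poly.coeff (christoffel_row s X (monom 1 (n - a))) l) = poly.coeff (christoffel_row s X Y) l"
    unfolding christoffel_row_sum_right by (simp add: coeff_sum)
  have "poly.coeff (christoffel_row s Y X) l = poly.coeff (christoffel_row s (\<Sum>a\<in>{1..n}. smult (poly.coeff Y (n - a)) (monom 1 (n - a))) X) l"
    using poly_eq_sum_monom[OF assms] by simp
  thus "(\<Sum>a\<in>{1..n}. poly.coeff Y (n - a) * poly.coeff (christoffel_row s (monom 1 (n - a)) X) l) = poly.coeff (christoffel_row s Y X) l"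
    unfolding christoffel_row_sum_left by (simp add: coeff_sum)
qed

lemma orbit_metric_torsion_free:
  assumes "degree P \<le> n" "i \<in> {1..n}" "j \<in> {1..n}"
  shows "(\<Sum>s\<in>{1..n}. orbit_metric n P i s * orbit_christoffel n P j k s) = (\<Sum>s\<in>{1..n}. orbit_metric n P j s * orbit_christoffel n P i k s)"
proof -
  have *: "(\<Sum>s\<in>{1..n}. orbit_metric n P i s * orbit_christoffel n P j k s)
     = poly.coeff (christoffel_row (n - j) P (metric_row (n - i) P)) (n - k) / of_nat (n - 1)^2" for i j
  proof -
    have "(\<Sum>s\<in>{1..n}. orbit_metric n P i s * orbit_christoffel n P j k s)
       = (\<Sum>s\<in>{1..n}. poly.coeff (metric_row (n - i) P) (n - s) * poly.coeff (christoffel_row (n - j) P (monom 1 (n - s))) (n - k)) / of_nat (n - 1)^2"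
      unfolding sum_divide_distrib
      by (intro sum.cong refl) (simp add: orbit_metric_def orbit_christoffel_def power2_eq_square)
    thus ?thesis by (simp only: sum_coeff_christoffel_row(1)[OF coeff_metric_row_eq_0[OF assms(1)]])
  qed
  have "christoffel_row (n - j) P (metric_row (n - i) P) = christoffel_row (n - i) P (metric_row (n - j) P)"
    by (rule christoffel_row_metric_row_commute[OF assms(1)]) (use assms in auto)
  thus ?thesis by (simp only: *)
qed

lemma orbit_metric_curvature:
  assumes "degree P \<le> n" "p \<in> {1..n}" "r \<in> {1..n}" "l \<in> {1..n}" "k \<in> {1..n}"
  shows "(\<Sum>j\<in>{1..n}. orbit_metric n P p j * (orbit_christoffel n (monom 1 (n - j)) r l k - orbit_christoffel n (monom 1 (n - k)) r l j))
     = (\<Sum>a\<in>{1..n}. orbit_christoffel n P p r a * orbit_christoffel n P a l k - orbit_christoffel n P p l a * orbit_christoffel n P a r k)"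
proof -
  let ?Y = "monom 1 (n - k) :: complex poly" and ?c = "of_nat (n - 1)^2 :: complex"
  have "(\<Sum>j\<in>{1..n}. orbit_metric n P p j * (orbit_christoffel n (monom 1 (n - j)) r l k - orbit_christoffel n (monom 1 (n - k)) r l j))
     = ((\<Sum>j\<in>{1..n}. poly.coeff (metric_row (n - p) P) (n - j) * poly.coeff (christoffel_row (n - r) (monom 1 (n - j)) ?Y) (n - l))
       - (\<Sum>j\<in>{1..n}. poly.coeff (metric_row (n - p) P) (n - j) * poly.coeff (christoffel_row (n - r) ?Y (monom 1 (n - j))) (n - l))) / ?c"
    unfolding sum_subtractf[symmetric] sum_divide_distrib
    by (simp add: orbit_metric_def orbit_christoffel_def power2_eq_square right_diff_distrib diff_divide_distrib)
  also have "\<dots> = (poly.coeff (christoffel_row (n - r) (metric_row (n - p) P) ?Y) (n - l)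
      - poly.coeff (christoffel_row (n - r) ?Y (metric_row (n - p) P)) (n - l)) / ?c"
    by (simp only: sum_coeff_christoffel_row[OF coeff_metric_row_eq_0[OF assms(1)]])
  also have "\<dots> = (poly.coeff (christoffel_row (n - p) P (christoffel_col n (n - l) P ?Y)) (n - r)
      - poly.coeff (christoffel_row (n - p) P (christoffel_col n (n - r) P ?Y)) (n - l)) / ?c"
    by (subst christoffel_row_curvature[OF assms(1)]) (use assms in \<open>auto intro!: order_trans[OF degree_monom_le]\<close>)
  also have "\<dots> = ((\<Sum>a\<in>{1..n}. poly.coeff (christoffel_col n (n - l) P ?Y) (n - a) * poly.coeff (christoffel_row (n - p) P (monom 1 (n - a))) (n - r))
      - (\<Sum>a\<in>{1..n}. poly.coeff (christoffel_col n (n - r) P ?Y) (n - a) * poly.coeff (christoffel_row (n - p) P (monom 1 (n - a))) (n - l))) / ?c"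
    by (subst (1 2) sum_coeff_christoffel_row(1)) (auto simp: coeff_christoffel_col)
  also have "\<dots> = (\<Sum>a\<in>{1..n}. orbit_christoffel n P p r a * orbit_christoffel n P a l k - orbit_christoffel n P p l a * orbit_christoffel n P a r k)"
    unfolding sum_subtractf[symmetric] sum_divide_distrib
    by (intro sum.cong refl)
       (auto simp: orbit_christoffel_def coeff_christoffel_col power2_eq_square diff_divide_distrib mult.commute)
  finally show ?thesis .
qed

lemma eventually_orbit_domain:
  assumes "x \<in> orbit_domain n" "k \<in> {1..n}"
  shows "\<forall>\<^sub>F t in nhds (x k). x(k := t) \<in> orbit_domain n"
proof (cases "k = n")
  case True
  hence "\<forall>\<^sub>F t in nhds (x k). t \<noteq> 0" using assms by (intro t1_space_nhds) (auto simp: orbit_domain_def)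
  thus ?thesis by (rule eventually_mono) (use assms True in \<open>auto simp: orbit_domain_def\<close>)
next
  case False
  thus ?thesis using assms by (intro always_eventually) (auto simp: orbit_domain_def)
qed

lemma orbit_metric_sym: "orbit_metric n P i j = orbit_metric n P j i"
  by (simp add: orbit_metric_def coeff_metric_row_sym[of "n - i"])

text \<open>The formula for h is available on the domain only, so h is differentiated after
  restricting to nearby points of the domain.\<close>

lemma contravariant_flat_orbit_metric:
  assumes "degree Z \<le> n" "\<And>x i j. x \<in> orbit_domain n \<Longrightarrow> i \<in> {1..n} \<Longrightarrow> j \<in> {1..n} \<Longrightarrow> h x i j = orbit_metric n (orbit_poly n x + Z) i j"
  shows "contravariant_flat n (orbit_domain n) h (\<lambda>x. orbit_christoffel n (orbit_poly n x + Z)) (\<lambda>m x. orbit_christoffel n (monom 1 (n - m)))"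
proof
  fix x i j k assume x: "x \<in> orbit_domain n" and ijk: "i \<in> {1..n}" "j \<in> {1..n}" "k \<in> {1..n}"
  have d: "degree (orbit_poly n x + Z) \<le> n" using assms(1) degree_orbit_poly by (intro degree_add_le)
  show "\<forall>\<^sub>F t in nhds (x k). x(k := t) \<in> orbit_domain n"
    by (rule eventually_orbit_domain[OF x ijk(3)])
  show "h x i j = h x j i" by (simp only: assms(2)[OF x] ijk orbit_metric_sym)
  have "\<forall>\<^sub>F t in nhds (x k). h (x(k := t)) i j = orbit_metric n (orbit_poly n (x(k := t)) + Z) i j"
    using eventually_orbit_domain[OF x ijk(3)]
    by (rule eventually_mono) (rule assms(2)[OF _ ijk(1,2)])
  thus "((\<lambda>t. h (x(k := t)) i j) has_field_derivative
      orbit_christoffel n (orbit_poly n x + Z) i j k + orbit_christoffel n (orbit_poly n x + Z) j i k) (at (x k))"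
    by (subst DERIV_cong_ev[OF refl _ refl]) (auto intro: orbit_metric_has_derivative[OF ijk(3,1,2)])
  have h: "(\<Sum>s\<in>{1..n}. h x i s * f s) = (\<Sum>s\<in>{1..n}. orbit_metric n (orbit_poly n x + Z) i s * f s)" if "i \<in> {1..n}" for i f
    using that by (intro sum.cong refl) (simp add: assms(2)[OF x])
  show "(\<Sum>s\<in>{1..n}. h x i s * orbit_christoffel n (orbit_poly n x + Z) j k s) = (\<Sum>s\<in>{1..n}. h x j s * orbit_christoffel n (orbit_poly n x + Z) i k s)"
    unfolding h[OF ijk(1)] h[OF ijk(2)] by (rule orbit_metric_torsion_free[OF d ijk(1,2)])
  fix l assume l: "l \<in> {1..n}"
  show "(\<Sum>j\<in>{1..n}. h x i j * (orbit_christoffel n (monom 1 (n - j)) j' l k - orbit_christoffel n (monom 1 (n - k)) j' l j))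
     = (\<Sum>a\<in>{1..n}. orbit_christoffel n (orbit_poly n x + Z) i j' a * orbit_christoffel n (orbit_poly n x + Z) a l k
         - orbit_christoffel n (orbit_poly n x + Z) i l a * orbit_christoffel n (orbit_poly n x + Z) a j' k)" if "j' \<in> {1..n}" for j'
    unfolding h[OF ijk(1)] by (rule orbit_metric_curvature[OF d ijk(1) that l ijk(3)])
  have "orbit_christoffel n (orbit_poly n (x(l := t)) + Z) i j k = orbit_christoffel n (orbit_poly n x + Z) i j k + (t - x l) * orbit_christoffel n (monom 1 (n - l)) i j k" for t
    by (simp add: orbit_poly_fun_upd[OF l] orbit_christoffel_def christoffel_row_add_left christoffel_row_smult_left add_divide_distrib)
  thus "((\<lambda>t. orbit_christoffel n (orbit_poly n (x(l := t)) + Z) i j k) has_field_derivative orbit_christoffel n (monom 1 (n - l)) i j k) (at (x l))"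
    by (auto intro!: derivative_eq_intros)
qed

section \<open>The metric eta and the linearity of the pencil\<close>

lemma metric_row_monom_1: "metric_row a (monom 1 1) = 0"
  by (auto simp: metric_row_def bezout_row_def monom_altdef pderiv_pCons poly_shift_Suc[of 0] poly_eq_iff coeff_poly_shift coeff_pCons split: nat.splits)

text \<open>In the direction z the Bezoutians reduce to a divided difference, so only the sum of the
  exponents matters; this is the Hankel form of eta.\<close>

lemma coeff_metric_row_deriv_monom_1:
  "poly.coeff (metric_row_deriv a P (monom 1 1)) b = of_nat (a + b) * poly.coeff P (a + b + 1)"
proof -
  have z: "(monom 1 1 :: complex poly) = [:0, 1:]" by (simp add: monom_altdef)
  have z': "pderiv (monom 1 1 :: complex poly) = 1" by (simp only: z) (simp add: pderiv_pCons one_pCons)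
  have sz: "poly_shift (Suc a) (monom 1 1 :: complex poly) = (if a = 0 then 1 else 0)"
    by (simp add: poly_shift_monom)
  have "poly.coeff (metric_row_deriv a P (monom 1 1)) b = poly.coeff (pderiv P) (a + b) - poly.coeff P (a + b + 1)"
    unfolding metric_row_deriv_def bezout_row_def z' sz unfolding z
    by (cases b) (auto simp: poly_shift_1 coeff_poly_shift add.commute)
  thus ?thesis by (simp add: coeff_pderiv algebra_simps)
qed

lemma coeff_christoffel_row_monom_1:
  "poly.coeff (christoffel_row a (monom 1 1) Y) b = of_nat b * poly.coeff Y (a + b + 1)"
proof -
  have z: "(monom 1 1 :: complex poly) = [:0, 1:]" by (simp add: monom_altdef)
  have z': "pderiv (monom 1 1 :: complex poly) = 1" by (simp only: z) (simp add: pderiv_pCons one_pCons)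
  have sz: "poly_shift (Suc a) (monom 1 1 :: complex poly) = (if a = 0 then 1 else 0)"
    by (simp add: poly_shift_monom)
  show ?thesis
    unfolding christoffel_row_def bezout_row_def z' sz pderiv_diff unfolding z
    by (auto simp: poly_shift_1 coeff_poly_shift coeff_pderiv algebra_simps)
qed

text \<open>Q = z P' - P with its coefficients reversed and normalized: Q(z) = (n-1) z^n D(1/z) on
  \<open>orbit_domain\<close>.\<close>

definition eta_series :: "nat \<Rightarrow> pt \<Rightarrow> complex fps" where
  "eta_series n u = Abs_fps (\<lambda>k. if k = 0 then 1 else (of_nat (n - 1) - of_nat k) / of_nat (n - 1) * u k)"

definition eta_metric :: "nat \<Rightarrow> pt \<Rightarrow> nat \<Rightarrow> nat \<Rightarrow> complex" where
  "eta_metric n u i j = (if n + 1 \<le> i + j then fps_nth (eta_series n u) (i + j - (n + 1)) else 0)"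

lemma eta_metric_eq_metric_row_deriv:
  assumes "n \<ge> 2" "i \<in> {1..n}" "j \<in> {1..n}"
  shows "eta_metric n u i j = poly.coeff (metric_row_deriv (n - i) (orbit_poly n u) (monom 1 1)) (n - j) / of_nat (n - 1)"
proof (cases "n + 1 \<le> i + j")
  case True
  define k where "k = i + j - (n + 1)"
  have k: "n - i + (n - j) + 1 = n - k" "k \<le> n - 1" "n - i + (n - j) = n - 1 - k"
    using True assms by (auto simp: k_def)
  have "of_nat (n - 1 - k) = (of_nat (n - 1) - of_nat k :: complex)" using k by (simp add: of_nat_diff)
  moreover have "eta_metric n u i j = fps_nth (eta_series n u) k" using True by (simp add: eta_metric_def k_def)
  moreover have "poly.coeff (orbit_poly n u) (n - k) = (if k = 0 then 1 else u k)"
    using k assms by (auto simp: coeff_orbit_poly)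
  ultimately show ?thesis
    unfolding coeff_metric_row_deriv_monom_1 k(1) unfolding k(3) using assms by (cases "k = 0") (simp_all add: eta_series_def)
next
  case False
  hence "poly.coeff (orbit_poly n u) (n - i + (n - j) + 1) = 0"
    using assms by (auto simp: coeff_orbit_poly)
  thus ?thesis using False unfolding coeff_metric_row_deriv_monom_1 by (simp add: eta_metric_def)
qed

text \<open>The term of second order in s is the metric of the polynomial z, which vanishes by
  \<open>metric_row_monom_1\<close>; this makes the shifted metric linear in s.\<close>

lemma orbit_metric_pencil:
  assumes "n \<ge> 2" "i \<in> {1..n}" "j \<in> {1..n}"
  shows "orbit_metric n (orbit_poly n u + smult (- s) (monom 1 1)) i j = orbit_metric n (orbit_poly n u) i j - s * eta_metric n u i j"
  unfolding orbit_metric_def metric_row_add_smult eta_metric_eq_metric_row_deriv[OF assms]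
  by (simp add: metric_row_monom_1[simplified] diff_divide_distrib)

text \<open>The contravariant symbols of eta: those of g with P replaced by z, hence independent of
  u.\<close>

definition eta_contra :: "nat \<Rightarrow> nat \<Rightarrow> nat \<Rightarrow> nat \<Rightarrow> complex" where
  "eta_contra n i j k = (if k + (n + 1) = i + j then of_nat (n - j) / of_nat (n - 1) else 0)"

lemma orbit_christoffel_monom_1:
  assumes "i \<in> {1..n}" "j \<in> {1..n}" "k \<in> {1..n}"
  shows "orbit_christoffel n (monom 1 1) i j k = eta_contra n i j k"
  unfolding orbit_christoffel_def coeff_christoffel_row_monom_1 eta_contra_def using assms by auto

lemma orbit_christoffel_pencil:
  assumes "i \<in> {1..n}" "j \<in> {1..n}" "k \<in> {1..n}"
  shows "orbit_christoffel n (orbit_poly n u + smult (- s) (monom 1 1)) i j k = orbit_christoffel n (orbit_poly n u) i j k - s * eta_contra n i j k"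
  unfolding orbit_christoffel_monom_1[OF assms, symmetric]
  unfolding orbit_christoffel_def christoffel_row_add_left christoffel_row_smult_left coeff_add coeff_smult by (simp add: diff_divide_distrib)

lemma eta_series_0 [simp]: "fps_nth (eta_series n u) 0 = 1"
  by (simp add: eta_series_def)

lemma eta_series_fun_upd:
  assumes "k \<in> {1..n}"
  shows "eta_series n (u(k := t)) = eta_series n u + fps_const ((t - u k) * ((of_nat (n - 1) - of_nat k) / of_nat (n - 1))) * fps_X ^ k"
proof -
  define c where "c = ((of_nat (n - 1) - of_nat k) / of_nat (n - 1) :: complex)"
  have "c * t = c * u k + (t - u k) * c" by (simp add: algebra_simps)
  thus ?thesis using assms unfolding eta_series_def c_def[symmetric]
    by (auto simp only: fps_eq_iff fps_nth_Abs_fps fps_add_nth fps_mult_left_const_nth fps_X_power_nth fun_upd_apply c_def) auto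
qed

lemma eta_metric_sym: "eta_metric n u i j = eta_metric n u j i"
  by (simp add: eta_metric_def add.commute)

lemma eta_contra_add:
  assumes "n \<ge> 2" "i \<in> {1..n}" "j \<in> {1..n}" "k \<in> {1..n}"
  shows "eta_contra n i j k + eta_contra n j i k = (if k + (n + 1) = i + j then (of_nat (n - 1) - of_nat k) / of_nat (n - 1) else 0)"
proof -
  have "n - j + (n - i) = n - 1 - k \<and> k \<le> n - 1" if "k + (n + 1) = i + j" using assms that by auto
  hence "of_nat (n - j) + of_nat (n - i) = (of_nat (n - 1) - of_nat k :: complex)" if "k + (n + 1) = i + j"
    using that by (metis of_nat_add of_nat_diff)
  thus ?thesis by (auto simp: eta_contra_def add_divide_distrib[symmetric] add.commute)
qed

lemma eta_metric_has_derivative: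
  assumes "n \<ge> 2" "i \<in> {1..n}" "j \<in> {1..n}" "k \<in> {1..n}"
  shows "((\<lambda>t. eta_metric n (x(k := t)) i j) has_field_derivative eta_contra n i j k + eta_contra n j i k) (at (x k))"
proof -
  define c where "c = ((of_nat (n - 1) - of_nat k) / of_nat (n - 1) :: complex)"
  have "eta_metric n (x(k := t)) i j = eta_metric n x i j + (t - x k) * (if k + (n + 1) = i + j then c else 0)" for t
    using assms(4) by (auto simp: eta_metric_def eta_series_fun_upd[OF assms(4)] c_def)
  moreover have "eta_contra n i j k + eta_contra n j i k = (if k + (n + 1) = i + j then c else 0)"
    unfolding eta_contra_add[OF assms] c_def ..
  ultimately show ?thesis by (auto intro!: derivative_eq_intros)
qed

text \<open>The closed form is symmetric in i and j, which is \<open>torsion_free\<close> for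
  eta.\<close>

lemma sum_eta_metric_eta_contra:
  assumes "i \<in> {1..n}" "j \<in> {1..n}" "k \<in> {1..n}"
  shows "(\<Sum>s\<in>{1..n}. eta_metric n x i s * eta_contra n j k s) =
     (if 2 * n + 2 \<le> i + j + k then fps_nth (eta_series n x) (i + j + k - (2 * n + 2)) * (of_nat (n - k) / of_nat (n - 1)) else 0)"
proof (cases "n + 1 < j + k")
  case True
  define s where "s = j + k - (n + 1)"
  have s: "s \<in> {1..n}" "\<And>s'. s' + (n + 1) = j + k \<longleftrightarrow> s' = s" using True assms by (auto simp: s_def)
  have "(\<Sum>s\<in>{1..n}. eta_metric n x i s * eta_contra n j k s) = eta_metric n x i s * (of_nat (n - k) / of_nat (n - 1))"
  proof -
    have "eta_metric n x i s' * eta_contra n j k s' = (if s' = s then eta_metric n x i s * (of_nat (n - k) / of_nat (n - 1)) else 0)" for s'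
      unfolding eta_contra_def s(2) by simp
    thus ?thesis using s(1) by simp
  qed
  also have "\<dots> = (if 2 * n + 2 \<le> i + j + k then fps_nth (eta_series n x) (i + j + k - (2 * n + 2)) * (of_nat (n - k) / of_nat (n - 1)) else 0)"
  proof -
    have "n + 1 \<le> i + s \<longleftrightarrow> 2 * n + 2 \<le> i + j + k" "i + s - (n + 1) = i + j + k - (2 * n + 2)"
      using True by (auto simp: s_def)
    thus ?thesis by (simp add: eta_metric_def)
  qed
  finally show ?thesis .
next
  case False
  hence "(\<Sum>s\<in>{1..n}. eta_metric n x i s * eta_contra n j k s) = 0"
    by (intro sum.neutral) (auto simp: eta_contra_def)
  thus ?thesis using False assms by auto
qed

text \<open>The closed form is symmetric in r and l. As the symbols of eta are constant, this is all
  that \<open>curvature\<close> asks.\<close>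

lemma sum_eta_contra_eta_contra:
  assumes "p \<in> {1..n}" "r \<in> {1..n}" "l \<in> {1..n}" "k \<in> {1..n}"
  shows "(\<Sum>a\<in>{1..n}. eta_contra n p r a * eta_contra n a l k) =
     (if k + (2 * n + 2) = p + r + l then of_nat (n - r) * of_nat (n - l) / of_nat (n - 1)^2 else 0)"
proof (cases "n + 1 < p + r")
  case True
  define s where "s = p + r - (n + 1)"
  have s: "s \<in> {1..n}" "\<And>s'. s' + (n + 1) = p + r \<longleftrightarrow> s' = s" using True assms by (auto simp: s_def)
  have "(\<Sum>a\<in>{1..n}. eta_contra n p r a * eta_contra n a l k) = of_nat (n - r) / of_nat (n - 1) * eta_contra n s l k"
  proof -
    have "eta_contra n p r a * eta_contra n a l k = (if a = s then of_nat (n - r) / of_nat (n - 1) * eta_contra n s l k else 0)" for a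
      unfolding eta_contra_def[of n p] s(2) by simp
    thus ?thesis using s(1) by simp
  qed
  also have "\<dots> = (if k + (2 * n + 2) = p + r + l then of_nat (n - r) * of_nat (n - l) / of_nat (n - 1)^2 else 0)"
  proof -
    have "k + (n + 1) = s + l \<longleftrightarrow> k + (2 * n + 2) = p + r + l" using True by (auto simp: s_def)
    thus ?thesis by (simp add: eta_contra_def power2_eq_square)
  qed
  finally show ?thesis .
next
  case False
  hence "(\<Sum>a\<in>{1..n}. eta_contra n p r a * eta_contra n a l k) = 0"
    by (intro sum.neutral) (auto simp: eta_contra_def)
  thus ?thesis using False assms by auto
qed

lemma contravariant_flat_eta_metric:
  assumes "n \<ge> 2" "\<And>x i j. x \<in> orbit_domain n \<Longrightarrow> i \<in> {1..n} \<Longrightarrow> j \<in> {1..n} \<Longrightarrow> h x i j = eta_metric n x i j"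
  shows "contravariant_flat n (orbit_domain n) h (\<lambda>x. eta_contra n) (\<lambda>m x i j k. 0)"
proof
  fix x i j k assume x: "x \<in> orbit_domain n" and ijk: "i \<in> {1..n}" "j \<in> {1..n}" "k \<in> {1..n}"
  show "\<forall>\<^sub>F t in nhds (x k). x(k := t) \<in> orbit_domain n"
    by (rule eventually_orbit_domain[OF x ijk(3)])
  show "h x i j = h x j i" by (simp only: assms(2)[OF x] ijk eta_metric_sym)
  have "\<forall>\<^sub>F t in nhds (x k). h (x(k := t)) i j = eta_metric n (x(k := t)) i j"
    using eventually_orbit_domain[OF x ijk(3)]
    by (rule eventually_mono) (rule assms(2)[OF _ ijk(1,2)])
  thus "((\<lambda>t. h (x(k := t)) i j) has_field_derivative eta_contra n i j k + eta_contra n j i k) (at (x k))"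
    by (subst DERIV_cong_ev[OF refl _ refl]) (auto intro: eta_metric_has_derivative[OF assms(1) ijk])
  have h: "(\<Sum>s\<in>{1..n}. h x i s * f s) = (\<Sum>s\<in>{1..n}. eta_metric n x i s * f s)" if "i \<in> {1..n}" for i f
    using that by (intro sum.cong refl) (simp add: assms(2)[OF x])
  show "(\<Sum>s\<in>{1..n}. h x i s * eta_contra n j k s) = (\<Sum>s\<in>{1..n}. h x j s * eta_contra n i k s)"
    unfolding h[OF ijk(1)] h[OF ijk(2)] sum_eta_metric_eta_contra[OF ijk] sum_eta_metric_eta_contra[OF ijk(2,1,3)]
    by (simp add: add.commute)
  fix l assume l: "l \<in> {1..n}"
  show "(\<Sum>s\<in>{1..n}. h x i s * (0 - 0)) = (\<Sum>a\<in>{1..n}. eta_contra n i j a * eta_contra n a l k - eta_contra n i l a * eta_contra n a j k)"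
    unfolding sum_subtractf sum_eta_contra_eta_contra[OF ijk(1,2) l ijk(3)] sum_eta_contra_eta_contra[OF ijk(1) l ijk(2,3)]
    by (simp add: mult.commute add.commute add.left_commute)
qed auto


section \<open>Reduction to polynomial form\<close>

lemma coeff_prod_linear:
  "poly.coeff (\<Prod>k\<in>{1..n}. [:(p k)^2, 1:]) m = (if m \<le> n then bu n (n - m) p else 0)"
proof -
  have pc: "(\<Prod>k\<in>S. [:q k:]) = [:\<Prod>k\<in>S. q k:]" for q :: "nat \<Rightarrow> complex" and S
    by (induction S rule: infinite_finite_induct) (auto simp: one_pCons)
  have "(\<Prod>k\<in>{1..n}. [:(p k)^2, 1:]) = (\<Prod>k\<in>{1..n}. [:(p k)^2:] + monom 1 1)"
    by (simp add: monom_altdef)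
  also have "\<dots> = (\<Sum>S\<in>Pow {1..n}. (\<Prod>k\<in>S. [:(p k)^2:]) * (\<Prod>k\<in>{1..n} - S. monom 1 1))"
    by (rule prod_add) simp
  also have "\<dots> = (\<Sum>S\<in>Pow {1..n}. monom (\<Prod>k\<in>S. (p k)^2) (n - card S))"
    by (intro sum.cong refl)
       (auto simp: pc monom_power smult_monom card_Diff_subset finite_subset)
  finally have "poly.coeff (\<Prod>k\<in>{1..n}. [:(p k)^2, 1:]) m
     = (\<Sum>S\<in>Pow {1..n}. if n - card S = m then \<Prod>k\<in>S. (p k)^2 else 0)"
    by (simp add: coeff_sum)
  also have "\<dots> = (\<Sum>S\<in>{S \<in> Pow {1..n}. n - card S = m}. \<Prod>k\<in>S. (p k)^2)"
    by (subst sum.inter_filter[symmetric]) auto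
  also have "{S \<in> Pow {1..n}. n - card S = m} = (if m \<le> n then {S. S \<subseteq> {1..n} \<and> card S = n - m} else {})"
  proof -
    have "card S \<le> n" if "S \<subseteq> {1..n}" for S using card_mono[OF _ that] by simp
    thus ?thesis by force
  qed
  finally show ?thesis by (simp add: bu_def)
qed

lemma bu_0 [simp]: "bu n 0 p = 1"
proof -
  have "{S. S \<subseteq> {1..n} \<and> card S = 0} = {{}}" using finite_subset by fastforce
  thus ?thesis unfolding bu_def by simp
qed

lemma orbit_poly_umap: "orbit_poly n (umap n p) = (\<Prod>k\<in>{1..n}. [:(p k)^2, 1:])"
  by (rule poly_eqI) (auto simp only: coeff_prod_linear coeff_orbit_poly umap_def, auto)

text \<open>The p_k are square roots of the negated roots of the orbit polynomial, and u n \<noteq>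
  0 excludes the root 0. Hence each point of the domain, including those with multiple roots, is the
  image of a p to which the hypothesis on G applies.\<close>

lemma umap_surj:
  assumes "u \<in> orbit_domain n" "n \<ge> 1"
  obtains p where "umap n p = u" "\<And>k. k \<in> {1..n} \<Longrightarrow> p k \<noteq> 0"
proof -
  have "degree (orbit_poly n u) = n"
    using degree_orbit_poly[of n u] by (intro antisym le_degree) (auto simp: coeff_orbit_poly)
  hence "lead_coeff (orbit_poly n u) = 1" by (simp add: coeff_orbit_poly)
  then obtain root where root: "(\<Prod>i<n. [:- root i, 1:]) = orbit_poly n u"
    using complex_poly_decompose'[of "orbit_poly n u"] \<open>degree (orbit_poly n u) = n\<close> by auto
  define p where "p k = csqrt (- root (k - 1))" for k
  have "(\<Prod>k\<in>{1..n}. [:(p k)^2, 1:]) = (\<Prod>i<n. [:- root i, 1:])"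
    by (rule prod.reindex_bij_witness[of _ Suc "\<lambda>k. k - 1"]) (auto simp: p_def)
  hence P: "(\<Prod>k\<in>{1..n}. [:(p k)^2, 1:]) = orbit_poly n u" using root by simp
  show thesis
  proof (rule that)
    show "umap n p = u"
    proof
      fix k
      show "umap n p k = u k"
      proof (cases "k \<in> {1..n}")
        case True
        have "poly.coeff (orbit_poly n (umap n p)) (n - k) = poly.coeff (orbit_poly n u) (n - k)"
          by (simp only: orbit_poly_umap P)
        moreover have "n - k < n" "n - (n - k) = k" using True by auto
        ultimately show ?thesis by (simp add: coeff_orbit_poly)
      qed (use assms in \<open>auto simp: umap_def orbit_domain_def\<close>)
    qed
    fix k assume k: "k \<in> {1..n}"
    have "poly (orbit_poly n u) 0 = u n" using assms(2) by (simp add: poly_0_coeff_0 coeff_orbit_poly)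
    hence "(\<Prod>k\<in>{1..n}. (p k)^2) \<noteq> 0"
      unfolding P[symmetric] using assms(1) by (simp add: poly_prod orbit_domain_def)
    thus "p k \<noteq> 0" using k by auto
  qed
qed

text \<open>In closed form: ((z + q) - (w + q)) R(z) R(w) / (z - w) = R(z) R(w).\<close>

lemma bezout_row_linear_factor: "bezout_row a ([:q, 1:] * R) R = smult (poly.coeff R a) R"
proof -
  have "poly_shift (Suc a) ([:q, 1:] * R) = smult q (poly_shift (Suc a) R) + poly_shift a R"
    by (simp add: poly_eq_iff coeff_poly_shift)
  moreover have "poly_shift a R = [:poly.coeff R a:] + [:0, 1:] * poly_shift (Suc a) R"
    by (subst poly_shift_Suc) simp
  ultimately show ?thesis
    by (simp add: bezout_row_def algebra_simps)
qed

lemma bezout_row_sum_right: "bezout_row s X (\<Sum>i\<in>I. Y i) = (\<Sum>i\<in>I. bezout_row s X (Y i))"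
proof -
  have "bezout_row s X 0 = 0" by (simp add: bezout_row_def)
  thus ?thesis by (induction I rule: infinite_finite_induct) (simp_all add: bezout_row_add_right)
qed

text \<open>Let R_k = P / (z + p_k^2), so dP/dp_k = 2 p_k R_k. The metric becomes 4 times the sum of
  R_k(z) R_l(w) over k \<noteq> l, and the sum over all k, l is P'(z) P'(w). Each diagonal term
  R_k(z) R_k(w) is the Bezoutian of P and R_k, and together they form the Bezoutian of P and
  P'.\<close>

lemma gBu_eq:
  assumes "\<And>k. k \<in> {1..n} \<Longrightarrow> p k \<noteq> 0" "i \<in> {1..n}" "j \<in> {1..n}"
  shows "gBu n p i j = 4 * poly.coeff (metric_row (n - i) (orbit_poly n (umap n p))) (n - j)"
proof -
  define R where "R k = (\<Prod>l\<in>{1..n} - {k}. [:(p l)^2, 1:])" for k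
  let ?P = "orbit_poly n (umap n p)"
  have P: "?P = [:(p k)^2, 1:] * R k" if "k \<in> {1..n}" for k
    unfolding orbit_poly_umap R_def using that by (subst prod.remove[of _ k]) auto
  have pd: "pd k (bu n i) p = 2 * p k * poly.coeff (R k) (n - i)" if k: "k \<in> {1..n}" and i: "i \<in> {1..n}" for k i
  proof -
    have "bu n i (p(k := t)) = t^2 * poly.coeff (R k) (n - i) + poly.coeff (pCons 0 (R k)) (n - i)" for t
    proof -
      have "bu n i (p(k := t)) = poly.coeff (\<Prod>l\<in>{1..n}. [:((p(k := t)) l)^2, 1:]) (n - i)"
        using i by (subst coeff_prod_linear) simp
      also have "(\<Prod>l\<in>{1..n}. [:((p(k := t)) l)^2, 1:]) = [:t^2, 1:] * (\<Prod>l\<in>{1..n} - {k}. [:((p(k := t)) l)^2, 1:])"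
        using k by (subst prod.remove[of _ k]) auto
      also have "(\<Prod>l\<in>{1..n} - {k}. [:((p(k := t)) l)^2, 1:]) = R k"
        unfolding R_def by (intro prod.cong) auto
      finally show ?thesis by (simp add: fun_upd_def)
    qed
    hence "((\<lambda>t. bu n i (p(k := t))) has_field_derivative 2 * p k * poly.coeff (R k) (n - i)) (at (p k))"
      by (auto intro!: derivative_eq_intros)
    thus ?thesis unfolding pd_def by (rule DERIV_imp_deriv)
  qed
  have dP: "pderiv ?P = (\<Sum>k\<in>{1..n}. R k)"
    unfolding orbit_poly_umap pderiv_prod R_def by (intro sum.cong) (auto simp: pderiv_pCons)
  have "bezout_row (n - i) ?P (pderiv ?P) = (\<Sum>k\<in>{1..n}. smult (poly.coeff (R k) (n - i)) (R k))"
    unfolding dP bezout_row_sum_right by (intro sum.cong refl) (use P bezout_row_linear_factor in metis)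
  hence "poly.coeff (metric_row (n - i) ?P) (n - j) =
     (\<Sum>k\<in>{1..n}. \<Sum>l\<in>{1..n}. poly.coeff (R k) (n - i) * poly.coeff (R l) (n - j))
     - (\<Sum>k\<in>{1..n}. poly.coeff (R k) (n - i) * poly.coeff (R k) (n - j))"
    unfolding metric_row_def dP by (simp add: coeff_sum sum_product)
  also have "\<dots> = (\<Sum>k\<in>{1..n}. \<Sum>l\<in>{1..n}. if k = l then 0 else poly.coeff (R k) (n - i) * poly.coeff (R l) (n - j))"
  proof -
    have "(\<Sum>l\<in>{1..n}. if k = l then 0 else f l) = (\<Sum>l\<in>{1..n}. f l) - f k" if "k \<in> {1..n}" for k and f :: "nat \<Rightarrow> complex"
    proof -
      have "(\<Sum>l\<in>{1..n}. f l) - f k = (\<Sum>l\<in>{1..n}. f l - (if k = l then f l else 0))"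
        using that by (simp add: sum_subtractf)
      thus ?thesis by (auto intro!: sum.cong)
    qed
    thus ?thesis unfolding sum_subtractf[symmetric] by (intro sum.cong) auto
  qed
  also have "4 * \<dots> = gBu n p i j"
    unfolding gBu_def gBp_def sum_distrib_left
    using assms by (intro sum.cong refl) (auto simp: pd field_simps)
  finally show ?thesis by simp
qed

lemma G_eq_orbit_metric:
  assumes "n \<ge> 2"
    and "\<forall>p. (\<forall>k\<in>{1..n}. p k \<noteq> 0) \<longrightarrow>
           (\<forall>i\<in>{1..n}. \<forall>j\<in>{1..n}. G (umap n p) i j = gBu n p i j / (4 * of_nat (n - 1)))"
    and "u \<in> orbit_domain n" "i \<in> {1..n}" "j \<in> {1..n}"
  shows "G u i j = orbit_metric n (orbit_poly n u) i j"
proof -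
  obtain p where p: "umap n p = u" "\<And>k. k \<in> {1..n} \<Longrightarrow> p k \<noteq> 0"
    using umap_surj[OF assms(3)] assms(1) by (metis one_le_numeral order_trans)
  hence "G (umap n p) i j = gBu n p i j / (4 * of_nat (n - 1))" using assms by blast
  also have "\<dots> = orbit_metric n (orbit_poly n u) i j"
  proof -
    have "gBu n p i j = 4 * poly.coeff (metric_row (n - i) (orbit_poly n (umap n p))) (n - j)"
      by (rule gBu_eq) (use p assms in auto)
    thus ?thesis by (simp add: p(1) orbit_metric_def)
  qed
  finally show ?thesis using p(1) by simp
qed

text \<open>The coordinate u_(n-1) multiplies z^1, so this derivative is
  \<open>metric_row_deriv\<close> in the direction \<open>monom 1 1\<close>.\<close>

lemma pd_G_eq_eta_metric:
  assumes "n \<ge> 2"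
    and "\<And>u i j. u \<in> orbit_domain n \<Longrightarrow> i \<in> {1..n} \<Longrightarrow> j \<in> {1..n} \<Longrightarrow> G u i j = orbit_metric n (orbit_poly n u) i j"
    and u: "u \<in> orbit_domain n" "i \<in> {1..n}" "j \<in> {1..n}"
  shows "pd (n - 1) (\<lambda>v. G v i j) u = eta_metric n u i j"
proof -
  have n1: "n - 1 \<in> {1..n}" using assms(1) by auto
  interpret contravariant_flat n "orbit_domain n" G "\<lambda>x. orbit_christoffel n (orbit_poly n x + 0)" "\<lambda>m x. orbit_christoffel n (monom 1 (n - m))"
    by (rule contravariant_flat_orbit_metric) (use assms(2) in auto)
  have "pd (n - 1) (\<lambda>v. G v i j) u = orbit_christoffel n (orbit_poly n u) i j (n - 1) + orbit_christoffel n (orbit_poly n u) j i (n - 1)"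
    unfolding pd_def using DERIV_imp_deriv[OF metric_deriv[OF u n1]] by simp
  also have "\<dots> = poly.coeff (metric_row_deriv (n - i) (orbit_poly n u) (monom 1 (n - (n - 1)))) (n - j) / of_nat (n - 1)"
    unfolding orbit_christoffel_def christoffel_row_compatible[symmetric] by (simp add: add_divide_distrib)
  also have "n - (n - 1) = 1" using assms(1) by simp
  finally show ?thesis by (simp only: eta_metric_eq_metric_row_deriv[OF assms(1) u(2,3)])
qed

lemma flat_pencil_orbit_metric_eta_metric:
  assumes n: "n \<ge> 2"
    and G: "\<And>u i j. u \<in> orbit_domain n \<Longrightarrow> i \<in> {1..n} \<Longrightarrow> j \<in> {1..n} \<Longrightarrow> G u i j = orbit_metric n (orbit_poly n u) i j"
    and H: "\<And>u i j. u \<in> orbit_domain n \<Longrightarrow> i \<in> {1..n} \<Longrightarrow> j \<in> {1..n} \<Longrightarrow> H u i j = eta_metric n u i j"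
  shows "flat_pencil n (orbit_domain n) G H"
proof -
  interpret g: contravariant_flat n "orbit_domain n" G "\<lambda>x. orbit_christoffel n (orbit_poly n x + 0)" "\<lambda>m x. orbit_christoffel n (monom 1 (n - m))"
    by (rule contravariant_flat_orbit_metric) (use G in auto)
  interpret eta: contravariant_flat n "orbit_domain n" H "\<lambda>x. eta_contra n" "\<lambda>m x i j k. 0"
    by (rule contravariant_flat_eta_metric) (use n H in auto)
  have pencil: "contravariant_flat n (orbit_domain n) (\<lambda>x i j. G x i j - s * H x i j)
      (\<lambda>x. orbit_christoffel n (orbit_poly n x + smult (- s) (monom 1 1))) (\<lambda>m x. orbit_christoffel n (monom 1 (n - m)))" for s
  proof (rule contravariant_flat_orbit_metric)
    show "degree (smult (- s) (monom 1 1)) \<le> n"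
      using n by (intro order_trans[OF degree_smult_le order_trans[OF degree_monom_le]]) auto
  qed (use n G H orbit_metric_pencil in auto)
  show ?thesis
    unfolding flat_pencil_def
  proof (intro conjI allI ballI impI)
    show "flat_on n (orbit_domain n) (\<lambda>x i j. G x i j - s * H x i j)" for s
      by (rule contravariant_flat.flat_on[OF pencil])
    fix s x i j k
    assume x: "x \<in> orbit_domain n"
      and nd: "nondeg n G x \<and> nondeg n H x \<and> nondeg n (\<lambda>x i j. G x i j - s * H x i j) x"
      and ijk: "i \<in> {1..n}" "j \<in> {1..n}" "k \<in> {1..n}"
    have "contra_christ n (\<lambda>x i j. G x i j - s * H x i j) x i j k
       = orbit_christoffel n (orbit_poly n x + smult (- s) (monom 1 1)) i j k"
      using contravariant_flat.contra_christ_eq[OF pencil x _ ijk] nd by blast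
    thus "contra_christ n (\<lambda>x i j. G x i j - s * H x i j) x i j k =
        contra_christ n G x i j k - s * contra_christ n H x i j k"
      using g.contra_christ_eq[OF x _ ijk] eta.contra_christ_eq[OF x _ ijk] nd
      by (simp only: orbit_christoffel_pencil[OF ijk]) simp
  qed (use g.is_cometric eta.is_cometric in auto)
qed


section \<open>The Frobenius algebra\<close>

definition eta_series_inv :: "nat \<Rightarrow> pt \<Rightarrow> complex fps" where
  "eta_series_inv n u = inverse (eta_series n u)"

text \<open>\<open>rho n u (i + j + k)\<close> is the lowered structure constant. The extra term at \<open>3 * n\<close> is forced by the
  recurrence with coefficients \<open>eta_series\<close>, whose last coefficient is \<open>- u n / (n - 1)\<close>.\<close>

definition rho :: "nat \<Rightarrow> pt \<Rightarrow> nat \<Rightarrow> complex" where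
  "rho n u N = (if N \<le> 2 * n then fps_nth (eta_series_inv n u) (2 * n - N) else 0)
     + (if N = 3 * n then of_nat (n - 1) / u n else 0)"

definition product_coeff :: "nat \<Rightarrow> pt \<Rightarrow> nat \<Rightarrow> nat \<Rightarrow> nat \<Rightarrow> complex" where
  "product_coeff n u i j k = (\<Sum>a\<in>{1..n}. eta_metric n u k a * rho n u (i + j + a))"

definition euler_field :: "nat \<Rightarrow> pt \<Rightarrow> nat \<Rightarrow> complex" where
  "euler_field n u k = of_nat k * u k / of_nat (n - 1)"

text \<open>The unit is d/du_(n-1), so eta(d_i, d_j) = c(e, d_i, d_j); hence the shift by n -
  1.\<close>

definition eta_lower :: "nat \<Rightarrow> pt \<Rightarrow> nat \<Rightarrow> nat \<Rightarrow> complex" where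
  "eta_lower n u i j = rho n u (i + j + (n - 1))"

lemma eta_series_eta_series_inv: "eta_series n u * eta_series_inv n u = 1"
  unfolding eta_series_inv_def by (rule inverse_mult_eq_1') simp

lemma sum_eta_series_eta_series_inv:
  "(\<Sum>k\<le>m. fps_nth (eta_series n u) k * fps_nth (eta_series_inv n u) (m - k)) = (if m = 0 then 1 else 0)"
  using arg_cong[OF eta_series_eta_series_inv[of n u], of "\<lambda>f. fps_nth f m"] by (simp add: fps_mult_nth atLeast0AtMost)

lemma eta_series_eq_0:
  assumes "u \<in> orbit_domain n" "k > n"
  shows "fps_nth (eta_series n u) k = 0"
  using assms by (simp add: eta_series_def orbit_domain_def)

lemma eta_series_n_minus_1: "n \<ge> 2 \<Longrightarrow> fps_nth (eta_series n u) (n - 1) = 0"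
  by (simp add: eta_series_def)

lemma eta_series_n: "n \<ge> 2 \<Longrightarrow> fps_nth (eta_series n u) n = - u n / of_nat (n - 1)"
  by (simp add: eta_series_def of_nat_diff)

lemma sum_eta_metric:
  assumes "a \<in> {1..n}"
  shows "(\<Sum>b\<in>{1..n}. eta_metric n u a b * f b) = (\<Sum>h<a. fps_nth (eta_series n u) h * f (h + (n + 1 - a)))"
proof -
  have "(\<Sum>b\<in>{1..n}. eta_metric n u a b * f b) = (\<Sum>b\<in>{n + 1 - a..n}. eta_metric n u a b * f b)"
    using assms by (intro sum.mono_neutral_right) (auto simp: eta_metric_def)
  also have "\<dots> = (\<Sum>h<a. fps_nth (eta_series n u) h * f (h + (n + 1 - a)))"
    by (rule sum.reindex_bij_witness[of _ "\<lambda>h. h + (n + 1 - a)" "\<lambda>b. b - (n + 1 - a)"])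
       (use assms in \<open>auto simp: eta_metric_def add.commute\<close>)
  finally show ?thesis .
qed

text \<open>Since i + j + n - 1 < 3n, the exceptional value of \<open>rho\<close> is not
  reached.\<close>

lemma eta_lower_eq:
  assumes "n \<ge> 2" "i \<in> {1..n}" "j \<in> {1..n}"
  shows "eta_lower n u i j = (if i + j \<le> n + 1 then fps_nth (eta_series_inv n u) (n + 1 - (i + j)) else 0)"
proof -
  have "i + j + (n - 1) \<noteq> 3 * n" "i + j + (n - 1) \<le> 2 * n \<longleftrightarrow> i + j \<le> n + 1"
    "2 * n - (i + j + (n - 1)) = n + 1 - (i + j)"
    using assms by auto
  thus ?thesis by (simp add: eta_lower_def rho_def)
qed

text \<open>Row a meets column c in the Cauchy product of D and R in degree a - c, a coefficient of
  D R = 1.\<close>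

lemma eta_metric_eta_lower:
  assumes "n \<ge> 2" "a \<in> {1..n}" "c \<in> {1..n}"
  shows "(\<Sum>b\<in>{1..n}. eta_metric n u a b * eta_lower n u b c) = (if a = c then 1 else 0)"
proof -
  have "(\<Sum>b\<in>{1..n}. eta_metric n u a b * eta_lower n u b c)
     = (\<Sum>h<a. fps_nth (eta_series n u) h * eta_lower n u (h + (n + 1 - a)) c)"
    by (rule sum_eta_metric[OF assms(2)])
  also have "\<dots> = (\<Sum>h<a. fps_nth (eta_series n u) h * (if h + c \<le> a then fps_nth (eta_series_inv n u) (a - c - h) else 0))"
  proof (intro sum.cong refl)
    fix h assume h: "h \<in> {..<a}"
    have "eta_lower n u (h + (n + 1 - a)) c = (if h + (n + 1 - a) + c \<le> n + 1 then
       fps_nth (eta_series_inv n u) (n + 1 - (h + (n + 1 - a) + c)) else 0)"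
      using h assms by (intro eta_lower_eq) auto
    moreover have "h + (n + 1 - a) + c \<le> n + 1 \<longleftrightarrow> h + c \<le> a" "n + 1 - (h + (n + 1 - a) + c) = a - c - h"
      using h assms by auto
    ultimately show "fps_nth (eta_series n u) h * eta_lower n u (h + (n + 1 - a)) c
       = fps_nth (eta_series n u) h * (if h + c \<le> a then fps_nth (eta_series_inv n u) (a - c - h) else 0)" by simp
  qed
  also have "\<dots> = (if a = c then 1 else 0)"
  proof (cases "c \<le> a")
    case True
    have "(\<Sum>h<a. fps_nth (eta_series n u) h * (if h + c \<le> a then fps_nth (eta_series_inv n u) (a - c - h) else 0))
       = (\<Sum>h\<le>a - c. fps_nth (eta_series n u) h * fps_nth (eta_series_inv n u) (a - c - h))"
      using assms True by (intro sum.mono_neutral_cong_right) auto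
    thus ?thesis using True by (simp only: sum_eta_series_eta_series_inv) auto
  next
    case False
    thus ?thesis by (auto intro!: sum.neutral)
  qed
  finally show ?thesis .
qed

text \<open>In residue form the sum collects residues of z^(2n-1-N) at the zeros of Q, where it has
  no pole. In coefficients it is D R = 1; at N = 2n the constant term 1 is cancelled by D_n times
  the exceptional value of \<open>rho\<close>.\<close>

lemma rho_recurrence:
  assumes "n \<ge> 2" "u \<in> orbit_domain n" "N \<le> 2 * n + 1"
  shows "(\<Sum>k\<le>n. fps_nth (eta_series n u) k * rho n u (N + k)) = 0"
proof (cases "N = 2 * n + 1")
  case True
  \<comment> \<open>Only k = n - 1 gives N + k = 3n, and D vanishes at that index.\<close>
  show ?thesis
  proof (intro sum.neutral ballI)
    fix k assume "k \<in> {..n}"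
    show "fps_nth (eta_series n u) k * rho n u (N + k) = 0"
      using True assms eta_series_n_minus_1[OF assms(1), of u] by (cases "k = n - 1") (auto simp: rho_def)
  qed
next
  case False
  hence N: "N \<le> 2 * n" using assms by simp
  have "(\<Sum>k\<le>n. fps_nth (eta_series n u) k * rho n u (N + k))
     = (\<Sum>k\<le>n. fps_nth (eta_series n u) k * (if N + k \<le> 2 * n then fps_nth (eta_series_inv n u) (2 * n - N - k) else 0))
     + (\<Sum>k\<le>n. fps_nth (eta_series n u) k * (if N + k = 3 * n then of_nat (n - 1) / u n else 0))"
    unfolding rho_def diff_diff_left by (simp only: distrib_left sum.distrib)
  also have "(\<Sum>k\<le>n. fps_nth (eta_series n u) k * (if N + k \<le> 2 * n then fps_nth (eta_series_inv n u) (2 * n - N - k) else 0))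
     = (\<Sum>k\<le>2 * n - N. fps_nth (eta_series n u) k * fps_nth (eta_series_inv n u) (2 * n - N - k))"
  proof -
    have "(\<Sum>k\<le>n. fps_nth (eta_series n u) k * (if N + k \<le> 2 * n then fps_nth (eta_series_inv n u) (2 * n - N - k) else 0))
     = (\<Sum>k\<le>2 * n. fps_nth (eta_series n u) k * (if N + k \<le> 2 * n then fps_nth (eta_series_inv n u) (2 * n - N - k) else 0))"
      using eta_series_eq_0[OF assms(2)] by (intro sum.mono_neutral_left) auto
    also have "\<dots> = (\<Sum>k\<le>2 * n - N. fps_nth (eta_series n u) k * fps_nth (eta_series_inv n u) (2 * n - N - k))"
      using N by (intro sum.mono_neutral_cong_right) auto
    finally show ?thesis .
  qed
  also have "\<dots> = (if N = 2 * n then 1 else 0)" using N by (simp only: sum_eta_series_eta_series_inv) auto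
  also have "(\<Sum>k\<le>n. fps_nth (eta_series n u) k * (if N + k = 3 * n then of_nat (n - 1) / u n else 0))
     = (if N = 2 * n then - 1 else 0)"
  proof (cases "N = 2 * n")
    case True
    have "(\<Sum>k\<le>n. fps_nth (eta_series n u) k * (if N + k = 3 * n then of_nat (n - 1) / u n else 0))
      = (\<Sum>k\<le>n. if k = n then fps_nth (eta_series n u) n * (of_nat (n - 1) / u n) else 0)"
      using True by (intro sum.cong) auto
    also have "\<dots> = fps_nth (eta_series n u) n * (of_nat (n - 1) / u n)" by simp
    also have "\<dots> = - 1" using assms by (simp add: eta_series_n orbit_domain_def of_nat_diff field_simps)
    finally show ?thesis using True by simp
  next
    case False
    thus ?thesis using N by (auto intro!: sum.neutral)
  qed
  finally show ?thesis by simp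
qed

text \<open>The contraction eta^{ab} c_{..a} c_{..b}: the other index pairs enter through their sums
  N and M. Associativity means that, in the range at hand, it depends on N + M alone.\<close>

definition rho_pairing :: "nat \<Rightarrow> pt \<Rightarrow> nat \<Rightarrow> nat \<Rightarrow> complex" where
  "rho_pairing n u N M = (\<Sum>a\<in>{1..n}. rho n u (N + a) * (\<Sum>b\<in>{1..n}. eta_metric n u a b * rho n u (M + b)))"

text \<open>For fixed h the two arguments of \<open>rho\<close> have the constant sum N + M + n + 1
  + h, which makes a shift between N and M telescope.\<close>

lemma rho_pairing_eq:
  "rho_pairing n u N M = (\<Sum>h\<le>n. fps_nth (eta_series n u) h * (\<Sum>a\<in>{Suc h..n}. rho n u (N + a) * rho n u (M + (n + 1 + h) - a)))"
proof -
  have "rho_pairing n u N M = (\<Sum>a\<in>{1..n}. \<Sum>h<a. fps_nth (eta_series n u) h * (rho n u (N + a) * rho n u (M + (h + (n + 1 - a)))))"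
    unfolding rho_pairing_def by (intro sum.cong refl) (simp only: sum_eta_metric sum_distrib_left mult.left_commute)
  also have "\<dots> = (\<Sum>a\<in>{1..n}. \<Sum>h\<le>n. if h < a then fps_nth (eta_series n u) h * (rho n u (N + a) * rho n u (M + (n + 1 + h) - a)) else 0)"
  proof (rule sum.cong[OF refl])
    fix a assume a: "a \<in> {1..n}"
    have "(\<Sum>h\<le>n. if h < a then fps_nth (eta_series n u) h * (rho n u (N + a) * rho n u (M + (n + 1 + h) - a)) else 0)
       = (\<Sum>h<a. fps_nth (eta_series n u) h * (rho n u (N + a) * rho n u (M + (n + 1 + h) - a)))"
      using a by (intro sum.mono_neutral_cong_right) auto
    also have "\<dots> = (\<Sum>h<a. fps_nth (eta_series n u) h * (rho n u (N + a) * rho n u (M + (h + (n + 1 - a)))))"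
    proof (intro sum.cong refl)
      fix h
      have "M + (n + 1 + h) - a = M + (h + (n + 1 - a))" using a by auto
      thus "fps_nth (eta_series n u) h * (rho n u (N + a) * rho n u (M + (n + 1 + h) - a))
        = fps_nth (eta_series n u) h * (rho n u (N + a) * rho n u (M + (h + (n + 1 - a))))" by (simp only:)
    qed
    finally show "(\<Sum>h<a. fps_nth (eta_series n u) h * (rho n u (N + a) * rho n u (M + (h + (n + 1 - a)))))
       = (\<Sum>h\<le>n. if h < a then fps_nth (eta_series n u) h * (rho n u (N + a) * rho n u (M + (n + 1 + h) - a)) else 0)" by simp
  qed
  also have "\<dots> = (\<Sum>h\<le>n. \<Sum>a\<in>{1..n}. if h < a then fps_nth (eta_series n u) h * (rho n u (N + a) * rho n u (M + (n + 1 + h) - a)) else 0)"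
    by (rule sum.swap)
  also have "\<dots> = (\<Sum>h\<le>n. \<Sum>a\<in>{Suc h..n}. fps_nth (eta_series n u) h * (rho n u (N + a) * rho n u (M + (n + 1 + h) - a)))"
    by (rule sum.cong[OF refl], rule sum.mono_neutral_cong_right) auto
  finally show ?thesis by (simp only: sum_distrib_left)
qed

text \<open>The telescoping in a leaves boundary terms at a = n + 1 and a = h + 1. Each is a factor
  free of h times a sum against D, which \<open>rho_recurrence\<close> kills.\<close>

lemma rho_pairing_shift:
  assumes "n \<ge> 2" "u \<in> orbit_domain n" "N \<le> 2 * n" "M \<le> 2 * n"
  shows "rho_pairing n u (Suc N) M = rho_pairing n u N (Suc M)"
proof -
  let ?r = "rho n u" and ?D = "fps_nth (eta_series n u)"
  have "rho_pairing n u (Suc N) M - rho_pairing n u N (Suc M)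
     = (\<Sum>h\<le>n. ?D h * ((\<Sum>a\<in>{Suc h..n}. ?r (Suc N + a) * ?r (M + (n + 1 + h) - a))
        - (\<Sum>a\<in>{Suc h..n}. ?r (N + a) * ?r (Suc M + (n + 1 + h) - a))))"
    by (simp only: rho_pairing_eq right_diff_distrib sum_subtractf)
  also have "\<dots> = (\<Sum>h\<le>n. ?D h * (?r (N + n + 1) * ?r (M + 1 + h) - ?r (N + 1 + h) * ?r (M + n + 1)))"
  proof (intro sum.cong refl)
    fix h assume h: "h \<in> {..n}"
    define f where "f a = ?r (N + a) * ?r (M + (n + 2 + h) - a)" for a
    have "(\<Sum>a\<in>{Suc h..n}. ?r (Suc N + a) * ?r (M + (n + 1 + h) - a))
        - (\<Sum>a\<in>{Suc h..n}. ?r (N + a) * ?r (Suc M + (n + 1 + h) - a))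
      = (\<Sum>a\<in>{Suc h..n}. f (Suc a) - f a)"
      unfolding sum_subtractf by (simp add: f_def)
    also have "\<dots> = f (Suc n) - f (Suc h)" by (rule sum_Suc_diff) (use h in auto)
    also have "\<dots> = ?r (N + n + 1) * ?r (M + 1 + h) - ?r (N + 1 + h) * ?r (M + n + 1)"
      by (simp add: f_def)
    finally show "?D h * ((\<Sum>a\<in>{Suc h..n}. ?r (Suc N + a) * ?r (M + (n + 1 + h) - a))
        - (\<Sum>a\<in>{Suc h..n}. ?r (N + a) * ?r (Suc M + (n + 1 + h) - a)))
       = ?D h * (?r (N + n + 1) * ?r (M + 1 + h) - ?r (N + 1 + h) * ?r (M + n + 1))" by (rule arg_cong)
  qed
  also have "\<dots> = ?r (N + n + 1) * (\<Sum>h\<le>n. ?D h * ?r (M + 1 + h)) - (\<Sum>h\<le>n. ?D h * ?r (N + 1 + h)) * ?r (M + n + 1)"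
    unfolding sum_distrib_left sum_distrib_right sum_subtractf[symmetric]
    by (intro sum.cong refl) (simp add: algebra_simps)
  also have "\<dots> = 0"
    using rho_recurrence[OF assms(1,2), of "M + 1"] rho_recurrence[OF assms(1,2), of "N + 1"] assms(3,4) by simp
  finally show ?thesis by simp
qed

lemma rho_pairing_shift_add:
  assumes "n \<ge> 2" "u \<in> orbit_domain n" "N + d \<le> 2 * n + 1" "M + d \<le> 2 * n + 1"
  shows "rho_pairing n u (N + d) M = rho_pairing n u N (M + d)"
  using assms(3,4)
proof (induction d arbitrary: M)
  case (Suc d)
  have "rho_pairing n u (N + Suc d) M = rho_pairing n u (N + d) (Suc M)"
    using rho_pairing_shift[OF assms(1,2), of "N + d" M] Suc.prems by simp
  also have "\<dots> = rho_pairing n u N (Suc M + d)" by (rule Suc.IH) (use Suc.prems in auto)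
  finally show ?case by simp
qed simp

lemma sum_product_coeff_product_coeff:
  "(\<Sum>m\<in>{1..n}. product_coeff n u i j m * product_coeff n u m k l) = (\<Sum>b\<in>{1..n}. eta_metric n u l b * rho_pairing n u (k + b) (i + j))"
proof -
  have "(\<Sum>m\<in>{1..n}. product_coeff n u i j m * product_coeff n u m k l)
     = (\<Sum>m\<in>{1..n}. \<Sum>b\<in>{1..n}. eta_metric n u l b * (rho n u (k + b + m) * product_coeff n u i j m))"
    by (simp add: product_coeff_def[of n u _ k l] sum_distrib_left mult_ac add_ac)
  also have "\<dots> = (\<Sum>b\<in>{1..n}. eta_metric n u l b * rho_pairing n u (k + b) (i + j))"
    unfolding rho_pairing_def sum_distrib_left[of _ _ "{1..n}"] product_coeff_def
    by (subst sum.swap) (simp add: sum_distrib_left)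
  finally show ?thesis .
qed

lemma product_coeff_commute: "product_coeff n u i j k = product_coeff n u j i k"
  by (simp add: product_coeff_def add.commute)

lemma product_coeff_assoc:
  assumes "n \<ge> 2" "u \<in> orbit_domain n" "i \<in> {1..n}" "j \<in> {1..n}" "k \<in> {1..n}"
  shows "(\<Sum>m\<in>{1..n}. product_coeff n u i j m * product_coeff n u m k l) = (\<Sum>m\<in>{1..n}. product_coeff n u j k m * product_coeff n u i m l)"
proof -
  \<comment> \<open>The amount i - k is moved from one argument to the other; the case i \<le> k is
    the same with the roles exchanged.\<close>
  have *: "rho_pairing n u (k + b) (i + j) = rho_pairing n u (i + b) (j + k)" if "b \<in> {1..n}" "k \<le> i" "i \<in> {1..n}" for b i k
  proof -
    have "rho_pairing n u (k + b) (i + j) = rho_pairing n u (k + b) (j + k + (i - k))" using that by (simp add: add_ac)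
    also have "\<dots> = rho_pairing n u (k + b + (i - k)) (j + k)"
      by (rule rho_pairing_shift_add[OF assms(1,2), symmetric]) (use that assms in auto)
    finally show ?thesis using that by (simp add: add_ac)
  qed
  have "rho_pairing n u (k + b) (i + j) = rho_pairing n u (i + b) (j + k)" if "b \<in> {1..n}" for b
    using *[OF that, of k i] *[OF that, of i k] assms by (cases "k \<le> i") (auto simp: add.commute)
  thus ?thesis
    unfolding product_coeff_commute[of n u i _ l] sum_product_coeff_product_coeff by (intro sum.cong refl) (simp add: add.commute)
qed

lemma sum_product_coeff_eta_lower:
  assumes "n \<ge> 2" "k \<in> {1..n}"
  shows "(\<Sum>a\<in>{1..n}. product_coeff n u i j a * eta_lower n u a k) = rho n u (i + j + k)"
proof -
  have "(\<Sum>a\<in>{1..n}. product_coeff n u i j a * eta_lower n u a k)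
     = (\<Sum>b\<in>{1..n}. (\<Sum>a\<in>{1..n}. eta_metric n u b a * eta_lower n u a k) * rho n u (i + j + b))"
    unfolding product_coeff_def sum_distrib_right
    by (subst sum.swap) (intro sum.cong refl, simp add: eta_metric_sym[of n u] mult_ac)
  also have "\<dots> = rho n u (i + j + k)"
  proof (rule sum_unit_vector(1)[OF _ assms(2)])
    show "(\<Sum>a\<in>{1..n}. eta_metric n u b a * eta_lower n u a k) = (if k = b then 1 else 0)" if "b \<in> {1..n}" for b
      unfolding eta_metric_eta_lower[OF assms(1) that assms(2)] by auto
  qed simp
  finally show ?thesis .
qed

text \<open>At i = n - 1 the lowered product is \<open>eta_lower\<close>, and raising an index gives
  the identity.\<close>

lemma product_coeff_unit:
  assumes "n \<ge> 2" "j \<in> {1..n}" "k \<in> {1..n}"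
  shows "product_coeff n u (n - 1) j k = (if j = k then 1 else 0)"
proof -
  have "product_coeff n u (n - 1) j k = (\<Sum>a\<in>{1..n}. eta_metric n u k a * eta_lower n u a j)"
    unfolding product_coeff_def eta_lower_def by (simp add: add_ac)
  thus ?thesis using eta_metric_eta_lower[OF assms(1,3,2)] by auto
qed


section \<open>Derivatives along the coordinates and quasi-homogeneity\<close>

definition eta_series_inv_deriv :: "nat \<Rightarrow> pt \<Rightarrow> nat \<Rightarrow> nat \<Rightarrow> complex" where
  "eta_series_inv_deriv n u l m = - ((of_nat (n - 1) - of_nat l) / of_nat (n - 1)) *
     (if l \<le> m then fps_nth (eta_series_inv n u * eta_series_inv n u) (m - l) else 0)"

text \<open>This is dR = - R^2 dD with dD = c x^l. The increment is exactly R_t - R = - (t - x_l) c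
  x^l R_t R, so coefficient m of R_t involves only coefficients up to m - l; as l \<ge> 1, induction
  on m applies.\<close>

lemma eta_series_inv_has_derivative:
  assumes l: "l \<in> {1..n}"
  shows "((\<lambda>t. fps_nth (eta_series_inv n (x(l := t))) m) has_field_derivative eta_series_inv_deriv n x l m) (at (x l))"
proof (induction m rule: less_induct)
  case (less m)
  define c where "c = ((of_nat (n - 1) - of_nat l) / of_nat (n - 1) :: complex)"
  define R where "R = eta_series_inv n x"
  define Rt where "Rt t = eta_series_inv n (x(l := t))" for t
  have Rt0: "Rt (x l) = R" by (simp add: Rt_def R_def)
  have Rt_eq: "Rt t = R - fps_const ((t - x l) * c) * (fps_X ^ l * (Rt t * R))" for t
  proof -
    have 1: "Rt t * (eta_series n x * R) = Rt t" by (simp add: R_def eta_series_eta_series_inv)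
    have 2: "(eta_series n (x(l := t)) * Rt t) * R = R" by (simp add: Rt_def eta_series_eta_series_inv)
    have "Rt t - R = Rt t * (eta_series n x * R) - (eta_series n (x(l := t)) * Rt t) * R"
      by (simp only: 1 2)
    also have "\<dots> = Rt t * (eta_series n x - eta_series n (x(l := t))) * R"
      by (simp add: algebra_simps)
    also have "\<dots> = - (fps_const ((t - x l) * c) * (fps_X ^ l * (Rt t * R)))"
      unfolding eta_series_fun_upd[OF l] c_def by (simp add: algebra_simps)
    finally show ?thesis by (simp add: algebra_simps)
  qed
  have eq: "fps_nth (Rt t) m = fps_nth R m - (t - x l) * (c * (if m < l then 0 else fps_nth (Rt t * R) (m - l)))" for t
  proof -
    have "fps_nth (Rt t) m = fps_nth (R - fps_const ((t - x l) * c) * (fps_X ^ l * (Rt t * R))) m"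
      by (rule arg_cong[OF Rt_eq])
    also have "\<dots> = fps_nth R m - (t - x l) * (c * (if m < l then 0 else fps_nth (Rt t * R) (m - l)))"
      by (simp only: fps_sub_nth fps_mult_left_const_nth fps_X_power_mult_nth mult.assoc)
    finally show ?thesis .
  qed
  \<comment> \<open>The derivative of (t - x l) g(t) at t = x l is g(x l), so differentiability of
    \<open>g\<close> there suffices.\<close>
  define g where "g t = c * (if m < l then 0 else fps_nth (Rt t * R) (m - l))" for t
  have "g field_differentiable (at (x l))"
  proof (cases "m < l")
    case False
    have "(\<lambda>t. fps_nth (Rt t) i) field_differentiable (at (x l))" if "i \<le> m - l" for i
    proof -
      have "i < m" using that False l by auto
      from less.IH[OF this] show ?thesis unfolding Rt_def field_differentiable_def by blast
    qed
    hence "(\<lambda>t. c * (\<Sum>i = 0..m - l. fps_nth (Rt t) i * fps_nth R (m - l - i))) field_differentiable (at (x l))"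
      by (intro field_differentiable_mult field_differentiable_sum) auto
    thus ?thesis using False by (simp add: g_def[abs_def] fps_mult_nth)
  qed (simp add: g_def[abs_def])
  then obtain g' where "(g has_field_derivative g') (at (x l))" by (auto simp: field_differentiable_def)
  hence "((\<lambda>t. fps_nth R m - (t - x l) * g t) has_field_derivative - g (x l)) (at (x l))"
    by (auto intro!: derivative_eq_intros)
  moreover have "- g (x l) = eta_series_inv_deriv n x l m"
    by (auto simp: g_def eta_series_inv_deriv_def Rt0 c_def R_def)
  ultimately show ?case
    unfolding Rt_def[symmetric] eq g_def[symmetric] by simp
qed

definition rho_deriv :: "nat \<Rightarrow> pt \<Rightarrow> nat \<Rightarrow> nat \<Rightarrow> complex" where
  "rho_deriv n u a N = (if N \<le> 2 * n then eta_series_inv_deriv n u a (2 * n - N) else 0)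
     + (if N = 3 * n \<and> a = n then - of_nat (n - 1) / (u n)^2 else 0)"

lemma rho_has_derivative:
  assumes "x \<in> orbit_domain n" "a \<in> {1..n}"
  shows "((\<lambda>t. rho n (x(a := t)) N) has_field_derivative rho_deriv n x a N) (at (x a))"
proof -
  have "((\<lambda>t. if N \<le> 2 * n then fps_nth (eta_series_inv n (x(a := t))) (2 * n - N) else 0) has_field_derivative
     (if N \<le> 2 * n then eta_series_inv_deriv n x a (2 * n - N) else 0)) (at (x a))"
    using eta_series_inv_has_derivative[OF assms(2)] by auto
  moreover have "((\<lambda>t. if N = 3 * n then of_nat (n - 1) / (x(a := t)) n else 0) has_field_derivative
     (if N = 3 * n \<and> a = n then - of_nat (n - 1) / (x n)^2 else 0)) (at (x a))"
  proof (cases "N = 3 * n \<and> a = n")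
    case True
    have "((\<lambda>t. of_nat (n - 1) / t) has_field_derivative - of_nat (n - 1) / (x n)^2) (at (x n))"
      using assms(1) by (auto intro!: derivative_eq_intros simp: orbit_domain_def power2_eq_square)
    thus ?thesis using True by simp
  next
    case False
    hence "(if N = 3 * n then of_nat (n - 1) / (x(a := t)) n else 0) = (if N = 3 * n then of_nat (n - 1) / x n else (0 :: complex))" for t
      by auto
    thus ?thesis using False by (simp only: if_False DERIV_const)
  qed
  ultimately show ?thesis unfolding rho_def rho_deriv_def by (rule DERIV_add)
qed

text \<open>Each D_k with k \<ge> 1 is linear in u_k, so the Euler field acts on D as x d/dx divided
  by n - 1; the inverse series inherits this grading.\<close>

lemma Euler_eta_series_inv:
  assumes "n \<ge> 2" "u \<in> orbit_domain n"
  shows "(\<Sum>a\<in>{1..n}. euler_field n u a * eta_series_inv_deriv n u a m) = of_nat m / of_nat (n - 1) * fps_nth (eta_series_inv n u) m"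
proof -
  let ?D = "eta_series n u" and ?R = "eta_series_inv n u"
  have "fps_deriv (?D * ?R) = 0" by (simp add: eta_series_eta_series_inv)
  hence 0: "?D * fps_deriv ?R = - (fps_deriv ?D * ?R)" by (simp add: eq_neg_iff_add_eq_0)
  have "fps_deriv ?R = (?D * ?R) * fps_deriv ?R" by (simp add: eta_series_eta_series_inv)
  also have "\<dots> = ?R * (?D * fps_deriv ?R)" by (simp add: mult_ac)
  also have "\<dots> = - (fps_deriv ?D * (?R * ?R))" unfolding 0 by (simp add: mult_ac)
  finally have "fps_XD ?R = - (fps_XD ?D * (?R * ?R))" by (simp add: fps_XD_def mult_ac)
  from arg_cong[OF this, of "\<lambda>f. fps_nth f m"]
  have "of_nat m * fps_nth ?R m = - (\<Sum>a = 0..m. of_nat a * fps_nth ?D a * fps_nth (?R * ?R) (m - a))"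
    by (simp add: fps_mult_nth[of "fps_XD ?D"])
  also have "(\<Sum>a = 0..m. of_nat a * fps_nth ?D a * fps_nth (?R * ?R) (m - a))
     = (\<Sum>a\<in>{1..n}. of_nat a * fps_nth ?D a * (if a \<le> m then fps_nth (?R * ?R) (m - a) else 0))"
  proof -
    have "(\<Sum>a = 0..m. of_nat a * fps_nth ?D a * fps_nth (?R * ?R) (m - a))
       = (\<Sum>a\<in>{1..n} \<inter> {..m}. of_nat a * fps_nth ?D a * fps_nth (?R * ?R) (m - a))"
      using eta_series_eq_0[OF assms(2)] by (intro sum.mono_neutral_right) (auto simp: not_le)
    also have "\<dots> = (\<Sum>a\<in>{1..n}. of_nat a * fps_nth ?D a * (if a \<le> m then fps_nth (?R * ?R) (m - a) else 0))"
      by (intro sum.mono_neutral_cong_left) auto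
    finally show ?thesis .
  qed
  finally have "of_nat m / of_nat (n - 1) * fps_nth ?R m = - (\<Sum>a\<in>{1..n}. of_nat a * fps_nth ?D a * (if a \<le> m then fps_nth (?R * ?R) (m - a) else 0)) / of_nat (n - 1)"
    by simp
  also have "\<dots> = (\<Sum>a\<in>{1..n}. euler_field n u a * eta_series_inv_deriv n u a m)"
    unfolding sum_negf[symmetric] sum_divide_distrib
    by (intro sum.cong refl) (auto simp: euler_field_def eta_series_inv_deriv_def eta_series_def)
  finally show ?thesis by simp
qed

text \<open>The exceptional term fits the same weight: at N = 3n it is - n/(n - 1), the weight of 1
  / u_n.\<close>

lemma Euler_rho:
  assumes "n \<ge> 2" "u \<in> orbit_domain n"
  shows "(\<Sum>a\<in>{1..n}. euler_field n u a * rho_deriv n u a N) = (2 * of_nat n - of_nat N) / of_nat (n - 1) * rho n u N"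
proof -
  have "(\<Sum>a\<in>{1..n}. euler_field n u a * rho_deriv n u a N) = (if N \<le> 2 * n then \<Sum>a\<in>{1..n}. euler_field n u a * eta_series_inv_deriv n u a (2 * n - N) else 0)
      + (\<Sum>a\<in>{1..n}. if a = n then euler_field n u n * (if N = 3 * n then - of_nat (n - 1) / (u n)^2 else 0) else 0)"
  proof -
    have "(\<Sum>a\<in>{1..n}. euler_field n u a * (if N = 3 * n \<and> a = n then - of_nat (n - 1) / (u n)^2 else 0))
      = (\<Sum>a\<in>{1..n}. if a = n then euler_field n u n * (if N = 3 * n then - of_nat (n - 1) / (u n)^2 else 0) else 0)"
      by (rule sum.cong) auto
    thus ?thesis unfolding rho_deriv_def distrib_left sum.distrib by simp
  qed
  also have "(\<Sum>a\<in>{1..n}. if a = n then euler_field n u n * (if N = 3 * n then - of_nat (n - 1) / (u n)^2 else 0) else 0)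
     = (if N = 3 * n then - of_nat n / u n else 0)"
    using assms by (auto simp: euler_field_def orbit_domain_def power2_eq_square field_simps)
  finally have sum_eq: "(\<Sum>a\<in>{1..n}. euler_field n u a * rho_deriv n u a N) =
    (if N \<le> 2 * n then of_nat (2 * n - N) / of_nat (n - 1) * fps_nth (eta_series_inv n u) (2 * n - N) else 0)
      + (if N = 3 * n then - of_nat n / u n else 0)"
    unfolding Euler_eta_series_inv[OF assms] .
  show ?thesis
  proof -
    have "of_nat (n - 1) \<noteq> (0 :: complex)" using assms(1) by simp
    hence e1: "(2 * of_nat n - of_nat (3 * n)) / of_nat (n - 1) * (of_nat (n - 1) / u n) = - of_nat n / u n" by simp
    have e2: "of_nat (2 * n - N) = (2 * of_nat n - of_nat N :: complex)" if "N \<le> 2 * n" using that by (simp add: of_nat_diff)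
    consider "N \<le> 2 * n" "N \<noteq> 3 * n" | "N = 3 * n" "\<not> N \<le> 2 * n" | "\<not> N \<le> 2 * n" "N \<noteq> 3 * n"
      using assms(1) by linarith
    thus ?thesis
    proof cases
      case 1
      thus ?thesis unfolding sum_eq rho_def by (simp add: e2)
    next
      case 2
      have "(\<Sum>a\<in>{1..n}. euler_field n u a * rho_deriv n u a N) = - of_nat n / u n" "rho n u N = of_nat (n - 1) / u n"
        unfolding sum_eq rho_def using 2 assms(1) by simp_all
      thus ?thesis using e1 2(1) by (simp only:)
    next
      case 3
      thus ?thesis unfolding sum_eq rho_def by simp
    qed
  qed
qed

lemma Euler_eta_metric:
  assumes "n \<ge> 2" "i \<in> {1..n}" "j \<in> {1..n}"
  shows "(\<Sum>a\<in>{1..n}. euler_field n u a * (eta_contra n i j a + eta_contra n j i a))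
     = (of_nat i + of_nat j - of_nat n - 1) / of_nat (n - 1) * eta_metric n u i j"
proof (cases "n + 1 < i + j")
  case True
  define s where "s = i + j - (n + 1)"
  have s: "s \<in> {1..n}" "\<And>a. a + (n + 1) = i + j \<longleftrightarrow> a = s" "of_nat s = (of_nat i + of_nat j - of_nat n - 1 :: complex)"
    using True assms by (auto simp: s_def of_nat_diff)
  have "(\<Sum>a\<in>{1..n}. euler_field n u a * (eta_contra n i j a + eta_contra n j i a))
     = (\<Sum>a\<in>{1..n}. if a = s then euler_field n u s * ((of_nat (n - 1) - of_nat s) / of_nat (n - 1)) else 0)"
    by (intro sum.cong refl) (simp only: eta_contra_add[OF assms] s(2), simp)
  also have "\<dots> = euler_field n u s * ((of_nat (n - 1) - of_nat s) / of_nat (n - 1))" using s(1) by simp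
  also have "\<dots> = of_nat s / of_nat (n - 1) * eta_metric n u i j"
  proof -
    have "eta_metric n u i j = fps_nth (eta_series n u) s" using True unfolding eta_metric_def s_def by simp
    thus ?thesis using s(1) by (simp add: euler_field_def eta_series_def)
  qed
  finally show ?thesis by (simp only: s(3))
next
  case False
  have "(\<Sum>a\<in>{1..n}. euler_field n u a * (eta_contra n i j a + eta_contra n j i a)) = 0"
  proof (rule sum.neutral, rule ballI)
    fix a assume "a \<in> {1..n}"
    thus "euler_field n u a * (eta_contra n i j a + eta_contra n j i a) = 0"
      using False by (subst eta_contra_add[OF assms]) auto
  qed
  \<comment> \<open>On the antidiagonal i + j = n + 1 the entry is the constant 1 and the weight is
    0; for smaller i + j the entry is 0.\<close>
  moreover have "of_nat i + of_nat j - of_nat n - 1 = (0 :: complex) \<or> eta_metric n u i j = 0"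
  proof (cases "i + j = n + 1")
    case True
    hence "of_nat i + of_nat j = (of_nat n + 1 :: complex)" by (metis of_nat_1 of_nat_add)
    thus ?thesis by simp
  qed (use False in \<open>auto simp: eta_metric_def\<close>)
  ultimately show ?thesis by auto
qed

section \<open>Christoffel symbols of eta and symmetry of nabla c\<close>

definition eta_christ :: "nat \<Rightarrow> pt \<Rightarrow> nat \<Rightarrow> nat \<Rightarrow> nat \<Rightarrow> complex" where
  "eta_christ n u a i j = - (of_nat (n - a) / of_nat (n - 1)) * (if i + j \<le> a then fps_nth (eta_series_inv n u) (a - (i + j)) else 0)"

lemma eta_christ_eq:
  assumes "n \<ge> 2" "k \<in> {1..n}" "i \<in> {1..n}" "j \<in> {1..n}"
  shows "- (\<Sum>a\<in>{1..n}. eta_lower n u i a * eta_contra n a k j) = eta_christ n u k i j"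
proof (cases "j < k")
  case True
  define s where "s = j + (n + 1) - k"
  have s: "s \<in> {1..n}" "\<And>a. j + (n + 1) = a + k \<longleftrightarrow> a = s" using True assms by (auto simp: s_def)
  have "eta_lower n u i a * eta_contra n a k j = (if a = s then eta_lower n u i s * (of_nat (n - k) / of_nat (n - 1)) else 0)" for a
    unfolding eta_contra_def s(2) by simp
  hence "(\<Sum>a\<in>{1..n}. eta_lower n u i a * eta_contra n a k j) = eta_lower n u i s * (of_nat (n - k) / of_nat (n - 1))"
    using s(1) by simp
  moreover have "i + s \<le> n + 1 \<longleftrightarrow> i + j \<le> k" "n + 1 - (i + s) = k - (i + j)"
    using True assms by (auto simp: s_def)
  ultimately show ?thesis
    by (simp add: eta_lower_eq[OF assms(1,3) s(1)] eta_christ_def)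
next
  case False
  hence "(\<Sum>a\<in>{1..n}. eta_lower n u i a * eta_contra n a k j) = 0"
    by (intro sum.neutral) (auto simp: eta_contra_def)
  thus ?thesis using False assms by (simp add: eta_christ_def)
qed


text \<open>The contraction of a Christoffel symbol of eta with \<open>rho\<close>, after
  substituting a = p + b. Subtraction on the naturals drops the terms with p + b > n, so b can run
  over the whole convolution.\<close>

definition truncated_conv :: "nat \<Rightarrow> pt \<Rightarrow> nat \<Rightarrow> nat \<Rightarrow> complex" where
  "truncated_conv n u p S = (\<Sum>b\<le>S. of_nat (n - (p + b)) * (fps_nth (eta_series_inv n u) b * fps_nth (eta_series_inv n u) (S - b)))"

lemma sum_eta_christ_rho:
  assumes "n \<ge> 2" "l \<in> {1..n}" "j \<in> {1..n}" "i \<in> {1..n}" "k \<in> {1..n}"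
  shows "(\<Sum>a\<in>{1..n}. eta_christ n u a l j * rho n u (i + k + a))
     = (if l + j + i + k \<le> 2 * n then - truncated_conv n u (l + j) (2 * n - (l + j + i + k)) / of_nat (n - 1) else 0)"
proof -
  let ?R = "fps_nth (eta_series_inv n u)"
  \<comment> \<open>The exceptional value of \<open>rho\<close> needs i = k = a = n, where the
    factor n - a of \<open>eta_christ\<close> is 0.\<close>
  have "eta_christ n u a l j * rho n u (i + k + a) = (if l + j \<le> a \<and> i + k + a \<le> 2 * n then
      - (of_nat (n - a) * (?R (a - (l + j)) * ?R (2 * n - (i + k + a)))) else 0) / of_nat (n - 1)"
    if "a \<in> {1..n}" for a
    using that assms by (auto simp: eta_christ_def rho_def mult.assoc)
  hence "(\<Sum>a\<in>{1..n}. eta_christ n u a l j * rho n u (i + k + a)) = (\<Sum>a\<in>{1..n}. if l + j \<le> a \<and> i + k + a \<le> 2 * n then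
      - (of_nat (n - a) * (?R (a - (l + j)) * ?R (2 * n - (i + k + a)))) else 0) / of_nat (n - 1)"
    unfolding sum_divide_distrib by (intro sum.cong refl) auto
  also have "(\<Sum>a\<in>{1..n}. if l + j \<le> a \<and> i + k + a \<le> 2 * n then
      - (of_nat (n - a) * (?R (a - (l + j)) * ?R (2 * n - (i + k + a)))) else 0)
    = (\<Sum>a\<in>{a \<in> {1..n}. l + j \<le> a \<and> i + k + a \<le> 2 * n}. - (of_nat (n - a) * (?R (a - (l + j)) * ?R (2 * n - (i + k + a)))))"
    by (rule sum.inter_filter[symmetric]) simp
  also have "\<dots> = - (\<Sum>a\<in>{a \<in> {1..n}. l + j \<le> a \<and> i + k + a \<le> 2 * n}. of_nat (n - a) * (?R (a - (l + j)) * ?R (2 * n - (i + k + a))))"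
    by (rule sum_negf)
  also have "(\<Sum>a\<in>{a \<in> {1..n}. l + j \<le> a \<and> i + k + a \<le> 2 * n}. of_nat (n - a) * (?R (a - (l + j)) * ?R (2 * n - (i + k + a)))) = (if l + j + i + k \<le> 2 * n then truncated_conv n u (l + j) (2 * n - (l + j + i + k)) else 0)"
  proof (cases "l + j + i + k \<le> 2 * n")
    case True
    define S where "S = 2 * n - (l + j + i + k)"
    have "(\<Sum>a\<in>{a \<in> {1..n}. l + j \<le> a \<and> i + k + a \<le> 2 * n}. of_nat (n - a) * (?R (a - (l + j)) * ?R (2 * n - (i + k + a))))
      = (\<Sum>b\<in>{b \<in> {..S}. l + j + b \<le> n}. of_nat (n - (l + j + b)) * (?R b * ?R (S - b)))"
    proof (rule sum.reindex_bij_witness[of _ "\<lambda>b. l + j + b" "\<lambda>a. a - (l + j)"], goal_cases)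
      case (5 a)
      have "2 * n - (i + k + a) = S - (a - (l + j))" "l + j + (a - (l + j)) = a" using 5 by (auto simp: S_def)
      thus ?case by (simp only:)
    qed (use assms True in \<open>auto simp: S_def\<close>)
    also have "\<dots> = truncated_conv n u (l + j) S"
      unfolding truncated_conv_def by (rule sum.mono_neutral_left) auto
    finally show ?thesis using True by (simp add: S_def)
  next
    case False
    hence "{a \<in> {1..n}. l + j \<le> a \<and> i + k + a \<le> 2 * n} = {}" by auto
    thus ?thesis using False by (simp only: sum.empty if_False)
  qed
  finally show ?thesis by simp
qed

text \<open>The product R_b R_(S-b) is invariant under b \<mapsto> S - b, so b averages to
  S/2.\<close>

lemma sum_index_convolution:
  fixes R :: "complex fps"
  shows "(\<Sum>b\<le>S. of_nat b * (fps_nth R b * fps_nth R (S - b))) * 2 = of_nat S * fps_nth (R * R) S"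
proof -
  have "(\<Sum>b\<le>S. of_nat b * (fps_nth R b * fps_nth R (S - b))) = (\<Sum>b\<le>S. of_nat (S - b) * (fps_nth R b * fps_nth R (S - b)))"
    by (rule sum.reindex_bij_witness[of _ "\<lambda>b. S - b" "\<lambda>b. S - b"]) auto
  hence "(\<Sum>b\<le>S. of_nat b * (fps_nth R b * fps_nth R (S - b))) * 2
     = (\<Sum>b\<le>S. of_nat b * (fps_nth R b * fps_nth R (S - b)) + of_nat (S - b) * (fps_nth R b * fps_nth R (S - b)))"
    by (simp add: sum.distrib)
  also have "\<dots> = (\<Sum>b\<le>S. of_nat S * (fps_nth R b * fps_nth R (S - b)))"
    by (intro sum.cong refl) (auto simp: of_nat_diff algebra_simps)
  finally show ?thesis by (simp add: fps_mult_nth sum_distrib_left atLeast0AtMost)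
qed

text \<open>Natural-number subtraction in \<open>truncated_conv\<close> is \<open>max 0\<close>. As \<open>max 0 y = y + max 0 (- y)\<close>,
  the reflection \<open>b \<mapsto> S - b\<close> exchanges the parts cut off from two such sums.\<close>

lemma truncated_conv_reflect:
  assumes "p + q + S = 2 * n"
  shows "truncated_conv n u p S - truncated_conv n u q S = (\<Sum>b\<le>S. (of_nat n - of_nat p - of_nat b) * (fps_nth (eta_series_inv n u) b * fps_nth (eta_series_inv n u) (S - b)))"
proof -
  let ?R = "fps_nth (eta_series_inv n u)"
  have "truncated_conv n u q S = (\<Sum>b\<le>S. of_nat (n - (q + (S - b))) * (?R b * ?R (S - b)))"
    unfolding truncated_conv_def by (rule sum.reindex_bij_witness[of _ "\<lambda>b. S - b" "\<lambda>b. S - b"]) auto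
  hence "truncated_conv n u p S - truncated_conv n u q S = (\<Sum>b\<le>S. (of_nat (n - (p + b)) - of_nat (n - (q + (S - b)))) * (?R b * ?R (S - b)))"
    by (simp add: truncated_conv_def sum_subtractf left_diff_distrib)
  also have "\<dots> = (\<Sum>b\<le>S. (of_nat n - of_nat p - of_nat b) * (?R b * ?R (S - b)))"
  proof (intro sum.cong refl)
    fix b assume b: "b \<in> {..S}"
    have "int (n - (p + b)) - int (n - (q + (S - b))) = int n - int p - int b"
      using b assms by auto
    hence "of_int (int (n - (p + b)) - int (n - (q + (S - b)))) = (of_int (int n - int p - int b) :: complex)" by simp
    hence "of_nat (n - (p + b)) - of_nat (n - (q + (S - b))) = (of_nat n - of_nat p - of_nat b :: complex)" by simp
    thus "(of_nat (n - (p + b)) - of_nat (n - (q + (S - b)))) * (?R b * ?R (S - b)) = (of_nat n - of_nat p - of_nat b) * (?R b * ?R (S - b))"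
      by (simp only:)
  qed
  finally show ?thesis .
qed

text \<open>The pairs (l + j, i + k) and (l + k, i + j) are complementary as in
  \<open>truncated_conv_reflect\<close>. Their differences carry untruncated linear weights in b,
  and averaging b leaves the factor i - l.\<close>

lemma truncated_conv_exchange:
  assumes "l + i + j + k + S = 2 * n"
  shows "truncated_conv n u (l + j) S + truncated_conv n u (l + k) S - truncated_conv n u (i + j) S - truncated_conv n u (i + k) S
     = (of_nat i - of_nat l) * fps_nth (eta_series_inv n u * eta_series_inv n u) S"
proof -
  let ?R = "fps_nth (eta_series_inv n u)"
  have conv: "fps_nth (eta_series_inv n u * eta_series_inv n u) S = (\<Sum>b\<le>S. ?R b * ?R (S - b))"
    by (simp add: fps_mult_nth atLeast0AtMost)
  have lin: "(\<Sum>b\<le>S. (of_nat n - of_nat p - of_nat b) * (?R b * ?R (S - b)))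
     = (of_nat n - of_nat p) * fps_nth (eta_series_inv n u * eta_series_inv n u) S - (\<Sum>b\<le>S. of_nat b * (?R b * ?R (S - b)))" for p
    unfolding conv by (simp add: left_diff_distrib sum_subtractf sum_distrib_left)
  have nS: "2 * of_nat n = (of_nat l + of_nat i + of_nat j + of_nat k + of_nat S :: complex)"
    using arg_cong[OF assms, of "of_nat :: nat \<Rightarrow> complex"] by simp
  have "truncated_conv n u (l + j) S + truncated_conv n u (l + k) S - truncated_conv n u (i + j) S - truncated_conv n u (i + k) S
     = (truncated_conv n u (l + j) S - truncated_conv n u (i + k) S) + (truncated_conv n u (l + k) S - truncated_conv n u (i + j) S)" by simp
  also have "\<dots> = (2 * of_nat n - 2 * of_nat l - of_nat j - of_nat k) * fps_nth (eta_series_inv n u * eta_series_inv n u) S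
     - (\<Sum>b\<le>S. of_nat b * (?R b * ?R (S - b))) * 2"
  proof -
    have "truncated_conv n u (l + j) S - truncated_conv n u (i + k) S = (of_nat n - of_nat (l + j)) * fps_nth (eta_series_inv n u * eta_series_inv n u) S - (\<Sum>b\<le>S. of_nat b * (?R b * ?R (S - b)))"
      using truncated_conv_reflect[of "l + j" "i + k" S n u] assms unfolding lin by simp
    moreover have "truncated_conv n u (l + k) S - truncated_conv n u (i + j) S = (of_nat n - of_nat (l + k)) * fps_nth (eta_series_inv n u * eta_series_inv n u) S - (\<Sum>b\<le>S. of_nat b * (?R b * ?R (S - b)))"
      using truncated_conv_reflect[of "l + k" "i + j" S n u] assms unfolding lin by simp
    ultimately show ?thesis by (simp only: of_nat_add) (simp add: algebra_simps)
  qed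
  also have "\<dots> = (of_nat i - of_nat l) * fps_nth (eta_series_inv n u * eta_series_inv n u) S"
    unfolding sum_index_convolution nS by (simp add: algebra_simps)
  finally show ?thesis .
qed

text \<open>Symmetry of nabla c without the Christoffel term in the pair (l, i), which is symmetric
  on its own. The difference of the derivatives of \<open>rho\<close> is what
  \<open>truncated_conv_exchange\<close> supplies.\<close>

lemma nabla_rho_symmetric:
  assumes "n \<ge> 2" "l \<in> {1..n}" "i \<in> {1..n}" "j \<in> {1..n}" "k \<in> {1..n}"
  shows "rho_deriv n u l (i + j + k) - (\<Sum>a\<in>{1..n}. eta_christ n u a l j * rho n u (i + k + a))
       - (\<Sum>a\<in>{1..n}. eta_christ n u a l k * rho n u (i + j + a))
     = rho_deriv n u i (l + j + k) - (\<Sum>a\<in>{1..n}. eta_christ n u a i j * rho n u (l + k + a))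
       - (\<Sum>a\<in>{1..n}. eta_christ n u a i k * rho n u (l + j + a))"
proof -
  \<comment> \<open>The exceptional term of \<open>rho_deriv\<close> occurs exactly when all four
    indices equal n, hence equally on both sides.\<close>
  have exc: "i + j + k = 3 * n \<and> l = n \<longleftrightarrow> l + j + k = 3 * n \<and> i = n" using assms by auto
  show ?thesis
  proof (cases "l + i + j + k \<le> 2 * n")
    case True
    define S where "S = 2 * n - (l + i + j + k)"
    have S: "l + i + j + k + S = 2 * n" using True by (simp add: S_def)
    have dd: "2 * n - (i + j + k) - l = S" "2 * n - (l + j + k) - i = S" "l \<le> 2 * n - (i + j + k)" "i \<le> 2 * n - (l + j + k)"
      "i + j + k \<le> 2 * n" "l + j + k \<le> 2 * n" using S by auto
    have ss: "2 * n - (l + j + i + k) = S" "2 * n - (l + k + i + j) = S" "2 * n - (i + j + l + k) = S" "2 * n - (i + k + l + j) = S"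
      "l + j + i + k \<le> 2 * n" "l + k + i + j \<le> 2 * n" "i + j + l + k \<le> 2 * n" "i + k + l + j \<le> 2 * n" using S by auto
    have n0: "of_nat (n - 1) \<noteq> (0 :: complex)" using assms(1) by simp
    define Q where "Q = fps_nth (eta_series_inv n u * eta_series_inv n u) S"
    have "- ((of_nat (n - 1) - of_nat l) / of_nat (n - 1)) * Q + (truncated_conv n u (l + j) S + truncated_conv n u (l + k) S) / of_nat (n - 1)
       = - ((of_nat (n - 1) - of_nat i) / of_nat (n - 1)) * Q + (truncated_conv n u (i + j) S + truncated_conv n u (i + k) S) / of_nat (n - 1)"
    proof -
      have "truncated_conv n u (l + j) S + truncated_conv n u (l + k) S = truncated_conv n u (i + j) S + truncated_conv n u (i + k) S + (of_nat i - of_nat l) * Q"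
        using truncated_conv_exchange[OF S, of u] unfolding Q_def by (simp add: algebra_simps)
      moreover have "- ((N - y) / N) * Q + A / N = - ((N - x) / N) * Q + B / N"
        if "N \<noteq> 0" "A = B + (x - y) * Q" for N A B x y :: complex
        using that by (simp add: field_simps)
      ultimately show ?thesis using n0 by blast
    qed
    thus ?thesis
      unfolding sum_eta_christ_rho[OF assms(1,2,4,3,5)] sum_eta_christ_rho[OF assms(1,2,5,3,4)]
        sum_eta_christ_rho[OF assms(1,3,4,2,5)] sum_eta_christ_rho[OF assms(1,3,5,2,4)] rho_deriv_def eta_series_inv_deriv_def exc
      by (simp only: dd ss if_True Q_def[symmetric]) (simp add: add_divide_distrib)
  next
    case False
    thus ?thesis
      unfolding sum_eta_christ_rho[OF assms(1,2,4,3,5)] sum_eta_christ_rho[OF assms(1,2,5,3,4)]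
        sum_eta_christ_rho[OF assms(1,3,4,2,5)] sum_eta_christ_rho[OF assms(1,3,5,2,4)] rho_deriv_def eta_series_inv_deriv_def exc
      by auto
  qed
qed

section \<open>The intersection form\<close>

lemma fps_cutoff_mult_nth:
  fixes F Q :: "complex fps"
  shows "fps_nth (fps_cutoff j F * Q) p = (\<Sum>h<j. fps_nth F h * (if h \<le> p then fps_nth Q (p - h) else 0))"
proof -
  have "fps_nth (fps_cutoff j F * Q) p = (\<Sum>h\<in>{..p} \<inter> {..<j}. fps_nth F h * fps_nth Q (p - h))"
    unfolding fps_mult_nth by (intro sum.mono_neutral_cong_right) auto
  also have "\<dots> = (\<Sum>h<j. fps_nth F h * (if h \<le> p then fps_nth Q (p - h) else 0))"
    by (intro sum.mono_neutral_cong_left) auto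
  finally show ?thesis .
qed

text \<open>Each cut-off is F minus its tail. The product of the two tails is divisible by x^(i+j),
  beyond degree m, and the rest simplifies by F Q = 1.\<close>

lemma cutoff_cutoff_inverse:
  fixes F Q :: "complex fps"
  assumes "F * Q = 1" "m < i + j"
  shows "fps_nth (fps_cutoff i F * (fps_cutoff j F * Q)) m
     = fps_nth F m * (1 - (if i \<le> m then 1 else 0) - (if j \<le> m then 1 else 0))"
proof -
  define H where "H i = F - fps_cutoff i F" for i
  have H: "H i = fps_X ^ i * fps_shift i F" for i
    using fps_shift_cutoff[of i F] by (simp add: H_def algebra_simps)
  have "fps_cutoff i F * (fps_cutoff j F * Q) = (F - H i) * ((F - H j) * Q)" by (simp add: H_def)
  also have "\<dots> = F * (F * Q) - H i * (F * Q) - H j * (F * Q) + H i * H j * Q" by (simp add: algebra_simps)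
  also have "\<dots> = F - H i - H j + fps_X ^ (i + j) * (fps_shift i F * fps_shift j F * Q)"
    unfolding assms(1) by (simp add: H power_add mult_ac)
  finally show ?thesis using assms(2) by (auto simp: fps_X_power_mult_nth H_def)
qed

text \<open>Multiplication by z^(n-1-k) with both indices raised. The range k < n includes k = 0,
  which is no coordinate, and avoids the exceptional value at a = b = k = n.\<close>

lemma sum_eta_metric_eta_metric_rho:
  assumes "n \<ge> 2" "i \<in> {1..n}" "j \<in> {1..n}" "k < n"
  shows "(\<Sum>a\<in>{1..n}. eta_metric n u i a * (\<Sum>b\<in>{1..n}. eta_metric n u j b * rho n u (a + b + k)))
     = (if k + 2 \<le> i + j then fps_nth (eta_series n u) (i + j - (k + 2)) *
          (1 - (if i \<le> i + j - (k + 2) then 1 else 0) - (if j \<le> i + j - (k + 2) then 1 else 0)) else 0)"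
proof -
  let ?D = "fps_nth (eta_series n u)" and ?R = "fps_nth (eta_series_inv n u)"
  define m where "m = i + j - (k + 2)"
  have r: "rho n u (h + (n + 1 - i) + (h' + (n + 1 - j)) + k)
     = (if k + 2 + h + h' \<le> i + j then ?R (m - h - h') else 0)" if "h < i" "h' < j" for h h'
  proof -
    have "h + (n + 1 - i) + (h' + (n + 1 - j)) + k \<noteq> 3 * n" using that assms by auto
    moreover have "h + (n + 1 - i) + (h' + (n + 1 - j)) + k \<le> 2 * n \<longleftrightarrow> k + 2 + h + h' \<le> i + j" using that assms by auto
    moreover have "2 * n - (h + (n + 1 - i) + (h' + (n + 1 - j)) + k) = m - h - h'" if "k + 2 + h + h' \<le> i + j"
      using that assms by (auto simp: m_def)
    ultimately show ?thesis by (simp add: rho_def)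
  qed
  have "(\<Sum>a\<in>{1..n}. eta_metric n u i a * (\<Sum>b\<in>{1..n}. eta_metric n u j b * rho n u (a + b + k)))
     = (\<Sum>h<i. ?D h * (\<Sum>h'<j. ?D h' * rho n u (h + (n + 1 - i) + (h' + (n + 1 - j)) + k)))"
    by (simp only: sum_eta_metric[OF assms(2)] sum_eta_metric[OF assms(3)])
  also have "\<dots> = (\<Sum>h<i. ?D h * (\<Sum>h'<j. ?D h' * (if k + 2 + h + h' \<le> i + j then ?R (m - h - h') else 0)))"
    by (rule sum.cong[OF refl], rule arg_cong[of _ _ "(*) _"], rule sum.cong[OF refl],
        rule arg_cong[of _ _ "(*) _"], rule r) auto
  also have "\<dots> = (if k + 2 \<le> i + j then ?D m * (1 - (if i \<le> m then 1 else 0) - (if j \<le> m then 1 else 0)) else 0)"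
  proof (cases "k + 2 \<le> i + j")
    case True
    have "(\<Sum>h<i. ?D h * (\<Sum>h'<j. ?D h' * (if k + 2 + h + h' \<le> i + j then ?R (m - h - h') else 0)))
       = (\<Sum>h<i. ?D h * (if h \<le> m then \<Sum>h'<j. ?D h' * (if h' \<le> m - h then ?R (m - h - h') else 0) else 0))"
    proof (rule sum.cong[OF refl])
      fix h
      have "k + 2 + h + h' \<le> i + j \<longleftrightarrow> h \<le> m \<and> h' \<le> m - h" for h' using True by (auto simp: m_def)
      thus "?D h * (\<Sum>h'<j. ?D h' * (if k + 2 + h + h' \<le> i + j then ?R (m - h - h') else 0))
        = ?D h * (if h \<le> m then \<Sum>h'<j. ?D h' * (if h' \<le> m - h then ?R (m - h - h') else 0) else 0)"
        by simp
    qed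
    also have "\<dots> = fps_nth (fps_cutoff i (eta_series n u) * (fps_cutoff j (eta_series n u) * eta_series_inv n u)) m"
      unfolding fps_cutoff_mult_nth[of i] fps_cutoff_mult_nth[of j] by simp
    also have "\<dots> = ?D m * (1 - (if i \<le> m then 1 else 0) - (if j \<le> m then 1 else 0))"
      by (rule cutoff_cutoff_inverse[OF eta_series_eta_series_inv]) (use True in \<open>auto simp: m_def\<close>)
    finally show ?thesis using True by simp
  next
    case False
    thus ?thesis by (auto intro!: sum.neutral)
  qed
  finally show ?thesis by (simp only: m_def)
qed

text \<open>Modulo Q the Euler field, the sum of k u_k z^(n-1-k) / (n-1), equals P': the difference
  is n/(n-1) times Q/z. In coefficients, n times \<open>rho_recurrence\<close> trades the index k =
  n for k = 0.\<close>

lemma sum_euler_field_rho: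
  assumes "n \<ge> 2" "u \<in> orbit_domain n" "N \<le> 2 * n + 1"
  shows "(\<Sum>k\<in>{1..n}. euler_field n u k * rho n u (N + k))
     = (\<Sum>k<n. of_nat (n - k) * (if k = 0 then 1 else u k) * rho n u (N + k))"
proof -
  let ?v = "\<lambda>k. of_nat (n - k) * (if k = 0 then 1 else u k)"
  have D: "of_nat n * fps_nth (eta_series n u) k = ?v k - euler_field n u k" if "k \<le> n" for k
    using that assms(1) by (auto simp: eta_series_def euler_field_def of_nat_diff field_simps)
  have "0 = of_nat n * (\<Sum>k\<le>n. fps_nth (eta_series n u) k * rho n u (N + k))"
    by (simp add: rho_recurrence[OF assms])
  also have "\<dots> = (\<Sum>k\<le>n. ?v k * rho n u (N + k)) - (\<Sum>k\<le>n. euler_field n u k * rho n u (N + k))"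
    unfolding sum_distrib_left sum_subtractf[symmetric]
    by (intro sum.cong refl) (simp add: D flip: mult.assoc left_diff_distrib)
  also have "(\<Sum>k\<le>n. ?v k * rho n u (N + k)) = (\<Sum>k<n. ?v k * rho n u (N + k))"
    by (rule sum.mono_neutral_right) auto
  also have "(\<Sum>k\<le>n. euler_field n u k * rho n u (N + k)) = (\<Sum>k\<in>{1..n}. euler_field n u k * rho n u (N + k))"
    by (rule sum.mono_neutral_right) (auto simp: euler_field_def)
  finally show ?thesis by simp
qed

lemma metric_row_eq_bezout_row: "metric_row s P = bezout_row s ([:0, 1:] * pderiv P - P) (pderiv P)"
proof -
  have "bezout_row s ([:0, 1:] * pderiv P + smult (- 1) P) (pderiv P)
     = smult (poly.coeff (pderiv P) s) (pderiv P) + smult (- 1) (bezout_row s P (pderiv P))"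
    by (simp only: bezout_row_add_left bezout_row_smult_left bezout_row_linear_factor)
  thus ?thesis by (simp add: metric_row_def)
qed

text \<open>The Bezoutian of Q and P' expanded in the coefficients (n - k) u_k of P', with u_0 = 1.
  The bracket of indicators comes from the two initial segments in
  \<open>coeff_bezout_row\<close>.\<close>

lemma orbit_metric_eq_sum:
  assumes "n \<ge> 2" "u \<in> orbit_domain n" "i \<in> {1..n}" "j \<in> {1..n}"
  shows "orbit_metric n (orbit_poly n u) i j = (\<Sum>k<n. of_nat (n - k) * (if k = 0 then 1 else u k) *
      (if k + 2 \<le> i + j then fps_nth (eta_series n u) (i + j - (k + 2)) *
          (1 - (if i \<le> i + j - (k + 2) then 1 else 0) - (if j \<le> i + j - (k + 2) then 1 else 0)) else 0))"
proof -
  let ?P = "orbit_poly n u" and ?D = "fps_nth (eta_series n u)"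
  define s t S where st: "s = n - i" "t = n - j" "S = s + t + 1"
  have S: "S + i + j = 2 * n + 1" using assms by (auto simp: st)
  define Q where "Q = [:0, 1:] * pderiv ?P - ?P"
  have Q: "poly.coeff Q l = of_nat (n - 1) * ?D (n - l)" if "l \<le> n" for l
  proof -
    have "poly.coeff ([:0, 1:] * pderiv ?P) l = of_nat l * poly.coeff ?P l"
      by (cases l) (simp_all add: coeff_pderiv)
    hence "poly.coeff Q l = (of_nat l - 1) * poly.coeff ?P l" by (simp add: Q_def algebra_simps)
    thus ?thesis using that assms(1) by (auto simp: coeff_orbit_poly eta_series_def of_nat_diff)
  qed
  have Q0: "poly.coeff Q l = 0" if "l > n" for l
    using that by (cases l) (auto simp: Q_def coeff_pderiv coeff_orbit_poly)
  define f where "f l = poly.coeff Q l * poly.coeff (pderiv ?P) (S - l)" for l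
  define w where "w l = (1 - (if l \<le> s then 1 else 0) - (if l \<le> t then 1 else 0) :: complex)" for l
  have "poly.coeff (metric_row s ?P) t = (\<Sum>l\<le>S. f l) - (\<Sum>l\<le>s. f l) - (\<Sum>l\<le>t. f l)"
    unfolding metric_row_eq_bezout_row coeff_bezout_row f_def Q_def st by simp
  also have "(\<Sum>l\<le>s. f l) = (\<Sum>l\<le>S. if l \<le> s then f l else 0)"
    by (intro sum.mono_neutral_cong_left) (auto simp: st)
  also have "(\<Sum>l\<le>t. f l) = (\<Sum>l\<le>S. if l \<le> t then f l else 0)"
    by (intro sum.mono_neutral_cong_left) (auto simp: st)
  also have "(\<Sum>l\<le>S. f l) - (\<Sum>l\<le>S. if l \<le> s then f l else 0) - (\<Sum>l\<le>S. if l \<le> t then f l else 0)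
     = (\<Sum>l\<le>S. f l * w l)"
    unfolding sum_subtractf[symmetric] by (intro sum.cong) (auto simp: w_def)
  also have "\<dots> = (\<Sum>l\<in>{l \<in> {..S}. S - l < n \<and> l \<le> n}. f l * w l)"
  proof (rule sum.mono_neutral_right)
    show "\<forall>l\<in>{..S} - {l \<in> {..S}. S - l < n \<and> l \<le> n}. f l * w l = 0"
    proof
      fix l assume "l \<in> {..S} - {l \<in> {..S}. S - l < n \<and> l \<le> n}"
      hence "n \<le> S - l \<or> n < l" by auto
      hence "f l = 0" using coeff_pderiv_eq_0[OF degree_orbit_poly[of n u], of "S - l"] Q0[of l] by (auto simp: f_def)
      thus "f l * w l = 0" by simp
    qed
  qed auto
  also have "\<dots> = (\<Sum>k\<in>{k \<in> {..<n}. k + 2 \<le> i + j \<and> i + j \<le> k + n + 2}. of_nat (n - k) * (if k = 0 then 1 else u k) *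
      (of_nat (n - 1) * (?D (i + j - (k + 2)) *
          (1 - (if i \<le> i + j - (k + 2) then 1 else 0) - (if j \<le> i + j - (k + 2) then 1 else 0)))))"
  \<comment> \<open>Here l is the exponent in Q and n - k - 1 the one in P'; they add up to S, that
    is l + i + j = k + n + 2.\<close>
  proof (rule sum.reindex_bij_witness[of _ "\<lambda>k. k + n + 2 - (i + j)" "\<lambda>l. l + (i + j) - (n + 2)"], goal_cases)
    case (5 l)
    define k where "k = l + (i + j) - (n + 2)"
    have k: "l + (i + j) = k + n + 2" "k < n" "k + 2 \<le> i + j" using 5 S by (auto simp: k_def)
    have l: "n - l = i + j - (k + 2)" "S - l + 1 = n - k" "l \<le> n" using k 5 S by auto
    have cond: "l \<le> s \<longleftrightarrow> i \<le> i + j - (k + 2)" "l \<le> t \<longleftrightarrow> j \<le> i + j - (k + 2)"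
      using k assms by (auto simp: st)
    have "poly.coeff (pderiv ?P) (S - l) = of_nat (n - k) * poly.coeff ?P (n - k)"
      using l(2) by (simp only: coeff_pderiv Suc_eq_plus1)
    also have "poly.coeff ?P (n - k) = (if k = 0 then 1 else u k)"
      using k by (auto simp: coeff_orbit_poly)
    finally have P': "poly.coeff (pderiv ?P) (S - l) = of_nat (n - k) * (if k = 0 then 1 else u k)" .
    show ?case
      unfolding k_def[symmetric] f_def w_def P' Q[OF l(3)] l(1) cond by (simp only: mult_ac)
  qed (use S assms in auto)
  also have "\<dots> = (\<Sum>k<n. of_nat (n - k) * (if k = 0 then 1 else u k) *
      (of_nat (n - 1) * (if k + 2 \<le> i + j then ?D (i + j - (k + 2)) *
          (1 - (if i \<le> i + j - (k + 2) then 1 else 0) - (if j \<le> i + j - (k + 2) then 1 else 0)) else 0)))"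
  proof (rule sum.mono_neutral_cong_left, simp, force, rule ballI, goal_cases)
    case (1 k)
    hence "k + 2 \<le> i + j \<Longrightarrow> i + j - (k + 2) > n" by auto
    thus ?case using eta_series_eq_0[OF assms(2), of "i + j - (k + 2)"] by (cases "k + 2 \<le> i + j") auto
  qed auto
  finally have eq: "poly.coeff (metric_row s ?P) t = (\<Sum>k<n. of_nat (n - k) * (if k = 0 then 1 else u k) *
      (of_nat (n - 1) * (if k + 2 \<le> i + j then ?D (i + j - (k + 2)) *
          (1 - (if i \<le> i + j - (k + 2) then 1 else 0) - (if j \<le> i + j - (k + 2) then 1 else 0)) else 0)))" .
  have cancel: "(\<Sum>k<n. f k * (N * g k)) / N = (\<Sum>k<n. f k * g k)" if "N \<noteq> 0" for f g :: "nat \<Rightarrow> complex" and N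
    using that by (simp add: sum_divide_distrib)
  have "of_nat (n - 1) \<noteq> (0 :: complex)" using assms(1) by simp
  thus ?thesis unfolding orbit_metric_def st(1,2)[symmetric] eq by (rule cancel)
qed

text \<open>Once \<open>sum_euler_field_rho\<close> has put P' in place of the Euler field, both
  sides are sums against (n - k) u_k that agree term by term.\<close>

lemma intersection_form_product_coeff:
  assumes "n \<ge> 2" "u \<in> orbit_domain n" "i \<in> {1..n}" "j \<in> {1..n}"
  shows "orbit_metric n (orbit_poly n u) i j = (\<Sum>k\<in>{1..n}. \<Sum>a\<in>{1..n}. euler_field n u k * eta_metric n u i a * product_coeff n u a k j)"
proof -
  have "(\<Sum>k\<in>{1..n}. \<Sum>a\<in>{1..n}. euler_field n u k * eta_metric n u i a * product_coeff n u a k j)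
     = (\<Sum>a\<in>{1..n}. \<Sum>k\<in>{1..n}. \<Sum>b\<in>{1..n}. eta_metric n u i a * (eta_metric n u j b * (euler_field n u k * rho n u (a + b + k))))"
    unfolding product_coeff_def by (subst sum.swap) (simp add: sum_distrib_left mult_ac add_ac)
  also have "\<dots> = (\<Sum>a\<in>{1..n}. \<Sum>b\<in>{1..n}. \<Sum>k\<in>{1..n}. eta_metric n u i a * (eta_metric n u j b * (euler_field n u k * rho n u (a + b + k))))"
    by (rule sum.cong[OF refl], rule sum.swap)
  also have "\<dots> = (\<Sum>a\<in>{1..n}. \<Sum>b\<in>{1..n}. eta_metric n u i a * (eta_metric n u j b * (\<Sum>k\<in>{1..n}. euler_field n u k * rho n u (a + b + k))))"
    by (simp only: sum_distrib_left)
  also have "\<dots> = (\<Sum>a\<in>{1..n}. \<Sum>b\<in>{1..n}. eta_metric n u i a * (eta_metric n u j b *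
       (\<Sum>k<n. of_nat (n - k) * (if k = 0 then 1 else u k) * rho n u (a + b + k))))"
    by (intro sum.cong refl, subst sum_euler_field_rho[OF assms(1,2)]) auto
  also have "\<dots> = (\<Sum>a\<in>{1..n}. \<Sum>b\<in>{1..n}. \<Sum>k<n. of_nat (n - k) * (if k = 0 then 1 else u k) *
       (eta_metric n u i a * (eta_metric n u j b * rho n u (a + b + k))))"
    unfolding sum_distrib_left by (intro sum.cong refl) (simp only: mult_ac)
  also have "\<dots> = (\<Sum>a\<in>{1..n}. \<Sum>k<n. \<Sum>b\<in>{1..n}. of_nat (n - k) * (if k = 0 then 1 else u k) *
       (eta_metric n u i a * (eta_metric n u j b * rho n u (a + b + k))))"
    by (rule sum.cong[OF refl], rule sum.swap)
  also have "\<dots> = (\<Sum>k<n. \<Sum>a\<in>{1..n}. \<Sum>b\<in>{1..n}. of_nat (n - k) * (if k = 0 then 1 else u k) *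
       (eta_metric n u i a * (eta_metric n u j b * rho n u (a + b + k))))"
    by (rule sum.swap)
  also have "\<dots> = (\<Sum>k<n. of_nat (n - k) * (if k = 0 then 1 else u k) *
       (\<Sum>a\<in>{1..n}. eta_metric n u i a * (\<Sum>b\<in>{1..n}. eta_metric n u j b * rho n u (a + b + k))))"
    by (simp only: sum_distrib_left)
  also have "\<dots> = orbit_metric n (orbit_poly n u) i j"
    unfolding orbit_metric_eq_sum[OF assms]
    by (rule sum.cong[OF refl], subst sum_eta_metric_eta_metric_rho[OF assms(1,3,4)]) auto
  finally show ?thesis by simp
qed


section \<open>Assembly of the Frobenius structure\<close>

lemma pd_eqI:
  assumes "\<forall>\<^sub>F t in nhds (x k). f (x(k := t)) = g (x(k := t))"
    and "((\<lambda>t. g (x(k := t))) has_field_derivative v) (at (x k))"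
  shows "pd k f x = v"
proof -
  have "deriv (\<lambda>t. f (x(k := t))) (x k) = deriv (\<lambda>t. g (x(k := t))) (x k)"
    using assms(1) by (intro deriv_cong_ev) auto
  thus ?thesis unfolding pd_def using DERIV_imp_deriv[OF assms(2)] by simp
qed

lemma product_coeff_has_derivative:
  assumes "n \<ge> 2" "x \<in> orbit_domain n" "l \<in> {1..n}" "k \<in> {1..n}"
  shows "((\<lambda>t. product_coeff n (x(l := t)) i j k) has_field_derivative
    (\<Sum>a\<in>{1..n}. (eta_contra n k a l + eta_contra n a k l) * rho n x (i + j + a) + eta_metric n x k a * rho_deriv n x l (i + j + a))) (at (x l))"
  unfolding product_coeff_def
proof (rule DERIV_sum)
  fix a assume a: "a \<in> {1..n}"
  show "((\<lambda>t. eta_metric n (x(l := t)) k a * rho n (x(l := t)) (i + j + a)) has_field_derivative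
     (eta_contra n k a l + eta_contra n a k l) * rho n x (i + j + a) + eta_metric n x k a * rho_deriv n x l (i + j + a)) (at (x l))"
    using DERIV_mult[OF eta_metric_has_derivative[OF assms(1,4) a assms(3), of x] rho_has_derivative[OF assms(2,3), of "i + j + a"]]
    by (simp add: mult.commute)
qed

text \<open>The weights of eta^{ka} and of rho(i+j+a) add up to a value in which a cancels.\<close>

lemma Euler_product_coeff:
  assumes "n \<ge> 2" "x \<in> orbit_domain n" "k \<in> {1..n}"
  shows "(\<Sum>l\<in>{1..n}. euler_field n x l *
      (\<Sum>a\<in>{1..n}. (eta_contra n k a l + eta_contra n a k l) * rho n x (i + j + a) + eta_metric n x k a * rho_deriv n x l (i + j + a)))
    = (of_nat n - 1 + of_nat k - of_nat i - of_nat j) / of_nat (n - 1) * product_coeff n x i j k"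
proof -
  have "(\<Sum>l\<in>{1..n}. euler_field n x l *
      (\<Sum>a\<in>{1..n}. (eta_contra n k a l + eta_contra n a k l) * rho n x (i + j + a) + eta_metric n x k a * rho_deriv n x l (i + j + a)))
    = (\<Sum>a\<in>{1..n}. (\<Sum>l\<in>{1..n}. euler_field n x l * (eta_contra n k a l + eta_contra n a k l)) * rho n x (i + j + a)
        + eta_metric n x k a * (\<Sum>l\<in>{1..n}. euler_field n x l * rho_deriv n x l (i + j + a)))"
    unfolding sum_distrib_left sum_distrib_right sum.distrib[symmetric]
    by (subst sum.swap, intro sum.cong refl) (simp add: algebra_simps)
  also have "\<dots> = (\<Sum>a\<in>{1..n}. (of_nat n - 1 + of_nat k - of_nat i - of_nat j) / of_nat (n - 1) * (eta_metric n x k a * rho n x (i + j + a)))"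
  proof (rule sum.cong[OF refl])
    fix a assume a: "a \<in> {1..n}"
    have lin: "p / N * E * r + E * (q / N * r) = (p + q) / N * (E * r)" for p q N E r :: complex
      by (simp add: add_divide_distrib algebra_simps)
    have pq: "of_nat k + of_nat a - of_nat n - 1 + (2 * of_nat n - of_nat (i + j + a))
        = (of_nat n - 1 + of_nat k - of_nat i - of_nat j :: complex)" by simp
    show "(\<Sum>l\<in>{1..n}. euler_field n x l * (eta_contra n k a l + eta_contra n a k l)) * rho n x (i + j + a)
        + eta_metric n x k a * (\<Sum>l\<in>{1..n}. euler_field n x l * rho_deriv n x l (i + j + a))
      = (of_nat n - 1 + of_nat k - of_nat i - of_nat j) / of_nat (n - 1) * (eta_metric n x k a * rho n x (i + j + a))"
      unfolding Euler_eta_metric[OF assms(1,3) a] Euler_rho[OF assms(1,2)] lin pq ..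
  qed
  finally show ?thesis unfolding product_coeff_def sum_distrib_left .
qed

lemma euler_field_has_derivative:
  "((\<lambda>t. euler_field n (x(a := t)) k) has_field_derivative (if k = a then of_nat k / of_nat (n - 1) else 0)) (at (x a))"
proof (cases "k = a")
  case True
  have "((\<lambda>t. of_nat k * t / of_nat (n - 1)) has_field_derivative of_nat k * 1 / of_nat (n - 1)) (at (x a))"
    by (intro DERIV_cdivide DERIV_cmult DERIV_ident)
  thus ?thesis using True by (simp add: euler_field_def)
qed (simp add: euler_field_def)

text \<open>The unit d/du_(n-1) is z^0. The charge comes from weights: eta_ij has weight
  (n+1-i-j)/(n-1) as a function and the Lie derivative adds (i+j)/(n-1), so 2 - d =
  (n+1)/(n-1).\<close>

lemma frobenius_structure_product_coeff:
  assumes n: "n \<ge> 2"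
    and H: "\<And>u i j. u \<in> orbit_domain n \<Longrightarrow> i \<in> {1..n} \<Longrightarrow> j \<in> {1..n} \<Longrightarrow> H u i j = eta_metric n u i j"
  shows "frobenius_structure n (orbit_domain n) H (product_coeff n) (\<lambda>x k. if k = n - 1 then 1 else 0) (euler_field n)
     ((of_nat n - 3) / of_nat (n - 1))"
proof -
  interpret eta: contravariant_flat n "orbit_domain n" H "\<lambda>x. eta_contra n" "\<lambda>m x i j k. 0"
    by (rule contravariant_flat_eta_metric) (use n H in auto)
  have inv: "(\<Sum>b\<in>{1..n}. H x a b * eta_lower n x b c) = (if a = c then 1 else 0)"
    if "x \<in> orbit_domain n" "a \<in> {1..n}" "c \<in> {1..n}" for x a c
    unfolding eta_metric_eta_lower[OF n that(2,3), of x, symmetric] by (intro sum.cong refl) (simp only: H[OF that(1,2)])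
  have nd: "nondeg n H x" if "x \<in> orbit_domain n" for x
    unfolding nondeg_def using inv[OF that] by blast
  have low: "lower n H x a c = eta_lower n x a c" if "x \<in> orbit_domain n" "a \<in> {1..n}" "c \<in> {1..n}" for x a c
    by (rule lower_eqI) (use that eta.metric_sym inv in blast)+
  have eta_christ: "christ n H x k i j = eta_christ n x k i j"
    if "x \<in> orbit_domain n" "k \<in> {1..n}" "i \<in> {1..n}" "j \<in> {1..n}" for x k i j
    unfolding eta.christ_eq[OF that(1) nd[OF that(1)] that(2-4)] eta.\<gamma>_def eta_christ_eq[OF n that(2-4), symmetric]
    using low[OF that(1,3)] by (intro arg_cong[of _ _ uminus] sum.cong) auto
  have clow: "clow n H (product_coeff n) x i j k = rho n x (i + j + k)"
    if "x \<in> orbit_domain n" "k \<in> {1..n}" for x i j k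
    unfolding clow_def sum_product_coeff_eta_lower[OF n that(2), symmetric] using low[OF that(1) _ that(2)] by (intro sum.cong) auto
  have pd_clow: "pd l (\<lambda>y. clow n H (product_coeff n) y i j k) x = rho_deriv n x l (i + j + k)"
    if "x \<in> orbit_domain n" "l \<in> {1..n}" "k \<in> {1..n}" for x i j k l
    by (rule pd_eqI[OF _ rho_has_derivative[OF that(1,2)]])
       (use eventually_orbit_domain[OF that(1,2)] in \<open>rule eventually_mono\<close>, rule clow[OF _ that(3)])
  have pd_low: "pd l (\<lambda>y. lower n H y i j) x = rho_deriv n x l (i + j + (n - 1))"
    if "x \<in> orbit_domain n" "l \<in> {1..n}" "i \<in> {1..n}" "j \<in> {1..n}" for x i j l
  proof (rule pd_eqI[OF _ rho_has_derivative[OF that(1,2)]])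
    show "\<forall>\<^sub>F t in nhds (x l). lower n H (x(l := t)) i j = rho n (x(l := t)) (i + j + (n - 1))"
      using eventually_orbit_domain[OF that(1,2)]
      by (rule eventually_mono) (use low[OF _ that(3,4)] in \<open>simp add: eta_lower_def\<close>)
  qed
  have pd_euler_field: "pd a (\<lambda>y. euler_field n y k) x = (if k = a then of_nat k / of_nat (n - 1) else 0)" for a k x
    unfolding pd_def by (rule DERIV_imp_deriv[OF euler_field_has_derivative])
  have pd_e: "pd a (\<lambda>y. if k = n - 1 then 1 else 0) x = 0" for a k x
    unfolding pd_def by (rule DERIV_imp_deriv[OF DERIV_const])
  have n0: "of_nat (n - 1) \<noteq> (0 :: complex)" using n by simp
  have n1: "n - 1 \<in> {1..n}" using n by auto
  have lowH: "(\<Sum>a\<in>{1..n}. product_coeff n x i j a * lower n H x a k) = rho n x (i + j + k)"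
    if "x \<in> orbit_domain n" "k \<in> {1..n}" for x i j k
    using clow[OF that, of i j] by (simp add: clow_def)
  show ?thesis
    unfolding frobenius_structure_def
  proof (intro conjI ballI)
    fix i j k assume "i \<in> {1..n}" "j \<in> {1..n}" "k \<in> {1..n}"
    show "holo_on n (orbit_domain n) (\<lambda>x. product_coeff n x i j k)"
      unfolding holo_on_def field_differentiable_def
      using product_coeff_has_derivative[OF n _ _ \<open>k \<in> {1..n}\<close>] by blast
  next
    fix k
    show "holo_on n (orbit_domain n) (\<lambda>x. if k = n - 1 then 1 else 0)"
      unfolding holo_on_def by simp
    show "holo_on n (orbit_domain n) (\<lambda>x. euler_field n x k)"
      unfolding holo_on_def field_differentiable_def using euler_field_has_derivative by blast
  next
    fix x i j k assume x: "x \<in> orbit_domain n" and ijk: "i \<in> {1..n}" "j \<in> {1..n}" "k \<in> {1..n}"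
    show "product_coeff n x i j k = product_coeff n x j i k" by (rule product_coeff_commute)
    have "(\<Sum>a\<in>{1..n}. lower n H x i a * product_coeff n x j k a) = (\<Sum>a\<in>{1..n}. product_coeff n x j k a * lower n H x a i)"
      using eta.lower_sym[OF x nd[OF x] ijk(1)] by (intro sum.cong) auto
    thus "(\<Sum>a\<in>{1..n}. product_coeff n x i j a * lower n H x a k) = (\<Sum>a\<in>{1..n}. lower n H x i a * product_coeff n x j k a)"
      unfolding lowH[OF x ijk(3)] lowH[OF x ijk(1)] by (simp add: add_ac)
  next
    fix x i j k l assume "x \<in> orbit_domain n" "i \<in> {1..n}" "j \<in> {1..n}" "k \<in> {1..n}" "l \<in> {1..n}"
    thus "(\<Sum>m\<in>{1..n}. product_coeff n x i j m * product_coeff n x m k l) = (\<Sum>m\<in>{1..n}. product_coeff n x j k m * product_coeff n x i m l)"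
      by (intro product_coeff_assoc n)
  next
    fix x j k assume x: "x \<in> orbit_domain n" and jk: "j \<in> {1..n}" "k \<in> {1..n}"
    have e: "(\<Sum>i\<in>{1..n}. (if i = n - 1 then 1 else 0) * f i) = f (n - 1)" for f :: "nat \<Rightarrow> complex"
      by (rule sum_unit_vector(1)[OF _ n1]) auto
    show "(\<Sum>i\<in>{1..n}. (if i = n - 1 then 1 else 0) * product_coeff n x i j k) = (if j = k then 1 else 0)"
      unfolding e by (rule product_coeff_unit[OF n jk])
    have e': "(\<Sum>i\<in>{1..n}. f i * (if i = n - 1 then 1 else 0)) = f (n - 1)" for f :: "nat \<Rightarrow> complex"
      by (rule sum_unit_vector(2)[OF _ n1]) auto
    \<comment> \<open>A nonzero entry would need j + n - 1 \<le> k, hence k = n, where the factor n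
      - k is 0.\<close>
    have "eta_christ n x k j (n - 1) = 0" using jk by (auto simp: eta_christ_def)
    thus "pd j (\<lambda>y. if k = n - 1 then 1 else 0) x + (\<Sum>i\<in>{1..n}. christ n H x k j i * (if i = n - 1 then 1 else 0)) = 0"
      unfolding e' pd_e eta_christ[OF x jk(2,1) n1] by simp
  next
    fix x l i j k assume x: "x \<in> orbit_domain n" and idx: "l \<in> {1..n}" "i \<in> {1..n}" "j \<in> {1..n}" "k \<in> {1..n}"
    have nab: "nabla_c n H (product_coeff n) x l i j k = rho_deriv n x l (i + j + k)
        - (\<Sum>a\<in>{1..n}. eta_christ n x a l j * rho n x (i + k + a)) - (\<Sum>a\<in>{1..n}. eta_christ n x a l k * rho n x (i + j + a))
        - (\<Sum>a\<in>{1..n}. eta_christ n x a l i * rho n x (j + k + a))"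
      if "l \<in> {1..n}" "i \<in> {1..n}" for l i
    proof -
      have "(\<Sum>a\<in>{1..n}. christ n H x a l i * clow n H (product_coeff n) x a j k + christ n H x a l j * clow n H (product_coeff n) x i a k
            + christ n H x a l k * clow n H (product_coeff n) x i j a)
         = (\<Sum>a\<in>{1..n}. eta_christ n x a l i * rho n x (j + k + a) + eta_christ n x a l j * rho n x (i + k + a) + eta_christ n x a l k * rho n x (i + j + a))"
        using that idx by (intro sum.cong refl) (simp add: eta_christ[OF x] clow[OF x] add_ac)
      thus ?thesis unfolding nabla_c_def pd_clow[OF x that(1) idx(4)] by (simp add: sum.distrib)
    qed
    \<comment> \<open>The term left out of \<open>nabla_rho_symmetric\<close> is symmetric in l and
      i by itself.\<close>
    have "eta_christ n x a l i = eta_christ n x a i l" for a by (simp add: eta_christ_def add.commute)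
    thus "nabla_c n H (product_coeff n) x l i j k = nabla_c n H (product_coeff n) x i l j k"
      unfolding nab[OF idx(1,2)] nab[OF idx(2,1)] nabla_rho_symmetric[OF n idx] by simp
  next
    fix x k assume x: "x \<in> orbit_domain n" and k: "k \<in> {1..n}"
    have "(\<Sum>i\<in>{1..n}. (if i = n - 1 then 1 else 0) * pd i (\<lambda>y. euler_field n y k) x - euler_field n x i * pd i (\<lambda>y. if k = n - 1 then 1 else 0) x)
       = (\<Sum>i\<in>{1..n}. (if i = n - 1 then 1 else 0) * (if k = i then of_nat k / of_nat (n - 1) else 0))"
      by (simp only: pd_e pd_euler_field mult_zero_right diff_zero)
    also have "\<dots> = (if k = n - 1 then of_nat k / of_nat (n - 1) else 0)"
      by (rule sum_unit_vector(1)[OF _ n1]) auto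
    \<comment> \<open>Division by n - 1 in \<open>euler_field\<close> gives u_(n-1) weight 1, so the
      bracket reproduces e.\<close>
    finally show "(\<Sum>i\<in>{1..n}. (if i = n - 1 then 1 else 0) * pd i (\<lambda>y. euler_field n y k) x - euler_field n x i * pd i (\<lambda>y. if k = n - 1 then 1 else 0) x)
       = (if k = n - 1 then 1 else 0)" using n0 by auto
  next
    fix x i j k assume x: "x \<in> orbit_domain n" and ijk: "i \<in> {1..n}" "j \<in> {1..n}" "k \<in> {1..n}"
    have pd_c: "pd l (\<lambda>y. product_coeff n y i j k) x = (\<Sum>a\<in>{1..n}. (eta_contra n k a l + eta_contra n a k l) * rho n x (i + j + a)
        + eta_metric n x k a * rho_deriv n x l (i + j + a))" if "l \<in> {1..n}" for l
      unfolding pd_def by (rule DERIV_imp_deriv[OF product_coeff_has_derivative[OF n x that ijk(3)]])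
    have Ec: "(\<Sum>a\<in>{1..n}. euler_field n x a * pd a (\<lambda>y. product_coeff n y i j k) x)
       = (of_nat n - 1 + of_nat k - of_nat i - of_nat j) / of_nat (n - 1) * product_coeff n x i j k"
      unfolding Euler_product_coeff[OF n x ijk(3), symmetric] by (intro sum.cong refl) (simp only: pd_c)
    have delta: "(\<Sum>a\<in>{1..n}. f a * (if a = m then of_nat a / of_nat (n - 1) else 0)) = of_nat m / of_nat (n - 1) * f m"
      "(\<Sum>a\<in>{1..n}. f a * (if m = a then of_nat m / of_nat (n - 1) else 0)) = of_nat m / of_nat (n - 1) * f m"
      if "m \<in> {1..n}" for f :: "nat \<Rightarrow> complex" and m
      using that by (simp_all add: if_distrib[of "(*) _"] mult.commute cong: if_cong)
    have "(\<Sum>a\<in>{1..n}. euler_field n x a * pd a (\<lambda>y. product_coeff n y i j k) x - product_coeff n x i j a * pd a (\<lambda>y. euler_field n y k) x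
            + product_coeff n x a j k * pd i (\<lambda>y. euler_field n y a) x + product_coeff n x i a k * pd j (\<lambda>y. euler_field n y a) x)
       = (of_nat n - 1 + of_nat k - of_nat i - of_nat j) / of_nat (n - 1) * product_coeff n x i j k
         - of_nat k / of_nat (n - 1) * product_coeff n x i j k + of_nat i / of_nat (n - 1) * product_coeff n x i j k + of_nat j / of_nat (n - 1) * product_coeff n x i j k"
      unfolding sum.distrib sum_subtractf Ec pd_euler_field delta[OF ijk(1)] delta[OF ijk(2)] delta[OF ijk(3)] ..
    \<comment> \<open>The weights of the three index directions cancel against that of the
      component, leaving (n - 1)/(n - 1).\<close>
    also have "\<dots> = (of_nat n - 1) / of_nat (n - 1) * product_coeff n x i j k"
    proof -
      have "(q + k - i - j) / N * C - k / N * C + i / N * C + j / N * C = q / N * C" for q k i j N C :: complex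
        by (simp add: diff_divide_distrib add_divide_distrib algebra_simps)
      thus ?thesis by this
    qed
    also have "\<dots> = product_coeff n x i j k" using n by (simp add: of_nat_diff)
    finally show "(\<Sum>a\<in>{1..n}. euler_field n x a * pd a (\<lambda>y. product_coeff n y i j k) x - product_coeff n x i j a * pd a (\<lambda>y. euler_field n y k) x
            + product_coeff n x a j k * pd i (\<lambda>y. euler_field n y a) x + product_coeff n x i a k * pd j (\<lambda>y. euler_field n y a) x) = product_coeff n x i j k" .
  next
    fix x i j assume x: "x \<in> orbit_domain n" and ij: "i \<in> {1..n}" "j \<in> {1..n}"
    have delta: "(\<Sum>a\<in>{1..n}. f a * (if a = m then of_nat a / of_nat (n - 1) else 0)) = of_nat m / of_nat (n - 1) * f m"
      if "m \<in> {1..n}" for f :: "nat \<Rightarrow> complex" and m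
      using that by (simp add: if_distrib[of "(*) _"] mult.commute cong: if_cong)
    have El: "(\<Sum>a\<in>{1..n}. euler_field n x a * pd a (\<lambda>y. lower n H y i j) x)
       = (2 * of_nat n - of_nat (i + j + (n - 1))) / of_nat (n - 1) * lower n H x i j"
      unfolding low[OF x ij] eta_lower_def Euler_rho[OF n x, symmetric]
      by (intro sum.cong refl) (simp only: pd_low[OF x _ ij])
    have "(\<Sum>a\<in>{1..n}. euler_field n x a * pd a (\<lambda>y. lower n H y i j) x + lower n H x a j * pd i (\<lambda>y. euler_field n y a) x
            + lower n H x i a * pd j (\<lambda>y. euler_field n y a) x)
       = (2 * of_nat n - of_nat (i + j + (n - 1))) / of_nat (n - 1) * lower n H x i j
         + of_nat i / of_nat (n - 1) * lower n H x i j + of_nat j / of_nat (n - 1) * lower n H x i j"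
      unfolding sum.distrib El pd_euler_field delta[OF ij(1)] delta[OF ij(2)] ..
    also have "\<dots> = (2 - (of_nat n - 3) / of_nat (n - 1)) * lower n H x i j"
    proof -
      have "(2 * of_nat n - of_nat (i + j + (n - 1))) / of_nat (n - 1) + of_nat i / of_nat (n - 1) + of_nat j / of_nat (n - 1)
         = (2 - (of_nat n - 3) / of_nat (n - 1) :: complex)"
      proof -
        have "(2 * (N + 1) - (p + q + N)) / N + p / N + q / N = 2 - (N + 1 - 3) / N" if "N \<noteq> 0" for N p q :: complex
          using that by (simp add: field_simps)
        from this[OF n0, of "of_nat i" "of_nat j"] show ?thesis
          using n by (simp only: of_nat_add) (simp add: of_nat_diff)
      qed
      thus ?thesis by (metis distrib_right)
    qed
    finally show "(\<Sum>a\<in>{1..n}. euler_field n x a * pd a (\<lambda>y. lower n H y i j) x + lower n H x a j * pd i (\<lambda>y. euler_field n y a) x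
            + lower n H x i a * pd j (\<lambda>y. euler_field n y a) x) = (2 - (of_nat n - 3) / of_nat (n - 1)) * lower n H x i j" .
  qed (use eta.is_cometric eta.flat_on nd in auto)
qed

theorem mainTheorem1:
  fixes n :: nat and G :: "(nat \<Rightarrow> complex) \<Rightarrow> nat \<Rightarrow> nat \<Rightarrow> complex"
  assumes "n \<ge> 2"
    and "\<forall>p. (\<forall>k\<in>{1..n}. p k \<noteq> 0) \<longrightarrow>
           (\<forall>i\<in>{1..n}. \<forall>j\<in>{1..n}. G (umap n p) i j = gBu n p i j / (4 * of_nat (n - 1)))"
  shows "flat_pencil n (orbit_domain n) G (\<lambda>u i j. pd (n - 1) (\<lambda>v. G v i j) u) \<and>
         (\<exists>c e E d. frobenius_structure n (orbit_domain n) (\<lambda>u i j. pd (n - 1) (\<lambda>v. G v i j) u) c e E d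
                   \<and> intersection_form_is n (orbit_domain n) (\<lambda>u i j. pd (n - 1) (\<lambda>v. G v i j) u) c E G)"
proof -
  define H where "H = (\<lambda>u i j. pd (n - 1) (\<lambda>v. G v i j) u)"
  have G: "G u i j = orbit_metric n (orbit_poly n u) i j" if "u \<in> orbit_domain n" "i \<in> {1..n}" "j \<in> {1..n}" for u i j
    by (rule G_eq_orbit_metric[OF assms that])
  have H: "H u i j = eta_metric n u i j" if "u \<in> orbit_domain n" "i \<in> {1..n}" "j \<in> {1..n}" for u i j
    unfolding H_def by (rule pd_G_eq_eta_metric[OF assms(1) G that])
  have "flat_pencil n (orbit_domain n) G H"
    by (rule flat_pencil_orbit_metric_eta_metric[OF assms(1) G H])
  moreover have "intersection_form_is n (orbit_domain n) H (product_coeff n) (euler_field n) G"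
    unfolding intersection_form_is_def
  proof (intro ballI)
    fix x i j assume x: "x \<in> orbit_domain n" and ij: "i \<in> {1..n}" "j \<in> {1..n}"
    show "G x i j = (\<Sum>k\<in>{1..n}. \<Sum>a\<in>{1..n}. euler_field n x k * H x i a * product_coeff n x a k j)"
      unfolding G[OF x ij] intersection_form_product_coeff[OF assms(1) x ij]
      using H[OF x ij(1)] by (intro sum.cong refl) simp
  qed
  moreover note frobenius_structure_product_coeff[OF assms(1) H]
  ultimately show ?thesis unfolding H_def[symmetric] by blast
qed

end
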